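(* Assume that $X_1$ satisfies (C) or (L), and that $\mathbf{E}|X_1|^4<\infty$. Let $y=y(n)$ and $z=z(n)$ be functions of $n$ with $y\in\mathcal L_n$ and $y-z\in\mathcal L_n$ for all $n$, such that $y\to\infty$, $y=o(\sqrt n)$, $z\to\infty$ and $z=o(\sqrt n)$ as $n\to\infty$. Then $$\lim_{n\to\infty}\frac{R_n(y-z,y)}{2yz/n}=1.$$
   Context: $X_1,X_2,\ldots$ are independent, identically distributed real random variables with $\mathbf{E}X_1=0$ and $\mathbf{E}X_1^2=1$. Put $S_0=T_0=0$ and, for $n\ge1$, $S_n=X_1+\cdots+X_n$, $T_n=\max(0,S_1,\ldots,S_n)$. Let $\phi(t)=\mathbf{E}e^{itX_1}$. Hypothesis (C): $X_1$ has a continuous distribution (with density $f$) and there is a positive integer $n_0$ with $\int_{-\infty}^{\infty}|\phi(t)|^{n_0}\,dt<\infty$. In this case $f_n$ is the density function of $S_n$, and $\mathcal L=\mathcal L_n=\mathbb R$. Hypothesis (L): $X_1$ has a lattice distribution. In this case $f(x)=\mathbf P(X_1=x)$, $f_n(x)=\mathbf P(S_n=x)$, the support of $f$ is contained in $\mathcal L=\{\gamma+m\lambda:m\in\mathbb Z\}$ where $\lambda>0$ is the maximal span (the support of $f$ is contained in no lattice $\{\gamma'+m\lambda':m\in\mathbb Z\}$ with $\lambda'>\lambda$), and $\mathcal L_n=\{n\gamma+m\lambda:m\in\mathbb Z\}$. $R_n(x,y)=\mathbf P[T_{n-1}<y\mid S_n=x]$ when $f_n(x)>0$, and $R_n(x,y)=1$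 when $f_n(x)=0$. That is, $R_n(x,y)=\widetilde R_n(x,y)/f_n(x)$ when $f_n(x)>0$, where $\widetilde R_n(x,y)=\mathbf P[T_{n-1}<y,\,S_n=x]$ in case (L), and $\widetilde R_n(x,y)=\frac{d}{dx}\mathbf P[T_{n-1}<y,\,S_n\le x]$ in case (C). Versions of densities in case (C): if $\int|\phi|<\infty$, $f$ is the bounded continuous version; $f_n$ is the $n$-fold convolution of $f$; for $y>0$, $\widetilde R_1(x,y)=f(x)$ and for $n\ge2$, $\widetilde R_n(x,y)=\int_{(-\infty,y)^{n-1}}f(s_1)f(s_2-s_1)\cdots f(s_{n-1}-s_{n-2})f(x-s_{n-1})\,ds_1\cdots ds_{n-1}$; for $y\le0$, $\widetilde R_n(x,y)=0$. At exceptional points where $f_n(x)=+\infty$ (possible only for small $n$), $R_n(x,y)$ is any value in $[0,1]$. *)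

theory Defs
  imports "HOL-Probability.Probability" "HOL-Library.Landau_Symbols"
begin

definition walk :: "(nat \<Rightarrow> 'a \<Rightarrow> real) \<Rightarrow> nat \<Rightarrow> 'a \<Rightarrow> real" where
  "walk X n \<omega> = (\<Sum>i=1..n. X i \<omega>)"

text \<open>Since \<open>walk X 0 = 0\<close>, this is \<open>max (0, S\<^sub>1, ..., S\<^sub>n)\<close>.\<close>
definition walk_max :: "(nat \<Rightarrow> 'a \<Rightarrow> real) \<Rightarrow> nat \<Rightarrow> 'a \<Rightarrow> real" where
  "walk_max X n \<omega> = Max ((\<lambda>k. walk X k \<omega>) ` {0..n})"

definition lattice_set :: "real \<Rightarrow> real \<Rightarrow> real set" where
  "lattice_set \<gamma> d = {\<gamma> + of_int m * d | m :: int. True}"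


subsection \<open>Continuous case\<close>

text \<open>When the characteristic function is integrable, \<open>f\<close> has to be the bounded continuous
  version of the density; otherwise any finite nonnegative version is allowed.\<close>
definition hyp_C :: "'a measure \<Rightarrow> (nat \<Rightarrow> 'a \<Rightarrow> real) \<Rightarrow> (real \<Rightarrow> real) \<Rightarrow> bool" where
  "hyp_C M X f \<longleftrightarrow>
     (let \<phi> = char (distr M borel (X 1)) in
       (\<forall>x. 0 \<le> f x) \<and>
       distributed M lborel (X 1) (\<lambda>x. ennreal (f x)) \<and>
       (\<exists>n0\<ge>1. integrable lborel (\<lambda>t. cmod (\<phi> t) ^ n0)) \<and>
       (integrable lborel (\<lambda>t. cmod (\<phi> t)) \<longrightarrow> continuous_on UNIV f \<and> bounded (range f)))"

text \<open>\<open>conv_pow f n\<close> is the pointwise \<open>n\<close>-fold convolution of \<open>f\<close>, possibly infinite at some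
  points; the value at \<open>n = 0\<close> is a dummy.\<close>
fun conv_pow :: "(real \<Rightarrow> real) \<Rightarrow> nat \<Rightarrow> real \<Rightarrow> ennreal" where
  "conv_pow f 0 x = 0"
| "conv_pow f (Suc 0) x = ennreal (f x)"
| "conv_pow f (Suc (Suc n)) x =
     (\<integral>\<^sup>+s. conv_pow f (Suc n) s * ennreal (f (x - s)) \<partial>lborel)"

text \<open>The path \<open>0, s\<^sub>1, ..., s\<^bsub>n-1\<^esub>, x\<close>.\<close>
definition bridge_path :: "nat \<Rightarrow> real \<Rightarrow> (nat \<Rightarrow> real) \<Rightarrow> nat \<Rightarrow> real" where
  "bridge_path n x s k = (if k = 0 then 0 else if k = n then x else s k)"

text \<open>The density in \<open>x\<close> of \<open>S\<^sub>n\<close> on the event \<open>T\<^bsub>n-1\<^esub> < y\<close>: the integral over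
  \<open>(s\<^sub>1, ..., s\<^bsub>n-1\<^esub>)\<close> with all coordinates below \<open>y\<close>. For \<open>n = 1\<close> the
  product measure is a point mass and the value is \<open>f x\<close>.\<close>
definition restr_density :: "(real \<Rightarrow> real) \<Rightarrow> nat \<Rightarrow> real \<Rightarrow> real \<Rightarrow> ennreal" where
  "restr_density f n x y =
     (if y \<le> 0 then 0
      else \<integral>\<^sup>+s. indicator {s. \<forall>i\<in>{1..<n}. s i < y} s *
             (\<Prod>i=1..n. ennreal (f (bridge_path n x s i - bridge_path n x s (i - 1))))
           \<partial>(Pi\<^sub>M {1..<n} (\<lambda>_. lborel)))"

text \<open>A predicate rather than a function: where the convolution is infinite, the conditional
  probability may take any value in the unit interval.\<close>
definition cond_prob_C :: "(real \<Rightarrow> real) \<Rightarrow> (nat \<Rightarrow> real \<Rightarrow> real \<Rightarrow> real) \<Rightarrow> bool" where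
  "cond_prob_C f R \<longleftrightarrow> (\<forall>n\<ge>1. \<forall>x y.
     (conv_pow f n x = 0 \<longrightarrow> R n x y = 1) \<and>
     (0 < conv_pow f n x \<and> conv_pow f n x < \<infinity> \<longrightarrow>
        R n x y = enn2real (restr_density f n x y / conv_pow f n x)) \<and>
     (conv_pow f n x = \<infinity> \<longrightarrow> 0 \<le> R n x y \<and> R n x y \<le> 1))"


subsection \<open>Lattice case\<close>

definition lattice_distribution :: "real measure \<Rightarrow> bool" where
  "lattice_distribution \<mu> \<longleftrightarrow> (\<exists>\<gamma> d. 0 < d \<and> (AE x in \<mu>. x \<in> lattice_set \<gamma> d))"

text \<open>\<open>d\<close> is the maximal span.\<close>
definition hyp_L ::
  "'a measure \<Rightarrow> (nat \<Rightarrow> 'a \<Rightarrow> real) \<Rightarrow> (real \<Rightarrow> real) \<Rightarrow> real \<Rightarrow> real \<Rightarrow> bool" where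
  "hyp_L M X f \<gamma> d \<longleftrightarrow>
     lattice_distribution (distr M borel (X 1)) \<and>
     (\<forall>x. f x = \<P>(\<omega> in M. X 1 \<omega> = x)) \<and>
     0 < d \<and> {x. f x > 0} \<subseteq> lattice_set \<gamma> d \<and>
     (\<forall>\<gamma>' d'. d < d' \<longrightarrow> \<not> {x. f x > 0} \<subseteq> lattice_set \<gamma>' d')"

definition cond_prob_L ::
  "'a measure \<Rightarrow> (nat \<Rightarrow> 'a \<Rightarrow> real) \<Rightarrow> (nat \<Rightarrow> real \<Rightarrow> real \<Rightarrow> real) \<Rightarrow> bool" where
  "cond_prob_L M X R \<longleftrightarrow> (\<forall>n\<ge>1. \<forall>x y. R n x y =
     (if \<P>(\<omega> in M. walk X n \<omega> = x) > 0
      then \<P>(\<omega> in M. walk_max X (n - 1) \<omega> < y \<bar> walk X n \<omega> = x)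
      else 1))"

end

theory Submission
  imports Defs
begin

text \<open>
  Measure positions by the distance \<open>u\<close> to the barrier, so that \<open>T\<^bsub>n-1\<^esub> < y\<close> says that the walk
  started at \<open>y\<close> stays positive. Let \<open>q\<^sub>n(y, z)\<close> be the density of its \<open>n\<close>-step transition from \<open>y\<close>
  to \<open>z\<close>; then \<open>R\<^sub>n(y - z, y) = q\<^sub>n(y, z) / f\<^sub>n(y - z)\<close>, and the local limit theorem gives the
  denominator.

  For the numerator, optional stopping for \<open>u\<close> together with a Lyapunov bound on the overshoot gives
  \<open>E[u\<^sub>m; alive] = y + o(y)\<close>, and the association inequality for monotone functions turns this into
  \<open>P(alive) = O(y / sqrt m)\<close>. The reflected Gaussian kernel \<open>g(x - v) - g(x + v)\<close> is almost preserved by a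
  step of the killed walk (Taylor expansion, comparing the step with a normal one), so
  that \<open>q\<^sub>N(y, v)\<close> equals the reflected kernel of variance \<open>N\<close> up to \<open>o(y / N)\<close>, uniformly in \<open>v\<close>; only
  the last few steps need the local limit theorem. Finally the last \<open>\<delta> n\<close> steps are read backwards
  from \<open>z\<close>: the reflected kernel is close to \<open>2 y v / (sqrt (2 pi) N sqrt N)\<close>, and summing \<open>v\<close> against
  the reversed killed walk gives \<open>z + o(z)\<close>.

  Densities and lattice probabilities are treated together, as densities with respect to Lebesgue
  measure, or to counting measure on a countable group containing all positions.
\<close>

section \<open>The walk killed outside a set\<close>

text \<open>The sizes of the errors dictate the shape of the argument. The reflected kernel
  describes \<open>q\<^sub>N(y, v)\<close> only up to \<open>\<delta> y / N\<close>, uniformly in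
  \<open>v\<close>, whereas the wanted quantity has the smaller order
  \<open>y z / (n sqrt n)\<close>. The error becomes harmless only after it is summed over those
  \<open>v\<close> from which the last \<open>m = \<delta> n\<close> steps lead to \<open>z\<close>
  without crossing the barrier: their total mass is \<open>O(z / sqrt (\<delta> n))\<close>, so that
  the relative error is of order \<open>sqrt \<delta>\<close>. Hence survival bounds linear in the
  starting height are needed for the walk and for its reversal. They rest on a Lyapunov function
  that exceeds the height by a term of square root order only, and on a lower bound for the mean
  positive part of the free walk, which the fourth moment provides. In the lattice case the
  positions \<open>y - S\<^sub>k\<close> pass through different cosets of the lattice. All of them
  lie in the group generated by offset and span, which is countable although it may be dense in the
  line; counting measure on it is invariant just as Lebesgue measure is, and the sets
  \<open>L n\<close> record in which coset the walk is.\<close>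

text \<open>With \<open>\<mu>\<close> the law of a step and \<open>S\<close> the walk, \<open>kill \<mu> B m g u\<close> is the expectation of
  \<open>g (u - S\<^sub>m)\<close> on the event that \<open>u - S\<^sub>k \<in> B\<close> for all \<open>k \<le> m\<close>.\<close>
primrec kill :: "real measure \<Rightarrow> real set \<Rightarrow> nat \<Rightarrow> (real \<Rightarrow> ennreal) \<Rightarrow> real \<Rightarrow> ennreal" where
  "kill \<mu> B 0 g u = g u * indicator B u"
| "kill \<mu> B (Suc m) g u = (\<integral>\<^sup>+x. kill \<mu> B m g (u - x) \<partial>\<mu>) * indicator B u"

text \<open>The recursion peels off the first step; this form peels off the last. With it and
  \<open>kill_mono\<close>, a one-step estimate for a function propagates to \<open>m\<close>
  steps.\<close>

lemma kill_Suc_right: "kill \<mu> B (Suc m) g u = kill \<mu> B m (kill \<mu> B (Suc 0) g) u"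
proof (induction m arbitrary: u)
  case 0
  then show ?case by (simp add: indicator_def)
next
  case (Suc m)
  have "kill \<mu> B (Suc (Suc m)) g u = (\<integral>\<^sup>+x. kill \<mu> B (Suc m) g (u - x) \<partial>\<mu>) * indicator B u"
    by (rule kill.simps(2))
  also have "\<dots> = kill \<mu> B (Suc m) (kill \<mu> B (Suc 0) g) u"
    unfolding Suc.IH by (rule kill.simps(2)[symmetric])
  finally show ?case .
qed

lemma kill_mono:
  assumes "\<And>u. u \<in> B \<Longrightarrow> g u \<le> h u"
  shows "kill \<mu> B m g u \<le> kill \<mu> B m h u"
proof (induction m arbitrary: u)
  case 0
  then show ?case using assms by (simp add: indicator_def)
next
  case (Suc m)
  then show ?case by (auto intro!: mult_right_mono nn_integral_mono)
qed

text \<open>This is \<open>(q - p) * (r - s) \<ge> 0\<close> multiplied out, without subtraction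
  because the values may be infinite.\<close>

lemma ennreal_rearrange:
  fixes p q r s :: ennreal
  assumes "p \<le> q" "s \<le> r"
  shows "p * r + q * s \<le> p * s + q * r"
proof -
  obtain c where c: "q = p + c" using assms(1) by (rule less_eqE)
  have "c * s \<le> c * r" using assms(2) by (rule mult_left_mono) simp
  then show ?thesis unfolding c by (simp add: distrib_right add.assoc add_left_mono add.left_commute)
qed

lemma kill_outside: "u \<notin> B \<Longrightarrow> kill \<mu> B m g u = 0"
  by (cases m) auto

context real_distribution
begin

lemma nn_integral_shift_measurable [measurable]:
  assumes [measurable]: "F \<in> borel_measurable borel"
  shows "(\<lambda>u. \<integral>\<^sup>+x. F (u - x) \<partial>M) \<in> borel_measurable borel"
  by measurable

lemma kill_measurable [measurable]:
  assumes [measurable]: "g \<in> borel_measurable borel" "B \<in> sets borel"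
  shows "kill M B m g \<in> borel_measurable borel"
  by (induction m) auto

lemma kill_add:
  assumes [measurable]: "g \<in> borel_measurable borel" "h \<in> borel_measurable borel" "B \<in> sets borel"
  shows "kill M B m (\<lambda>u. g u + h u) u = kill M B m g u + kill M B m h u"
proof (induction m arbitrary: u)
  case 0
  then show ?case by (simp add: distrib_right)
next
  case (Suc m)
  then show ?case by (simp add: nn_integral_add distrib_right)
qed

lemma kill_cmult:
  assumes [measurable]: "g \<in> borel_measurable borel" "B \<in> sets borel"
  shows "kill M B m (\<lambda>u. c * g u) u = c * kill M B m g u"
proof (induction m arbitrary: u)
  case 0
  then show ?case by (simp add: mult.assoc)
next
  case (Suc m)
  then show ?case by (simp add: nn_integral_cmult mult.assoc)
qed

text \<open>Run with the same steps, the path that starts higher stays higher, so it survives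
  whenever the lower one does.\<close>

lemma kill_mono_pos:
  assumes "mono g" "u \<le> v"
  shows "kill M {0<..} m g u \<le> kill M {0<..} m g v"
  using assms(2)
proof (induction m arbitrary: u v)
  case 0
  then show ?case using assms(1) by (auto simp: indicator_def monoD)
next
  case (Suc m)
  then have "(\<integral>\<^sup>+x. kill M {0<..} m g (u - x) \<partial>M) \<le> (\<integral>\<^sup>+x. kill M {0<..} m g (v - x) \<partial>M)"
    by (auto intro!: nn_integral_mono)
  then show ?case using Suc.prems by (auto simp: indicator_def)
qed

lemma kill_UNIV_mono:
  assumes "mono g" "u \<le> v"
  shows "kill M UNIV m g u \<le> kill M UNIV m g v"
  using assms(2)
proof (induction m arbitrary: u v)
  case 0
  then show ?case using assms(1) by (auto simp: monoD)
next
  case (Suc m)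
  then show ?case by (auto intro!: nn_integral_mono)
qed

text \<open>Chebyshev's association inequality: integrate the rearrangement inequality over an
  independent copy \<open>y\<close> of \<open>x\<close>. The functions decrease because a step
  \<open>x\<close> moves the walk from \<open>u\<close> to \<open>u - x\<close>.\<close>

lemma nn_integral_comonotone:
  fixes a b :: "real \<Rightarrow> ennreal"
  assumes [measurable]: "a \<in> borel_measurable borel" "b \<in> borel_measurable borel"
    and a: "\<And>x y. x \<le> y \<Longrightarrow> a y \<le> a x" and b: "\<And>x y. x \<le> y \<Longrightarrow> b y \<le> b x"
  shows "(\<integral>\<^sup>+x. a x \<partial>M) * (\<integral>\<^sup>+x. b x \<partial>M) \<le> (\<integral>\<^sup>+x. a x * b x \<partial>M)"
proof -
  have pw: "a x * b y + a y * b x \<le> a x * b x + a y * b y" for x y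
  proof (cases "x \<le> y")
    case True
    with ennreal_rearrange[OF a[OF True] b[OF True]] show ?thesis by (simp add: add.commute)
  next
    case False
    then have "y \<le> x" by simp
    with ennreal_rearrange[OF a[OF this] b[OF this]] show ?thesis by (simp add: add.commute)
  qed
  let ?a = "\<integral>\<^sup>+x. a x \<partial>M" and ?b = "\<integral>\<^sup>+x. b x \<partial>M" and ?c = "\<integral>\<^sup>+x. a x * b x \<partial>M"
  have "(\<integral>\<^sup>+x. (\<integral>\<^sup>+y. a x * b y + a y * b x \<partial>M) \<partial>M) \<le> (\<integral>\<^sup>+x. (\<integral>\<^sup>+y. a x * b x + a y * b y \<partial>M) \<partial>M)"
    using pw by (intro nn_integral_mono) auto
  then have "2 * (?a * ?b) \<le> 2 * ?c"
    by (simp add: nn_integral_add nn_integral_cmult nn_integral_multc emeasure_space_1[simplified] mult_2)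
  then show ?thesis by (subst (asm) ennreal_mult_le_mult_iff) auto
qed

end

text \<open>\<open>g\<close> may be negative, where the hypothesis says nothing; the comparison goes
  through its positive part. In this way integrals computed exactly from moments bound killed
  expectations from below.\<close>

lemma ennreal_integral_le:
  fixes g :: "'a \<Rightarrow> real"
  assumes "integrable M g" "\<And>x. ennreal (g x) \<le> H x"
  shows "ennreal (\<integral>x. g x \<partial>M) \<le> (\<integral>\<^sup>+x. H x \<partial>M)"
proof -
  have m: "integrable M (\<lambda>x. max 0 (g x))" using assms(1) by simp
  have "ennreal (\<integral>x. g x \<partial>M) \<le> ennreal (\<integral>x. max 0 (g x) \<partial>M)"
    using assms(1) m by (intro ennreal_leI integral_mono) auto
  also have "\<dots> = (\<integral>\<^sup>+x. ennreal (max 0 (g x)) \<partial>M)"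
    using m by (intro nn_integral_eq_integral[symmetric]) auto
  also have "\<dots> \<le> (\<integral>\<^sup>+x. H x \<partial>M)"
    using assms(2) by (intro nn_integral_mono) (auto simp: max_def ennreal_neg split: if_splits)
  finally show ?thesis .
qed

lemma nn_integral_le_ennreal:
  fixes g :: "'a \<Rightarrow> real"
  assumes "integrable M g" "\<And>x. 0 \<le> g x" "\<And>x. H x \<le> ennreal (g x)"
  shows "(\<integral>\<^sup>+x. H x \<partial>M) \<le> ennreal (\<integral>x. g x \<partial>M)"
proof -
  have "(\<integral>\<^sup>+x. H x \<partial>M) \<le> (\<integral>\<^sup>+x. ennreal (g x) \<partial>M)" using assms(3) by (intro nn_integral_mono) auto
  also have "\<dots> = ennreal (\<integral>x. g x \<partial>M)" using assms by (intro nn_integral_eq_integral) auto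
  finally show ?thesis .
qed

text \<open>The second-order Taylor polynomial of \<open>sqrt (1 - t)\<close> with a cubic error
  valid for every real \<open>t\<close>, beyond 1 as well, where the root is cut off to 0. The
  global range lets it be integrated against an unbounded step.\<close>

lemma sqrt_one_minus_le:
  fixes t :: real
  shows "sqrt (max 0 (1 - t)) \<le> 1 - t / 2 - t\<^sup>2 / 8 + \<bar>t\<bar> ^ 3"
proof -
  define s where "s = \<bar>t\<bar>"
  have s0: "0 \<le> s" and ts: "t \<le> s" "- s \<le> t" "t\<^sup>2 = s\<^sup>2" by (auto simp: s_def)
  have cub: "s ^ 3 \<ge> s\<^sup>2 - s / 4"
  proof -
    have "0 \<le> s * (s - 1/2)\<^sup>2" using s0 by simp
    then show ?thesis by (simp add: power2_eq_square power3_eq_cube algebra_simps)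
  qed
  have q: "0 \<le> 15/8 - t - s\<^sup>2 / 4 + s ^ 3"
  proof -
    have "0 \<le> (3 * s - 5/2)\<^sup>2" by simp
    then have "0 \<le> 15/8 - 5/4 * s + 3/4 * s\<^sup>2" by (simp add: power2_eq_square algebra_simps)
    with cub ts show ?thesis by linarith
  qed
  have r0: "0 \<le> 1 - t / 2 - t\<^sup>2 / 8 + s ^ 3"
    using q cub s0 ts(3) zero_le_power[OF s0, of 3] by linarith
  \<comment> \<open>Squaring the majorant leaves \<open>t^3 / 8\<close> and a multiple of
    \<open>s^3\<close> beyond \<open>1 - t\<close>. The constant \<open>15/8 = 2 - 1/8\<close> in
    \<open>q\<close> is what remains of the factor 2 after the possibly negative
    \<open>t^3 / 8\<close> has been absorbed.\<close>
  have "1 - t \<le> (1 - t / 2 - t\<^sup>2 / 8 + s ^ 3)\<^sup>2"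
  proof -
    have t3: "t ^ 3 \<ge> - (s ^ 3)" unfolding s_def by (cases "t \<ge> 0") (auto simp: power3_eq_cube)
    have "(1 - t / 2 - t\<^sup>2 / 8 + s ^ 3)\<^sup>2
        = (1 - t) + t ^ 3 / 8 + (t\<^sup>2)\<^sup>2 / 64 + s ^ 3 * (2 * (1 - t / 2 - t\<^sup>2 / 8) + s ^ 3)"
      by (simp add: power2_eq_square power3_eq_cube field_simps)
    also have "\<dots> \<ge> (1 - t) + s ^ 3 * (15/8 - t - s\<^sup>2 / 4 + s ^ 3)"
      using t3 ts(3) zero_le_power[OF s0, of 4]
      by (simp add: algebra_simps) (use zero_le_power[OF s0, of 4] in linarith)
    moreover have "s ^ 3 * (15/8 - t - s\<^sup>2 / 4 + s ^ 3) \<ge> 0" using q s0 by simp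
    ultimately show ?thesis by linarith
  qed
  then have "max 0 (1 - t) \<le> (1 - t / 2 - t\<^sup>2 / 8 + s ^ 3)\<^sup>2" by simp
  then show ?thesis using r0 unfolding s_def by (intro real_le_lsqrt) auto
qed

text \<open>The square root term makes \<open>overshoot_bound\<close> superharmonic up to the barrier: its concavity
  outweighs the jumps beyond \<open>- A\<close>.\<close>
definition overshoot_bound :: "real \<Rightarrow> real \<Rightarrow> real" where
  "overshoot_bound A u = max 0 (u + A) + sqrt (max 0 (u + A))"

lemma overshoot_bound_nonneg: "0 \<le> overshoot_bound A u"
  by (simp add: overshoot_bound_def)

lemma overshoot_bound_measurable [measurable]: "overshoot_bound A \<in> borel_measurable borel"
  unfolding overshoot_bound_def by measurable

section \<open>Moments, the Lyapunov function and the mean height of the killed walk\<close>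

locale fourth_moment_walk = real_distribution +
  assumes integrable_4: "integrable M (\<lambda>x. x ^ 4)"
    and mean_0: "(\<integral>x. x \<partial>M) = 0"
    and variance_1: "(\<integral>x. x\<^sup>2 \<partial>M) = 1"
begin

lemma prob_UNIV [simp]: "prob UNIV = 1"
  using prob_space by simp

lemma integrable_1 [simp]: "integrable M (\<lambda>x. x)"
proof (rule Bochner_Integration.integrable_bound)
  show "integrable M (\<lambda>x. 1 + x ^ 4)" using integrable_4 by simp
  have "\<bar>x\<bar> \<le> 1 + x ^ 4" for x :: real
    using power_increasing[of 1 4 "\<bar>x\<bar>"] by (cases "\<bar>x\<bar> \<le> 1") (auto simp: add_increasing2)
  then show "AE x in M. norm x \<le> norm (1 + x ^ 4)" by auto
qed auto

lemma integrable_2 [simp]: "integrable M (\<lambda>x. x\<^sup>2)"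
proof (rule Bochner_Integration.integrable_bound)
  show "integrable M (\<lambda>x. 1 + x ^ 4)" using integrable_4 by simp
  have "x\<^sup>2 \<le> 1 + x ^ 4" for x :: real
    using power_increasing[of 2 4 "\<bar>x\<bar>"] power_le_one[of "\<bar>x\<bar>" 2] 
    by (cases "\<bar>x\<bar> \<le> 1") (auto simp: abs_square_le_1 add_increasing2)
  then show "AE x in M. norm (x\<^sup>2) \<le> norm (1 + x ^ 4)" by auto
qed auto

lemma integrable_abs_3 [simp]: "integrable M (\<lambda>x. \<bar>x\<bar> ^ 3)"
proof (rule Bochner_Integration.integrable_bound)
  show "integrable M (\<lambda>x. 1 + x ^ 4)" using integrable_4 by simp
  have "\<bar>x\<bar> ^ 3 \<le> 1 + x ^ 4" for x :: real
    using power_increasing[of 3 4 "\<bar>x\<bar>"] power_le_one[of "\<bar>x\<bar>" 3] 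
    by (cases "\<bar>x\<bar> \<le> 1") (auto simp: add_increasing2)
  then show "AE x in M. norm (\<bar>x\<bar> ^ 3) \<le> norm (1 + x ^ 4)" by auto
qed auto

lemma integrable_3 [simp]: "integrable M (\<lambda>x. x ^ 3)"
  by (rule Bochner_Integration.integrable_bound[OF integrable_abs_3]) (auto simp: power_abs)

declare integrable_4 [simp]

lemma integral_shift_1 [simp]: "(\<integral>x. u - x \<partial>M) = u"
  by (simp add: mean_0)

lemma integral_shift_2 [simp]: "(\<integral>x. (u - x)\<^sup>2 \<partial>M) = u\<^sup>2 + 1"
  by (simp add: power2_diff mean_0 variance_1)

lemma integrable_shift_2 [simp]: "integrable M (\<lambda>x. (u - x)\<^sup>2)"
  by (simp add: power2_diff)

lemma shift_4: "(u - x) ^ 4 = u ^ 4 - 4 * u ^ 3 * x + 6 * u\<^sup>2 * x\<^sup>2 - 4 * u * x ^ 3 + (x::real) ^ 4"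
  by (simp add: power2_eq_square power3_eq_cube power4_eq_xxxx algebra_simps)

lemma integrable_shift_4 [simp]: "integrable M (\<lambda>x. (u - x) ^ 4)"
  by (simp add: shift_4)

definition "abs_moment_3 = (\<integral>x. \<bar>x\<bar> ^ 3 \<partial>M)"

lemma abs_moment_3_nonneg: "0 \<le> abs_moment_3"
  by (simp add: abs_moment_3_def)

text \<open>Write \<open>v = u + A\<close> and \<open>b\<close> for the absolute third moment. By
  unit variance the concavity of the root gains \<open>sqrt v / (8 v^2)\<close>. The costs are
  \<open>b / v^2\<close>, for cutting \<open>v - x\<close> off at 0, and
  \<open>b sqrt v / v^3\<close>, the cubic error of the root; together they are at most
  \<open>2 b / v^2\<close>. Thus \<open>sqrt v \<ge> 16 b\<close> suffices, whence the constant
  256.\<close>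

lemma overshoot_bound_superharmonic:
  assumes A: "A \<ge> 1" "A \<ge> 256 * abs_moment_3\<^sup>2" and u: "u > 0"
  shows "(\<integral>\<^sup>+x. ennreal (overshoot_bound A (u - x)) \<partial>M) \<le> ennreal (overshoot_bound A u)"
proof -
  define v where "v = u + A"
  have v: "v \<ge> 1" "v \<ge> 256 * abs_moment_3\<^sup>2" using A u by (auto simp: v_def)
  let ?b = "abs_moment_3"
  let ?m = "\<lambda>x. v - x + \<bar>x\<bar> ^ 3 / v\<^sup>2 + sqrt v * (1 - x / v / 2 - x\<^sup>2 / v\<^sup>2 / 8 + \<bar>x\<bar> ^ 3 / v ^ 3)"
  have pw: "overshoot_bound A (u - x) \<le> ?m x" for x
  proof -
    have "max 0 (v - x) \<le> v - x + \<bar>x\<bar> ^ 3 / v\<^sup>2"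
    proof (cases "x \<le> v")
      case False
      then have "x ^ 3 / v\<^sup>2 \<ge> x * v\<^sup>2 / v\<^sup>2"
        using v by (intro divide_right_mono) (auto simp: power3_eq_cube power2_eq_square intro!: mult_mono)
      then show ?thesis using False v by simp
    qed simp
    moreover have "sqrt (max 0 (v - x)) \<le> sqrt v * (1 - x / v / 2 - x\<^sup>2 / v\<^sup>2 / 8 + \<bar>x\<bar> ^ 3 / v ^ 3)"
    proof -
      have "max 0 (v - x) = v * max 0 (1 - x / v)" using v by (auto simp: max_def field_simps)
      then have "sqrt (max 0 (v - x)) = sqrt v * sqrt (max 0 (1 - x / v))" by (simp add: real_sqrt_mult)
      also have "\<dots> \<le> sqrt v * (1 - x / v / 2 - (x / v)\<^sup>2 / 8 + \<bar>x / v\<bar> ^ 3)"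
        using v by (intro mult_left_mono sqrt_one_minus_le) auto
      finally show ?thesis using v by (simp add: power_divide)
    qed
    ultimately show ?thesis unfolding overshoot_bound_def v_def by (simp add: algebra_simps)
  qed
  have m0: "0 \<le> ?m x" for x using pw[of x] overshoot_bound_nonneg[of A "u - x"] by linarith
  have int: "(\<integral>x. ?m x \<partial>M) = v + ?b / v\<^sup>2 + sqrt v * (1 - 1 / v\<^sup>2 / 8 + ?b / v ^ 3)"
    by (simp add: mean_0 variance_1 abs_moment_3_def)
  have le: "(\<integral>x. ?m x \<partial>M) \<le> v + sqrt v"
  proof -
    have s: "sqrt v \<ge> 16 * ?b"
      using v abs_moment_3_nonneg by (intro real_le_rsqrt) (auto simp: power2_eq_square)
    have s1: "sqrt v \<ge> 1" using v by simp
    have "?b / v\<^sup>2 + sqrt v * (?b / v ^ 3) = (?b + ?b * (sqrt v / v)) / v\<^sup>2"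
      using v by (simp add: field_simps power2_eq_square power3_eq_cube)
    also have "\<dots> \<le> (sqrt v / 8) / v\<^sup>2"
    proof (intro divide_right_mono)
      have "sqrt v / v \<le> 1" using v by (simp add: divide_le_eq sqrt_le_D real_le_lsqrt power2_eq_square)
      then have "?b * (sqrt v / v) \<le> ?b * 1" using abs_moment_3_nonneg by (intro mult_left_mono)
      then show "?b + ?b * (sqrt v / v) \<le> sqrt v / 8" using s by linarith
    qed simp
    finally show ?thesis unfolding int by (simp add: algebra_simps)
  qed
  have "(\<integral>\<^sup>+x. ennreal (overshoot_bound A (u - x)) \<partial>M) \<le> ennreal (\<integral>x. ?m x \<partial>M)"
    using pw m0 by (intro nn_integral_le_ennreal) (auto intro: ennreal_leI)
  also have "\<dots> \<le> ennreal (overshoot_bound A u)"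
    using le v u A by (intro ennreal_leI) (auto simp: overshoot_bound_def v_def)
  finally show ?thesis .
qed

definition "barrier_shift = max 1 (256 * abs_moment_3\<^sup>2)"

abbreviation "hb \<equiv> overshoot_bound barrier_shift"

abbreviation "surv \<equiv> kill M {0<..}"

lemma surv_hb: "surv m (\<lambda>u. ennreal (hb u)) u \<le> ennreal (hb u)"
proof (induction m arbitrary: u)
  case 0
  then show ?case by (simp add: indicator_def)
next
  case (Suc m)
  show ?case
  proof (cases "u > 0")
    case True
    have "(\<integral>\<^sup>+x. surv m (\<lambda>u. ennreal (hb u)) (u - x) \<partial>M) \<le> (\<integral>\<^sup>+x. ennreal (hb (u - x)) \<partial>M)"
      using Suc by (intro nn_integral_mono) auto
    also have "\<dots> \<le> ennreal (hb u)"
      using True by (intro overshoot_bound_superharmonic) (auto simp: barrier_shift_def)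
    finally show ?thesis using True by simp
  qed simp
qed

lemma surv_id_le: "surv m ennreal u \<le> ennreal (hb u)"
proof -
  have "surv m ennreal u \<le> surv m (\<lambda>u. ennreal (hb u)) u"
    by (intro kill_mono ennreal_leI) (auto simp: overshoot_bound_def barrier_shift_def)
  also have "\<dots> \<le> ennreal (hb u)" by (rule surv_hb)
  finally show ?thesis .
qed

text \<open>The mean height of the free walk is constant, and killing only removes paths at
  nonpositive heights.\<close>

lemma surv_id_ge: "ennreal u \<le> surv m ennreal u"
proof (induction m arbitrary: u)
  case 0
  then show ?case by (auto simp: indicator_def ennreal_neg)
next
  case (Suc m)
  have "ennreal u = ennreal (\<integral>x. u - x \<partial>M)" by simp
  also have "\<dots> \<le> (\<integral>\<^sup>+x. surv m ennreal (u - x) \<partial>M)"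
    using Suc by (intro ennreal_integral_le) auto
  finally show ?case by (auto simp: indicator_def ennreal_neg)
qed

text \<open>Survival and a high end point are both favoured by smaller steps, so they are positively
  correlated; the induction applies Chebyshev's inequality to one step at a time. With the positive
  part for \<open>g\<close>, a bound on the mean height of surviving paths becomes a bound on the
  survival probability.\<close>

lemma surv_association:
  assumes [measurable]: "g \<in> borel_measurable borel" and "mono g"
  shows "surv m (\<lambda>_. 1) u * kill M UNIV m g u \<le> surv m g u"
proof (induction m arbitrary: u)
  case 0
  then show ?case by (simp add: mult.commute)
next
  case (Suc m)
  show ?case
  proof (cases "u > 0")
    case True
    have "(\<integral>\<^sup>+x. surv m (\<lambda>_. 1) (u - x) \<partial>M) * (\<integral>\<^sup>+x. kill M UNIV m g (u - x) \<partial>M)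
       \<le> (\<integral>\<^sup>+x. surv m (\<lambda>_. 1) (u - x) * kill M UNIV m g (u - x) \<partial>M)"
      by (intro nn_integral_comonotone)
        (auto intro!: kill_mono_pos kill_UNIV_mono assms(2) simp: mono_def)
    also have "\<dots> \<le> (\<integral>\<^sup>+x. surv m g (u - x) \<partial>M)"
      using Suc by (intro nn_integral_mono) auto
    finally show ?thesis using True by simp
  qed simp
qed

text \<open>The positive part is \<open>(u + \<bar>u\<bar>) / 2\<close>, and
  \<open>\<bar>u\<bar> \<ge> u^2 / t - u^4 / t^3\<close> for every scale \<open>t\<close>. The mean
  of this polynomial along the free walk is controlled by moments up to order four, without any
  limit theorem.\<close>

lemma free_pos_part_ge:
  assumes t: "t > 0" and D: "D = 2 * (\<integral>x. x ^ 3 \<partial>M)\<^sup>2 + (\<integral>x. x ^ 4 \<partial>M)"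
  shows "ennreal (u / 2 + ((u\<^sup>2 + m) / t - (u ^ 4 + 8 * m * u\<^sup>2 + 4 * m\<^sup>2 + D * m) / t ^ 3) / 2)
     \<le> kill M UNIV m ennreal u"
proof (induction m arbitrary: u)
  case 0
  have "u / 2 + (u\<^sup>2 / t - u ^ 4 / t ^ 3) / 2 \<le> max 0 u"
  proof -
    define r where "r = \<bar>u\<bar> / t"
    have r: "r \<ge> 0" "\<bar>u\<bar> = r * t" using t by (auto simp: r_def)
    have "r\<^sup>2 - r ^ 4 \<le> r"
    proof (cases "r \<le> 1")
      case True
      then have "r\<^sup>2 \<le> r" using r by (simp add: power2_eq_square mult_left_le)
      then show ?thesis using zero_le_power[OF r(1), of 4] by linarith
    next
      case False
      then have "r\<^sup>2 \<le> r ^ 4" by (intro power_increasing) auto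
      then show ?thesis using r by linarith
    qed
    then have "t * (r\<^sup>2 - r ^ 4) \<le> t * r" using t by (intro mult_left_mono) auto
    moreover have "u\<^sup>2 / t - u ^ 4 / t ^ 3 = t * (r\<^sup>2 - r ^ 4)"
      using t by (simp add: r_def power_divide field_simps power2_eq_square power3_eq_cube power4_eq_xxxx)
    ultimately have "u\<^sup>2 / t - u ^ 4 / t ^ 3 \<le> \<bar>u\<bar>" using r by (simp add: mult.commute)
    moreover have "u / 2 + e / 2 \<le> max 0 u" if "e \<le> \<bar>u\<bar>" for e
      using that by (auto simp: abs_if max_def split: if_splits)
    ultimately show ?thesis by blast
  qed
  then have "ennreal (u / 2 + (u\<^sup>2 / t - u ^ 4 / t ^ 3) / 2) \<le> ennreal (max 0 u)" by (rule ennreal_leI)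
  then show ?case by (auto simp: max_def ennreal_neg split: if_splits)
next
  case (Suc m)
  let ?r = "\<lambda>m u. u / 2 + ((u\<^sup>2 + real m) / t - (u ^ 4 + 8 * real m * u\<^sup>2 + 4 * (real m)\<^sup>2 + D * real m) / t ^ 3) / 2"
  let ?m3 = "\<integral>x. x ^ 3 \<partial>M" and ?m4 = "\<integral>x. x ^ 4 \<partial>M"
  have int4: "(\<integral>x. (u - x) ^ 4 \<partial>M) = u ^ 4 + 6 * u\<^sup>2 - 4 * u * ?m3 + ?m4"
    by (simp add: shift_4 mean_0 variance_1)
  \<comment> \<open>The mixed term \<open>- 4 u m3\<close> is split as at most
    \<open>2 u^2 + 2 m3^2\<close>. This turns the natural coefficient 6 into 8 and puts the third
    moment into \<open>D\<close>.\<close>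
  have i4: "(\<integral>x. (u - x) ^ 4 \<partial>M) \<le> u ^ 4 + 8 * u\<^sup>2 + D"
  proof -
    have "0 \<le> 2 * (u + ?m3)\<^sup>2" by simp
    then show ?thesis unfolding int4 D by (simp add: power2_eq_square algebra_simps)
  qed
  have "?r (Suc m) u \<le> u / 2 + ((u\<^sup>2 + 1 + real m) / t
     - ((\<integral>x. (u - x) ^ 4 \<partial>M) + 8 * real m * (u\<^sup>2 + 1) + 4 * (real m)\<^sup>2 + D * real m) / t ^ 3) / 2"
  proof -
    have "((\<integral>x. (u - x) ^ 4 \<partial>M) + 8 * real m * (u\<^sup>2 + 1) + 4 * (real m)\<^sup>2 + D * real m) / t ^ 3
       \<le> (u ^ 4 + 8 * real (Suc m) * u\<^sup>2 + 4 * (real (Suc m))\<^sup>2 + D * real (Suc m)) / t ^ 3"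
      using t i4 by (intro divide_right_mono) (auto simp: power2_eq_square algebra_simps)
    moreover have "u\<^sup>2 + real (Suc m) = u\<^sup>2 + 1 + real m" by simp
    ultimately show ?thesis by (metis add_left_mono diff_left_mono divide_right_mono zero_le_numeral)
  qed
  also have "\<dots> = (\<integral>x. ?r m (u - x) \<partial>M)"
    by (simp add:)
  finally have "ennreal (?r (Suc m) u) \<le> ennreal (\<integral>x. ?r m (u - x) \<partial>M)" by (rule ennreal_leI)
  also have "\<dots> \<le> (\<integral>\<^sup>+x. kill M UNIV m ennreal (u - x) \<partial>M)"
    using Suc by (intro ennreal_integral_le) auto
  finally show ?case by simp
qed

lemma surv_one_bound: "\<exists>C>0. \<forall>m\<ge>1. \<forall>u. surv m (\<lambda>_. 1) u \<le> ennreal (C * hb u / sqrt m)"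
proof -
  define D where "D = 2 * (\<integral>x. x ^ 3 \<partial>M)\<^sup>2 + (\<integral>x. x ^ 4 \<partial>M)"
  have D0: "D \<ge> 0" by (auto simp: D_def intro!: add_nonneg_nonneg integral_nonneg)
  \<comment> \<open>With \<open>t = K * sqrt m\<close> this choice makes the quartic correction at
    most half of the leading term \<open>m / t\<close>.\<close>
  define K where "K = sqrt (2 * (4 + D))"
  have K: "K > 0" "K\<^sup>2 = 2 * (4 + D)" using D0 by (auto simp: K_def)
  have low: "ennreal (sqrt m / (4 * K)) \<le> kill M UNIV m ennreal u" if "m \<ge> 1" "u \<ge> 0" for m u
  proof -
    define t where "t = K * sqrt m"
    have t: "t > 0" "t\<^sup>2 = K\<^sup>2 * m" using K that by (auto simp: t_def power_mult_distrib)
    have "sqrt m / (4 * K) \<le> (m / t - (4 * m\<^sup>2 + D * m) / t ^ 3) / 2"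
    proof -
      have "(4 * m\<^sup>2 + D * m) / t ^ 3 \<le> ((4 + D) * m\<^sup>2) / t ^ 3"
        using t that D0 mult_left_mono[of "real m" "real m * real m" D]
        by (intro divide_right_mono) (auto simp: algebra_simps power2_eq_square)
      also have "\<dots> = (K\<^sup>2 * m) * m / (2 * t ^ 3)" unfolding K(2) using t by (simp add: field_simps power2_eq_square)
      also have "\<dots> = m / (2 * t)" unfolding t(2)[symmetric] using t K D0 by (simp add: power2_eq_square power3_eq_cube)
      finally have "(m / t - (4 * m\<^sup>2 + D * m) / t ^ 3) / 2 \<ge> m / (4 * t)" by simp
      moreover have "m / (4 * t) = (real m / sqrt m) / (4 * K)" by (simp add: t_def mult.commute mult.left_commute)
      then have "m / (4 * t) = sqrt m / (4 * K)" by (simp add: real_div_sqrt)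
      ultimately show ?thesis by simp
    qed
    then have "ennreal (sqrt m / (4 * K)) \<le> ennreal (0 / 2 + ((0\<^sup>2 + real m) / t - (0 ^ 4 + 8 * real m * 0\<^sup>2 + 4 * (real m)\<^sup>2 + D * real m) / t ^ 3) / 2)"
      by (intro ennreal_leI) auto
    also have "\<dots> \<le> kill M UNIV m ennreal 0" by (rule free_pos_part_ge[OF t(1) D_def])
    also have "\<dots> \<le> kill M UNIV m ennreal u" using that by (intro kill_UNIV_mono) (auto simp: mono_def ennreal_leI)
    finally show ?thesis .
  qed
  have "surv m (\<lambda>_. 1) u \<le> ennreal (4 * K * hb u / sqrt m)" if m: "m \<ge> 1" for m u
  proof (cases "u > 0")
    case True
    have "surv m (\<lambda>_. 1) u * ennreal (sqrt m / (4 * K)) \<le> surv m (\<lambda>_. 1) u * kill M UNIV m ennreal u"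
      using low[OF m] True by (intro mult_left_mono) auto
    also have "\<dots> \<le> surv m ennreal u" by (intro surv_association) (auto simp: mono_def ennreal_leI)
    also have "\<dots> \<le> ennreal (hb u)" by (rule surv_id_le)
    finally have "surv m (\<lambda>_. 1) u * ennreal (sqrt m / (4 * K)) * ennreal (4 * K / sqrt m)
       \<le> ennreal (hb u) * ennreal (4 * K / sqrt m)" by (intro mult_right_mono) auto
    moreover have "ennreal (sqrt m / (4 * K)) * ennreal (4 * K / sqrt m) = 1"
      using K m by (simp add: ennreal_mult[symmetric])
    moreover have "ennreal (hb u) * ennreal (4 * K / sqrt m) = ennreal (4 * K * hb u / sqrt m)"
      using K overshoot_bound_nonneg by (subst ennreal_mult[symmetric]) (auto simp: algebra_simps)
    ultimately show ?thesis by (simp add: mult.assoc)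
  next
    case False
    then show ?thesis by (simp add: kill_outside)
  qed
  then show ?thesis using K by (intro exI[of _ "4 * K"]) auto
qed

lemma surv_one_le_1: "surv m (\<lambda>_. 1) u \<le> 1"
proof (induction m arbitrary: u)
  case 0
  then show ?case by (simp add: indicator_def)
next
  case (Suc m)
  have "(\<integral>\<^sup>+x. surv m (\<lambda>_. 1) (u - x) \<partial>M) \<le> (\<integral>\<^sup>+x. 1 \<partial>M)"
    using Suc by (intro nn_integral_mono) auto
  also have "\<dots> = 1" by (simp add: emeasure_space_1[simplified])
  finally show ?case by (simp add: indicator_def)
qed

text \<open>Variance accumulates only while the walk is alive, so the second moment grows like
  \<open>u sqrt m\<close> and not like \<open>m\<close>. The gained factor \<open>u / sqrt m\<close>
  makes the quadratic correction of the reflected kernel negligible in the end.\<close>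

lemma surv_square_le:
  "surv m (\<lambda>u. ennreal (u\<^sup>2)) u \<le> ennreal (u\<^sup>2) + (\<Sum>k<m. surv k (\<lambda>_. 1) u)"
proof (induction m)
  case 0
  then show ?case by (simp add: indicator_def)
next
  case (Suc m)
  have one: "surv (Suc 0) (\<lambda>u. ennreal (u\<^sup>2)) u \<le> ennreal (u\<^sup>2) + 1" for u
  proof -
    have "(\<integral>\<^sup>+x. surv 0 (\<lambda>u. ennreal (u\<^sup>2)) (u - x) \<partial>M) \<le> ennreal (\<integral>x. (u - x)\<^sup>2 \<partial>M)"
      by (rule nn_integral_le_ennreal) (auto simp: indicator_def)
    then show ?thesis by (auto simp: indicator_def)
  qed
  have "surv (Suc m) (\<lambda>u. ennreal (u\<^sup>2)) u = surv m (surv (Suc 0) (\<lambda>u. ennreal (u\<^sup>2))) u"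
    by (rule kill_Suc_right)
  also have "\<dots> \<le> surv m (\<lambda>u. ennreal (u\<^sup>2) + 1) u" by (intro kill_mono one)
  also have "\<dots> = surv m (\<lambda>u. ennreal (u\<^sup>2)) u + surv m (\<lambda>_. 1) u" by (rule kill_add) auto
  also have "\<dots> \<le> ennreal (u\<^sup>2) + (\<Sum>k<m. surv k (\<lambda>_. 1) u) + surv m (\<lambda>_. 1) u"
    by (intro add_right_mono Suc)
  finally show ?case by (simp add: add.assoc)
qed

text \<open>A form of Kolmogorov's maximal inequality: the quotient is the mean of
  \<open>((u - a) / a)^2\<close> after the remaining \<open>m\<close> steps, and it is at least 1
  once the walk is at or below the barrier. For \<open>a = u\<close> the walk dies within
  \<open>m\<close> steps with probability at most \<open>m / u^2\<close>.\<close>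

lemma surv_one_ge:
  assumes a: "a > 0"
  shows "1 \<le> surv m (\<lambda>_. 1) u + ennreal (((u - a)\<^sup>2 + m) / a\<^sup>2)"
proof (induction m arbitrary: u)
  case 0
  show ?case
  proof (cases "u > 0")
    case False
    then have "a\<^sup>2 \<le> (u - a)\<^sup>2" using a by (intro iffD1[OF abs_le_square_iff]) auto
    then show ?thesis using False a by (simp add: ennreal_ge_1)
  qed simp
next
  case (Suc m)
  show ?case
  proof (cases "u > 0")
    case False
    then have "a\<^sup>2 \<le> (u - a)\<^sup>2" using a by (intro iffD1[OF abs_le_square_iff]) auto
    then show ?thesis using False a by (simp add: ennreal_ge_1)
  next
    case True
    have "1 = (\<integral>\<^sup>+x. 1 \<partial>M)" by (simp add: emeasure_space_1[simplified])
    also have "\<dots> \<le> (\<integral>\<^sup>+x. surv m (\<lambda>_. 1) (u - x) + ennreal (((u - x - a)\<^sup>2 + m) / a\<^sup>2) \<partial>M)"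
      using Suc by (intro nn_integral_mono) auto
    also have "\<dots> = surv (Suc m) (\<lambda>_. 1) u + (\<integral>\<^sup>+x. ennreal (((u - x - a)\<^sup>2 + m) / a\<^sup>2) \<partial>M)"
      using True by (simp add: nn_integral_add)
    also have "(\<integral>\<^sup>+x. ennreal (((u - x - a)\<^sup>2 + m) / a\<^sup>2) \<partial>M) \<le> ennreal (\<integral>x. (((u - a) - x)\<^sup>2 + m) / a\<^sup>2 \<partial>M)"
    proof -
      have "(\<integral>\<^sup>+x. ennreal (((u - x - a)\<^sup>2 + m) / a\<^sup>2) \<partial>M) = (\<integral>\<^sup>+x. ennreal ((((u - a) - x)\<^sup>2 + m) / a\<^sup>2) \<partial>M)"
        by (rule nn_integral_cong) (simp add: algebra_simps)
      also have "\<dots> \<le> ennreal (\<integral>x. (((u - a) - x)\<^sup>2 + m) / a\<^sup>2 \<partial>M)"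
        by (intro nn_integral_le_ennreal) auto
      finally show ?thesis .
    qed
    also have "(\<integral>x. (((u - a) - x)\<^sup>2 + m) / a\<^sup>2 \<partial>M) = ((u - a)\<^sup>2 + Suc m) / a\<^sup>2"
      by (simp add:)
    finally show ?thesis by (simp add: add_left_mono)
  qed
qed

text \<open>The mean overshoot of one step from \<open>u\<close>: it makes up for the drift of \<open>u\<close> under the killed walk.\<close>
definition "excess u = (\<integral>\<^sup>+x. ennreal (x - u) \<partial>M)"

lemma excess_measurable [measurable]: "excess \<in> borel_measurable borel"
  unfolding excess_def[abs_def] by measurable

lemma nn_integral_pos_part_shift:
  assumes "u > 0"
  shows "(\<integral>\<^sup>+x. ennreal (u - x) \<partial>M) = ennreal u + excess u"
proof -
  have i: "integrable M (\<lambda>x. max 0 (u - x))" "integrable M (\<lambda>x. max 0 (x - u))" by auto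
  have e: "ennreal (max 0 z) = ennreal z" for z by (auto simp: max_def ennreal_neg)
  have "(\<integral>x. max 0 (u - x) \<partial>M) - (\<integral>x. max 0 (x - u) \<partial>M) = (\<integral>x. u - x \<partial>M)"
  proof -
    have "(\<integral>x. max 0 (u - x) - max 0 (x - u) \<partial>M) = (\<integral>x. u - x \<partial>M)"
      by (intro Bochner_Integration.integral_cong) auto
    then show ?thesis using Bochner_Integration.integral_diff[OF i] by simp
  qed
  then have "(\<integral>x. max 0 (u - x) \<partial>M) = u + (\<integral>x. max 0 (x - u) \<partial>M)" by simp
  moreover have "(\<integral>\<^sup>+x. ennreal (u - x) \<partial>M) = ennreal (\<integral>x. max 0 (u - x) \<partial>M)"
    using i by (subst nn_integral_eq_integral[symmetric]) (auto simp: e)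
  moreover have "excess u = ennreal (\<integral>x. max 0 (x - u) \<partial>M)"
    unfolding excess_def using i by (subst nn_integral_eq_integral[symmetric]) (auto simp: e)
  ultimately show ?thesis using assms by (simp add: ennreal_plus[symmetric] del: ennreal_plus)
qed

lemma surv_id_eq:
  assumes "u > 0"
  shows "surv m ennreal u = ennreal u + (\<Sum>k<m. surv k excess u)"
proof (induction m)
  case 0
  then show ?case using assms by simp
next
  case (Suc m)
  have one: "surv (Suc 0) ennreal v = (ennreal v + excess v) * indicator {0<..} v" for v
  proof -
    have "(\<integral>\<^sup>+x. ennreal (v - x) * indicator {0<..} (v - x) \<partial>M) = (\<integral>\<^sup>+x. ennreal (v - x) \<partial>M)"
      by (intro nn_integral_cong) (auto simp: indicator_def ennreal_neg)
    then show ?thesis using nn_integral_pos_part_shift[of v] by (auto simp: indicator_def)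
  qed
  have "surv (Suc m) ennreal u = surv m (surv (Suc 0) ennreal) u" by (rule kill_Suc_right)
  also have "\<dots> = surv m (\<lambda>v. ennreal v + excess v) u"
    by (intro antisym kill_mono) (auto simp: one simp del: kill.simps)
  also have "\<dots> = surv m ennreal u + surv m excess u" by (rule kill_add) auto
  finally show ?case by (simp add: Suc add.assoc)
qed

text \<open>By \<open>surv_id_eq\<close> the mean height of the killed walk grows exactly by the
  accumulated overshoot, while \<open>hb u\<close> bounds it for all times. Hence the total expected
  overshoot is of square root order in \<open>u\<close>, uniformly in \<open>m\<close>.\<close>

lemma sum_surv_excess_le:
  assumes "u > 0"
  shows "(\<Sum>k<m. surv k excess u) \<le> ennreal (hb u - u)"
proof -
  have "ennreal u + (\<Sum>k<m. surv k excess u) \<le> ennreal u + ennreal (hb u - u)"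
  proof -
    have "ennreal u + ennreal (hb u - u) = ennreal (hb u)"
      using assms by (subst ennreal_plus[symmetric]) (auto simp: overshoot_bound_def barrier_shift_def)
    then show ?thesis using surv_id_le[of m u] surv_id_eq[OF assms, of m] by simp
  qed
  then show ?thesis by (subst (asm) ennreal_add_left_cancel_le) auto
qed

end

section \<open>Gaussian kernels\<close>

lemma ennreal_plus_le: "0 \<le> b \<Longrightarrow> ennreal (a + b) \<le> ennreal a + ennreal b"
  by (cases "0 \<le> a") (auto simp: ennreal_neg intro: ennreal_leI)

lemma sum_inverse_sqrt_le: "(\<Sum>k=1..<m. 1 / sqrt (real k)) \<le> 2 * sqrt (real m)"
proof -
  have "(\<Sum>k=1..m. 1 / sqrt (real k)) \<le> 2 * sqrt (real m)" for m
  proof (induction m)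
    case (Suc m)
    define a b where "a = sqrt (real m)" and "b = sqrt (real (Suc m))"
    have ab: "a\<^sup>2 + 1 = b\<^sup>2" "b > 0" by (auto simp: a_def b_def)
    have "2 * a * b + 1 \<le> 2 * b\<^sup>2"
      using ab zero_le_power2[of "a - b"] by (simp add: power2_diff)
    then have "2 * a + 1 / b \<le> 2 * b" using ab by (simp add: field_simps power2_eq_square)
    then show ?case using Suc unfolding a_def b_def by simp
  qed simp
  moreover have "(\<Sum>k=1..<m. 1 / sqrt (real k)) \<le> (\<Sum>k=1..m. 1 / sqrt (real k))"
    by (intro sum_mono2) auto
  ultimately show ?thesis by (meson order_trans)
qed

definition gauss :: "real \<Rightarrow> real \<Rightarrow> real" where
  "gauss s x = exp (- x\<^sup>2 / (2 * s)) / sqrt (2 * pi * s)"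

lemma gauss_normal_density: "s > 0 \<Longrightarrow> gauss s x = normal_density 0 (sqrt s) x"
  by (simp add: gauss_def normal_density_def)

lemma gauss_measurable [measurable]: "gauss s \<in> borel_measurable borel"
  unfolding gauss_def[abs_def] by measurable

lemma gauss_nonneg: "0 \<le> s \<Longrightarrow> 0 \<le> gauss s x"
  by (simp add: gauss_def)

lemma gauss_minus [simp]: "gauss s (- x) = gauss s x"
  by (simp add: gauss_def)

lemma gauss_antimono: "0 < s \<Longrightarrow> 0 \<le> x \<Longrightarrow> x \<le> y \<Longrightarrow> gauss s y \<le> gauss s x"
  by (auto simp: gauss_def intro!: divide_right_mono)

lemma sqrt_2pi_ge: "sqrt (2 * pi) \<ge> 2"
  using pi_ge_two by (intro real_le_rsqrt) auto

lemma gauss_scale: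
  assumes "s > 0"
  shows "gauss s x = exp (- (x / sqrt s)\<^sup>2 / 2) / sqrt (2 * pi) / sqrt s"
  using assms by (simp add: gauss_def real_sqrt_mult power_divide field_simps)

lemma gauss_le_peak: "0 < s \<Longrightarrow> gauss s x \<le> 1 / (sqrt (2 * pi) * sqrt s)"
  by (simp add: gauss_scale divide_right_mono)

lemma gauss_le: "0 < s \<Longrightarrow> gauss s x \<le> 1 / sqrt s"
proof -
  assume s: "0 < s"
  have "1 / (sqrt (2 * pi) * sqrt s) \<le> 1 / (1 * sqrt s)"
    using s sqrt_2pi_ge pi_ge_two by (intro divide_left_mono mult_right_mono) auto
  with gauss_le_peak[OF s, of x] show ?thesis by simp
qed

lemma gauss_deriv:
  assumes "s > 0"
  shows "(gauss s has_real_derivative (- x / s * gauss s x)) (at x)"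
  unfolding gauss_def[abs_def] using assms
  by (auto intro!: derivative_eq_intros simp: field_simps)

lemma gauss_deriv2:
  assumes "s > 0"
  shows "((\<lambda>x. - x / s * gauss s x) has_real_derivative ((x\<^sup>2 / s\<^sup>2 - 1 / s) * gauss s x)) (at x)"
  using assms by (auto intro!: derivative_eq_intros gauss_deriv simp: field_simps power2_eq_square)

lemma gauss_deriv3:
  assumes "s > 0"
  shows "((\<lambda>x. (x\<^sup>2 / s\<^sup>2 - 1 / s) * gauss s x) has_real_derivative
    ((3 * x / s\<^sup>2 - x ^ 3 / s ^ 3) * gauss s x)) (at x)"
  using assms by (auto intro!: derivative_eq_intros gauss_deriv simp: field_simps power2_eq_square power3_eq_cube)

lemma exp_neg_half_square_bound:
  fixes r :: real assumes "0 \<le> r"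
  shows "(r ^ 3 + 3 * r) * exp (- r\<^sup>2 / 2) \<le> 8" "r * exp (- r\<^sup>2 / 2) \<le> 1"
proof -
  have e: "1 + r\<^sup>2 / 2 + (r\<^sup>2 / 2)\<^sup>2 / 2 \<le> exp (r\<^sup>2 / 2)"
    by (rule exp_lower_Taylor_quadratic) simp
  have r4: "(r\<^sup>2 / 2)\<^sup>2 / 2 = r ^ 4 / 8" by (simp add: power_divide)
  have c: "r ^ 3 \<le> r\<^sup>2 / 2 + r ^ 4 / 2"
  proof -
    have "0 \<le> (r * (r - 1))\<^sup>2" by simp
    then show ?thesis by (simp add: power2_eq_square power3_eq_cube power4_eq_xxxx algebra_simps)
  qed
  have "0 \<le> r\<^sup>2 + 1 - 2 * r" using zero_le_power2[of "r - 1"] by (simp add: power2_diff)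
  then have q: "3 * r \<le> 3 + 3 * r\<^sup>2" "r \<le> 1 + r\<^sup>2 / 2" using zero_le_power2[of r] by linarith+
  have "r ^ 3 + 3 * r \<le> 8 * exp (r\<^sup>2 / 2)"
    using e r4 c q zero_le_power[OF assms, of 4] zero_le_power[OF assms, of 2] by linarith
  then show "(r ^ 3 + 3 * r) * exp (- r\<^sup>2 / 2) \<le> 8" by (simp add: exp_minus field_simps)
  have "r \<le> exp (r\<^sup>2 / 2)"
    using e r4 q zero_le_power[OF assms, of 4] by linarith
  then show "r * exp (- r\<^sup>2 / 2) \<le> 1" by (simp add: exp_minus field_simps)
qed

lemma gauss_deriv_bound:
  assumes "s > 0"
  shows "\<bar>- x / s * gauss s x\<bar> \<le> 1 / s"
proof -
  define r where "r = \<bar>x\<bar> / sqrt s"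
  have r: "r \<ge> 0" "\<bar>x\<bar> = r * sqrt s" "(x / sqrt s)\<^sup>2 = r\<^sup>2" using assms by (auto simp: r_def power_divide)
  have "\<bar>- x / s * gauss s x\<bar> = (r * exp (- r\<^sup>2 / 2)) / sqrt (2 * pi) / s"
    using assms by (simp add: gauss_scale abs_mult r(2) r(3))
  also have "\<dots> \<le> 1 / 1 / s"
    using exp_neg_half_square_bound(2)[OF r(1)] order_trans[OF one_le_numeral sqrt_2pi_ge] assms r(1)
    by (intro divide_right_mono frac_le) auto
  finally show ?thesis by simp
qed

lemma gauss_deriv3_bound:
  assumes "s > 0"
  shows "\<bar>(3 * x / s\<^sup>2 - x ^ 3 / s ^ 3) * gauss s x\<bar> \<le> 4 / s\<^sup>2"
proof -
  define r where "r = \<bar>x\<bar> / sqrt s"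
  have r: "r \<ge> 0" "\<bar>x\<bar> = r * sqrt s" "(x / sqrt s)\<^sup>2 = r\<^sup>2" using assms by (auto simp: r_def power_divide)
  have ss: "sqrt s ^ 3 = s * sqrt s" using assms by (simp add: power3_eq_cube)
  have "\<bar>3 * x / s\<^sup>2 - x ^ 3 / s ^ 3\<bar> \<le> 3 * \<bar>x\<bar> / s\<^sup>2 + \<bar>x\<bar> ^ 3 / s ^ 3"
    using abs_triangle_ineq4[of "3 * x / s\<^sup>2" "x ^ 3 / s ^ 3"] assms by (simp add: abs_mult power_abs)
  also have "\<dots> = (r ^ 3 + 3 * r) * sqrt s / s\<^sup>2"
    unfolding r(2) power_mult_distrib ss using assms by (simp add: field_simps power2_eq_square power3_eq_cube)
  finally have "\<bar>(3 * x / s\<^sup>2 - x ^ 3 / s ^ 3) * gauss s x\<bar> \<le> (r ^ 3 + 3 * r) * sqrt s / s\<^sup>2 * gauss s x"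
    using assms gauss_nonneg[of s x] unfolding abs_mult by (intro mult_mono) auto
  also have "\<dots> = ((r ^ 3 + 3 * r) * exp (- r\<^sup>2 / 2)) / sqrt (2 * pi) / s\<^sup>2"
    using assms by (simp add: gauss_scale r(3))
  also have "\<dots> \<le> 8 / 2 / s\<^sup>2"
    using exp_neg_half_square_bound(1)[OF r(1)] sqrt_2pi_ge assms r(1)
    by (intro divide_right_mono frac_le) auto
  finally show ?thesis by simp
qed

lemma gauss_lipschitz:
  assumes "s > 0"
  shows "\<bar>gauss s x - gauss s y\<bar> \<le> \<bar>x - y\<bar> / s"
proof -
  have *: "\<bar>gauss s x - gauss s y\<bar> \<le> \<bar>x - y\<bar> / s" if "x < y" for x y
  proof -
    have "\<exists>z>x. z < y \<and> gauss s y - gauss s x = (y - x) * (- z / s * gauss s z)"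
      by (rule MVT2[OF that gauss_deriv[OF assms]])
    then obtain z where "gauss s y - gauss s x = (y - x) * (- z / s * gauss s z)" by blast
    then have "\<bar>gauss s x - gauss s y\<bar> = \<bar>y - x\<bar> * \<bar>- z / s * gauss s z\<bar>"
      by (metis abs_minus_commute abs_mult)
    also have "\<dots> \<le> \<bar>y - x\<bar> * (1 / s)" by (intro mult_left_mono gauss_deriv_bound assms) auto
    finally show ?thesis by (simp add: abs_minus_commute)
  qed
  show ?thesis using *[of x y] *[of y x] by (cases x y rule: linorder_cases) (auto simp: abs_minus_commute)
qed

lemma gauss_taylor:
  assumes s: "s > 0"
  shows "\<bar>gauss s (x - t) - (gauss s x - t * (- x / s * gauss s x) + t\<^sup>2 / 2 * ((x\<^sup>2 / s\<^sup>2 - 1 / s) * gauss s x))\<bar>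
    \<le> \<bar>t\<bar> ^ 3 / s\<^sup>2"
proof -
  define diff :: "nat \<Rightarrow> real \<Rightarrow> real" where "diff = (\<lambda>m t. if m = 0 then gauss s (x - t)
    else if m = 1 then - (- (x - t) / s * gauss s (x - t))
    else if m = 2 then ((x - t)\<^sup>2 / s\<^sup>2 - 1 / s) * gauss s (x - t)
    else - ((3 * (x - t) / s\<^sup>2 - (x - t) ^ 3 / s ^ 3) * gauss s (x - t)))"
  have sh: "((\<lambda>t. F (x - t)) has_real_derivative - D) (at t)"
    if "(F has_real_derivative D) (at (x - t))" for F D t
      proof -
    have "((\<lambda>t. x - t) has_real_derivative -1) (at t)" by (auto intro!: derivative_eq_intros)
    from DERIV_chain2[where f = F and g = "\<lambda>t. x - t", OF that this] show ?thesis by simp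
  qed
  have "DERIV (diff m) t :> diff (Suc m) t" if "m < 3" for m t
  proof -
    consider "m = 0" | "m = 1" | "m = 2" using \<open>m < 3\<close> by linarith
    then show ?thesis
    proof cases
      case 1 then show ?thesis using sh[OF gauss_deriv[OF s]] by (simp add: diff_def)
    next
      case 2 then show ?thesis using DERIV_minus[OF sh[OF gauss_deriv2[OF s]]] by (simp add: diff_def)
    next
      case 3 then show ?thesis using sh[OF gauss_deriv3[OF s]] by (simp add: diff_def)
    qed
  qed
  then obtain z where z: "gauss s (x - t) = (\<Sum>m<3. diff m 0 / fact m * t ^ m) + diff 3 z / fact 3 * t ^ 3"
    using Maclaurin_bi_le[of diff "\<lambda>t. gauss s (x - t)" 3 t] by (auto simp: diff_def)
  have "\<bar>diff 3 z / fact 3 * t ^ 3\<bar> = \<bar>diff 3 z\<bar> / 6 * \<bar>t\<bar> ^ 3"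
    by (simp add: abs_mult power_abs fact_numeral)
  also have "\<dots> \<le> (4 / s\<^sup>2) / 6 * \<bar>t\<bar> ^ 3"
    using gauss_deriv3_bound[OF s, of "x - z"] by (intro mult_right_mono divide_right_mono) (auto simp: diff_def)
  also have "\<dots> \<le> \<bar>t\<bar> ^ 3 / s\<^sup>2" using s by (simp add: field_simps)
  finally show ?thesis unfolding z
    by (simp add: eval_nat_numeral diff_def mult_ac)
qed

text \<open>The method of images: for positive arguments this is the heat kernel at time
  \<open>s\<close> of Brownian motion killed at 0.\<close>

definition reflected :: "real \<Rightarrow> real \<Rightarrow> real \<Rightarrow> real" where
  "reflected s v x = gauss s (x - v) - gauss s (x + v)"

lemma reflected_measurable [measurable]: "reflected s v \<in> borel_measurable borel"
  unfolding reflected_def[abs_def] by measurable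

lemma reflected_eq:
  assumes "s > 0"
  shows "reflected s v x = gauss s (x - v) * (1 - exp (- (2 * x * v / s)))"
proof -
  have "- (x + v)\<^sup>2 / (2 * s) = - (x - v)\<^sup>2 / (2 * s) + - (2 * x * v / s)"
    using assms by (simp add: power2_eq_square field_simps)
  then have "gauss s (x + v) = gauss s (x - v) * exp (- (2 * x * v / s))"
    unfolding gauss_def by (simp add: exp_add[symmetric])
  then show ?thesis by (simp add: reflected_def algebra_simps)
qed

lemma reflected_nonneg: "s > 0 \<Longrightarrow> 0 \<le> v \<Longrightarrow> 0 \<le> x \<Longrightarrow> 0 \<le> reflected s v x"
  unfolding reflected_eq by (intro mult_nonneg_nonneg gauss_nonneg) auto

lemma reflected_nonpos:
  assumes "s > 0" "0 \<le> v" "x \<le> 0"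
  shows "reflected s v x \<le> 0"
proof -
  have "x * v \<le> 0" using assms by (intro mult_nonpos_nonneg) auto
  then have "2 * x * v / s \<le> 0" using assms(1) by (intro divide_nonpos_pos) (auto simp: mult_ac)
  then show ?thesis
    using assms(1) unfolding reflected_eq[OF assms(1)] by (intro mult_nonneg_nonpos gauss_nonneg) auto
qed

text \<open>At \<open>x = 0\<close> the two Gaussians agree, and each is Lipschitz with constant
  \<open>1 / s\<close>. Below the barrier the kernel is therefore negative at most in proportion to
  the overshoot.\<close>

lemma reflected_ge_linear: "s > 0 \<Longrightarrow> x \<le> 0 \<Longrightarrow> 2 / s * x \<le> reflected s v x"
  using gauss_lipschitz[of s "x - v" "- v"] gauss_lipschitz[of s "x + v" v]
  unfolding reflected_def by simp

lemma reflected_upper: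
  assumes "s > 0" "0 \<le> v" "0 \<le> x"
  shows "reflected s v x \<le> 2 * x * v / (sqrt (2 * pi) * s * sqrt s)"
proof -
  have "1 - exp (- (2 * x * v / s)) \<le> 2 * x * v / s"
    using exp_ge_add_one_self[of "- (2 * x * v / s)"] by simp
  then have "reflected s v x \<le> 1 / (sqrt (2 * pi) * sqrt s) * (2 * x * v / s)"
    unfolding reflected_eq[OF assms(1)] using assms
    by (intro mult_mono gauss_le_peak) auto
  then show ?thesis by (simp add: mult_ac)
qed

text \<open>In the scaled variables \<open>a\<close> and \<open>b\<close> the kernel is
  \<open>exp (- (a - b)^2 / 2) * (1 - exp (- 2 a b))\<close> up to normalisation. If
  \<open>a + b > 1\<close> the left side is not positive. Otherwise both factors are replaced by
  their Taylor minorants, and the relative loss is at most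
  \<open>(a^2 + b^2) / 2 \<le> a + b\<close>.\<close>

lemma reflected_lower:
  assumes "s > 0" "0 \<le> v" "0 \<le> x"
  shows "2 * x * v / (sqrt (2 * pi) * s * sqrt s) * (1 - (x + v) / sqrt s) \<le> reflected s v x"
proof -
  define a b where "a = x / sqrt s" and "b = v / sqrt s"
  have ab: "a \<ge> 0" "b \<ge> 0" using assms by (auto simp: a_def b_def)
  define t where "t = 2 * a * b"
  have t0: "t \<ge> 0" using ab by (simp add: t_def)
  have e: "exp (- t) \<le> 1 - t + t\<^sup>2 / 2"
  proof -
    have p: "1 + t + t\<^sup>2 / 2 \<le> exp t" by (rule exp_lower_Taylor_quadratic[OF t0])
    have q: "0 \<le> 1 - t + t\<^sup>2 / 2" using zero_le_power2[of "t - 1"] by (simp add: power2_diff)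
    have "1 \<le> (1 - t + t\<^sup>2 / 2) * (1 + t + t\<^sup>2 / 2)"
      using zero_le_power2[of "t\<^sup>2"] by (simp add: algebra_simps power2_eq_square)
    also have "\<dots> \<le> (1 - t + t\<^sup>2 / 2) * exp t" by (intro mult_left_mono p q)
    finally show ?thesis by (simp add: exp_minus field_simps)
  qed
  have key: "t * (1 - (a + b)) \<le> exp (- (a - b)\<^sup>2 / 2) * (1 - exp (- t))"
  proof (cases "a + b \<le> 1")
    case False
    then have "t * (1 - (a + b)) \<le> 0" using t0 by (intro mult_nonneg_nonpos) auto
    also have "0 \<le> exp (- (a - b)\<^sup>2 / 2) * (1 - exp (- t))" using t0 by simp
    finally show ?thesis .
  next
    case True
    have s1: "(a + b)\<^sup>2 \<le> a + b" using True ab by (simp add: power2_eq_square mult_left_le)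
    have sq: "(a + b)\<^sup>2 = a\<^sup>2 + b\<^sup>2 + t" "(a - b)\<^sup>2 = a\<^sup>2 + b\<^sup>2 - t" by (auto simp: t_def power2_sum power2_diff)
    have t1: "t \<le> 1" using s1 sq True zero_le_power2[of a] zero_le_power2[of b] by linarith
    have "t * (1 - (a + b)) \<le> t * (1 - t / 2 - (a - b)\<^sup>2 / 2)"
    proof (intro mult_left_mono)
      show "1 - (a + b) \<le> 1 - t / 2 - (a - b)\<^sup>2 / 2"
        using s1 ab t0 unfolding sq by (simp add: field_simps)
    qed (rule t0)
    also have "\<dots> \<le> t * ((1 - (a - b)\<^sup>2 / 2) * (1 - t / 2))"
    proof (intro mult_left_mono)
      have "0 \<le> (a - b)\<^sup>2 / 2 * (t / 2)" using t0 by (intro mult_nonneg_nonneg) auto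
      then show "1 - t / 2 - (a - b)\<^sup>2 / 2 \<le> (1 - (a - b)\<^sup>2 / 2) * (1 - t / 2)" by (simp add: algebra_simps)
    qed (use t0 in auto)
    also have "\<dots> = (1 - (a - b)\<^sup>2 / 2) * (t - t\<^sup>2 / 2)"
    proof -
      have "t * ((1 - q) * (1 - t / 2)) = (1 - q) * (t - t\<^sup>2 / 2)" for q
        by (simp add: power2_eq_square algebra_simps)
      then show ?thesis .
    qed
    also have "\<dots> \<le> exp (- (a - b)\<^sup>2 / 2) * (1 - exp (- t))"
    proof (intro mult_mono)
      show "1 - (a - b)\<^sup>2 / 2 \<le> exp (- (a - b)\<^sup>2 / 2)"
        using exp_ge_add_one_self[of "- (a - b)\<^sup>2 / 2"] by simp
      show "t - t\<^sup>2 / 2 \<le> 1 - exp (- t)" using e by simp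
      have "t * t \<le> t" using t0 t1 by (simp add: mult_left_le)
      then show "0 \<le> t - t\<^sup>2 / 2" using t0 by (simp add: power2_eq_square)
    qed simp
    finally show ?thesis .
  qed
  have ts: "t = 2 * x * v / s" using assms by (simp add: t_def a_def b_def)
  have "2 * x * v / (sqrt (2 * pi) * s * sqrt s) * (1 - (x + v) / sqrt s)
     = t * (1 - (a + b)) / (sqrt (2 * pi) * sqrt s)"
    by (simp add: ts a_def b_def add_divide_distrib)
  also have "\<dots> \<le> exp (- (a - b)\<^sup>2 / 2) * (1 - exp (- t)) / (sqrt (2 * pi) * sqrt s)"
    using assms by (intro divide_right_mono key) auto
  also have "\<dots> = reflected s v x"
    unfolding reflected_eq[OF assms(1)] gauss_scale[OF assms(1)] ts
    by (simp add: a_def b_def diff_divide_distrib)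
  finally show ?thesis .
qed

section \<open>Comparison of a step with a normal step\<close>

text \<open>The normal law belongs to the same class of steps, so the one-step expansion applies to
  it too, while its exact effect on a Gaussian is to raise the variance by 1.\<close>

lemma std_normal_walk: "fourth_moment_walk std_normal_distribution"
proof -
  interpret real_distribution std_normal_distribution by (rule real_dist_normal_dist)
  show ?thesis
  proof
    show "integrable std_normal_distribution (\<lambda>x. x ^ 4)"
      by (rule integrable_std_normal_distribution_moment)
    show "(\<integral>x. x \<partial>std_normal_distribution) = 0"
      using integral_std_normal_distribution_moment_odd[of 1] by simp
    show "(\<integral>x. x\<^sup>2 \<partial>std_normal_distribution) = 1"
      using std_normal_distribution_even_moments(1)[of 1] by simp
  qed
qed

lemma std_normal_gauss:
  assumes s: "s > 0"
  shows "(\<integral>x. gauss s (u - x) \<partial>std_normal_distribution) = gauss (s + 1) u"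
proof -
  have "(\<integral>\<^sup>+x. ennreal (gauss s (u - x)) \<partial>std_normal_distribution)
      = (\<integral>\<^sup>+x. ennreal (normal_density 0 (sqrt s) (u - x) * normal_density 0 1 x) \<partial>lborel)"
    using s by (subst nn_integral_density)
      (auto simp: gauss_normal_density normal_density_nonneg ennreal_mult[symmetric] mult.commute)
  also have "\<dots> = ennreal (gauss (s + 1) u)"
    using fun_cong[OF conv_normal_density_zero_mean[of "sqrt s" 1], of u] s
    by (simp add: gauss_normal_density)
  finally have "(\<integral>\<^sup>+x. ennreal (gauss s (u - x)) \<partial>std_normal_distribution) = ennreal (gauss (s + 1) u)" .
  then show ?thesis using s
    by (subst integral_eq_nn_integral) (auto simp: gauss_nonneg)
qed

context fourth_moment_walk
begin

definition "surv_const = (SOME C. C > 0 \<and> (\<forall>m\<ge>1. \<forall>u. surv m (\<lambda>_. 1) u \<le> ennreal (C * hb u / sqrt m)))"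

lemma surv_const: "surv_const > 0" "m \<ge> 1 \<Longrightarrow> surv m (\<lambda>_. 1) u \<le> ennreal (surv_const * hb u / sqrt m)"
  using someI_ex[OF surv_one_bound] unfolding surv_const_def[symmetric] by auto

lemma sum_surv_one_le: "(\<Sum>k<m. surv k (\<lambda>_. 1) u) \<le> ennreal (1 + 2 * surv_const * hb u * sqrt m)"
proof (cases "m = 0")
  case False
  then have "(\<Sum>k<m. surv k (\<lambda>_. 1) u) = surv 0 (\<lambda>_. 1) u + (\<Sum>k=1..<m. surv k (\<lambda>_. 1) u)"
    by (simp only: lessThan_atLeast0 sum.atLeast_Suc_lessThan One_nat_def)
  also have "\<dots> \<le> 1 + (\<Sum>k=1..<m. ennreal (surv_const * hb u / sqrt k))"
    using surv_const(2) by (intro add_mono surv_one_le_1 sum_mono) auto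
  also have "\<dots> = ennreal (1 + surv_const * hb u * (\<Sum>k=1..<m. 1 / sqrt k))"
  proof -
    have "(\<Sum>k=1..<m. ennreal (surv_const * hb u / sqrt k)) = ennreal (surv_const * hb u * (\<Sum>k=1..<m. 1 / sqrt k))"
      using surv_const(1) by (subst sum_ennreal) (auto simp: overshoot_bound_nonneg sum_distrib_left)
    moreover have "0 \<le> surv_const * hb u * (\<Sum>k=1..<m. 1 / sqrt k)"
      using surv_const(1) overshoot_bound_nonneg by (intro mult_nonneg_nonneg sum_nonneg) auto
    ultimately show ?thesis by (simp add: ennreal_plus)
  qed
  also have "\<dots> \<le> ennreal (1 + surv_const * hb u * (2 * sqrt m))"
    using surv_const(1) by (intro ennreal_leI add_left_mono mult_left_mono sum_inverse_sqrt_le) (auto simp: overshoot_bound_nonneg)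
  finally show ?thesis by (simp add: mult_ac)
qed simp

lemma gauss_integrable: "s > 0 \<Longrightarrow> integrable M (\<lambda>x. gauss s (u - x))"
  by (rule integrable_const_bound[where B = "1 / sqrt s"]) (auto simp: gauss_le gauss_nonneg)

lemma expectation_gauss_taylor:
  assumes s: "s > 0"
  shows "\<bar>(\<integral>x. gauss s (u - x) \<partial>M) - (gauss s u + (u\<^sup>2 / s\<^sup>2 - 1 / s) * gauss s u / 2)\<bar> \<le> abs_moment_3 / s\<^sup>2"
proof -
  let ?p = "\<lambda>x. gauss s u - x * (- u / s * gauss s u) + x\<^sup>2 / 2 * ((u\<^sup>2 / s\<^sup>2 - 1 / s) * gauss s u)"
  have p: "integrable M ?p" by (auto intro!: integrable_mult_left)
  have "(\<integral>x. ?p x \<partial>M) = gauss s u + (u\<^sup>2 / s\<^sup>2 - 1 / s) * gauss s u / 2"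
    by (simp add: mean_0 variance_1)
  note P = this
  have "\<bar>(\<integral>x. gauss s (u - x) \<partial>M) - (gauss s u + (u\<^sup>2 / s\<^sup>2 - 1 / s) * gauss s u / 2)\<bar>
     = \<bar>\<integral>x. gauss s (u - x) - ?p x \<partial>M\<bar>"
    unfolding Bochner_Integration.integral_diff[OF gauss_integrable[OF s] p] P ..
  also have "\<dots> \<le> (\<integral>x. \<bar>gauss s (u - x) - ?p x\<bar> \<partial>M)" by (rule integral_abs_bound)
  also have "\<dots> \<le> (\<integral>x. \<bar>x\<bar> ^ 3 / s\<^sup>2 \<partial>M)"
    using p gauss_integrable[OF s] by (intro integral_mono gauss_taylor[OF s]) auto
  also have "\<dots> = abs_moment_3 / s\<^sup>2" by (simp add: abs_moment_3_def)
  finally show ?thesis .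
qed

definition "caloric_const = 2 * (abs_moment_3 + fourth_moment_walk.abs_moment_3 std_normal_distribution)"

lemma caloric_const_nonneg: "0 \<le> caloric_const"
  using abs_moment_3_nonneg fourth_moment_walk.abs_moment_3_nonneg[OF std_normal_walk]
  by (simp add: caloric_const_def)

text \<open>Lindeberg's replacement: the step and the normal step have the same first two moments,
  hence the same second-order expansion, and differ only by cubic terms.\<close>

lemma gauss_caloric:
  assumes s: "s > 0"
  shows "\<bar>(\<integral>x. gauss s (u - x) \<partial>M) - gauss (s + 1) u\<bar> \<le> caloric_const / 2 / s\<^sup>2"
proof -
  have tri: "\<bar>a - p\<bar> \<le> c \<Longrightarrow> \<bar>b - p\<bar> \<le> d \<Longrightarrow> \<bar>a - b\<bar> \<le> c + d" for a b c d p :: real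
    by linarith
  show ?thesis
    using tri[OF expectation_gauss_taylor[OF s, of u]
      fourth_moment_walk.expectation_gauss_taylor[OF std_normal_walk s, of u]] std_normal_gauss[OF s, of u]
    by (simp add: caloric_const_def add_divide_distrib)
qed

lemma reflected_integrable: "s > 0 \<Longrightarrow> integrable M (\<lambda>x. reflected s v (u - x))"
  using gauss_integrable[of s "u - v"] gauss_integrable[of s "u + v"]
  unfolding reflected_def by (auto simp: algebra_simps)

lemma reflected_caloric:
  assumes s: "s > 0"
  shows "\<bar>(\<integral>x. reflected s v (u - x) \<partial>M) - reflected (s + 1) v u\<bar> \<le> caloric_const / s\<^sup>2"
proof -
  have "(\<integral>x. reflected s v (u - x) \<partial>M) = (\<integral>x. gauss s (u - v - x) \<partial>M) - (\<integral>x. gauss s (u + v - x) \<partial>M)"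
    unfolding reflected_def
    using gauss_integrable[OF s, of "u - v"] gauss_integrable[OF s, of "u + v"]
    by (subst Bochner_Integration.integral_diff[symmetric]) (auto simp: algebra_simps)
  then show ?thesis
    using gauss_caloric[OF s, of "u - v"] gauss_caloric[OF s, of "u + v"]
    unfolding reflected_def by (simp add: abs_le_iff)
qed

lemma surv_reflected_step_ge:
  assumes "s > 0" "v \<ge> 0" "u > 0"
  shows "ennreal (reflected (s + 1) v u) \<le> surv (Suc 0) (\<lambda>x. ennreal (reflected s v x)) u + ennreal (caloric_const / s\<^sup>2)"
proof -
  have "ennreal (reflected (s + 1) v u) \<le> ennreal ((\<integral>x. reflected s v (u - x) \<partial>M) + caloric_const / s\<^sup>2)"
    using reflected_caloric[OF assms(1), of v u] by (intro ennreal_leI) linarith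
  also have "\<dots> \<le> ennreal (\<integral>x. reflected s v (u - x) \<partial>M) + ennreal (caloric_const / s\<^sup>2)"
    by (rule ennreal_plus_le) (simp add: caloric_const_nonneg)
  also have "ennreal (\<integral>x. reflected s v (u - x) \<partial>M)
     \<le> (\<integral>\<^sup>+x. ennreal (reflected s v (u - x)) * indicator {0<..} (u - x) \<partial>M)"
    using assms reflected_nonpos[of s v]
    by (intro ennreal_integral_le reflected_integrable) (auto simp: indicator_def ennreal_neg)
  finally show ?thesis using assms by (simp add: add_right_mono)
qed

lemma excess_eq: "excess u = ennreal (\<integral>x. max 0 (x - u) \<partial>M)"
proof -
  have e: "ennreal (max 0 z) = ennreal z" for z by (auto simp: max_def ennreal_neg)
  show ?thesis
    unfolding excess_def by (subst nn_integral_eq_integral[symmetric]) (auto simp: e)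
qed

text \<open>Without killing the step preserves the kernel up to the caloric error. Killing discards
  the negative values below the barrier, a gain bounded by \<open>2 / s\<close> times the overshoot,
  whose mean is \<open>excess u\<close>. In the lower bound discarding them only helps, so no such
  term arises there.\<close>

lemma surv_reflected_step_le:
  assumes s: "s > 0" and v: "v \<ge> 0" and u: "u > 0"
  shows "surv (Suc 0) (\<lambda>x. ennreal (reflected s v x)) u
    \<le> ennreal (reflected (s + 1) v u) + ennreal (caloric_const / s\<^sup>2) + ennreal (2 / s) * excess u"
proof -
  let ?g = "\<lambda>x. reflected s v (u - x) + 2 / s * max 0 (x - u)"
  have g: "integrable M ?g" using reflected_integrable[OF s, of v u] by auto
  have g0: "0 \<le> ?g x" for x
    using reflected_nonneg[OF s v, of "u - x"] reflected_ge_linear[OF s, of "u - x" v] s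
    by (cases "x \<le> u") (auto simp: algebra_simps diff_divide_distrib)
  have "(\<integral>\<^sup>+x. ennreal (reflected s v (u - x)) * indicator {0<..} (u - x) \<partial>M) \<le> ennreal (\<integral>x. ?g x \<partial>M)"
    using g g0 s by (intro nn_integral_le_ennreal) (auto simp: indicator_def intro!: ennreal_leI)
  also have "(\<integral>x. ?g x \<partial>M) = (\<integral>x. reflected s v (u - x) \<partial>M) + 2 / s * (\<integral>x. max 0 (x - u) \<partial>M)"
    using reflected_integrable[OF s, of v u] by simp
  also have "ennreal \<dots> \<le> ennreal ((reflected (s + 1) v u + caloric_const / s\<^sup>2) + 2 / s * (\<integral>x. max 0 (x - u) \<partial>M))"
    using reflected_caloric[OF s, of v u] by (intro ennreal_leI add_right_mono) linarith
  also have "\<dots> = ennreal (reflected (s + 1) v u) + ennreal (caloric_const / s\<^sup>2) + ennreal (2 / s) * excess u"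
  proof -
    have "ennreal (2 / s * (\<integral>x. max 0 (x - u) \<partial>M)) = ennreal (2 / s) * excess u"
      unfolding excess_eq using s by (intro ennreal_mult) auto
    moreover have "0 \<le> 2 / s * (\<integral>x. max 0 (x - u) \<partial>M)" using s by (intro mult_nonneg_nonneg) auto
    moreover have "0 \<le> reflected (s + 1) v u" using s v u by (intro reflected_nonneg) auto
    moreover have "0 \<le> caloric_const / s\<^sup>2" using caloric_const_nonneg by simp
    ultimately show ?thesis by (simp only: ennreal_plus add_nonneg_nonneg)
  qed
  finally show ?thesis using u by simp
qed

text \<open>A step contributes its error only while the walk is alive, so the errors are weighted
  with survival probabilities. Their sum is of order \<open>u sqrt k\<close> instead of
  \<open>k\<close>, and this keeps the factor \<open>u\<close> in the final error. The final
  variance \<open>l\<close> has to stay away from 0, because the error of a step is of order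
  \<open>s^(-2)\<close>.\<close>

lemma surv_reflected_ge:
  assumes "l > 0" "v \<ge> 0" "u > 0" "l \<le> s"
  shows "ennreal (reflected (s + k) v u) \<le> surv k (\<lambda>x. ennreal (reflected s v x)) u
     + ennreal (caloric_const / l\<^sup>2) * (\<Sum>i<k. surv i (\<lambda>_. 1) u)"
  using assms(4)
proof (induction k arbitrary: s)
  case 0
  then show ?case using assms by simp
next
  case (Suc k)
  let ?c = "ennreal (caloric_const / l\<^sup>2)"
  have step: "ennreal (reflected (s + 1) v x) \<le> surv (Suc 0) (\<lambda>x. ennreal (reflected s v x)) x + ?c" if "x > 0" for x
  proof -
    have "caloric_const / s\<^sup>2 \<le> caloric_const / l\<^sup>2"
      using Suc.prems assms caloric_const_nonneg by (intro divide_left_mono) (auto intro!: power_mono)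
    then show ?thesis
      using surv_reflected_step_ge[of s v x] Suc.prems assms that
      by (meson add_left_mono ennreal_leI less_le_trans order_trans)
  qed
  have "ennreal (reflected (s + 1 + k) v u) \<le> surv k (\<lambda>x. ennreal (reflected (s + 1) v x)) u + ?c * (\<Sum>i<k. surv i (\<lambda>_. 1) u)"
    using Suc.IH[of "s + 1"] Suc.prems by simp
  also have "surv k (\<lambda>x. ennreal (reflected (s + 1) v x)) u
     \<le> surv k (\<lambda>x. surv (Suc 0) (\<lambda>x. ennreal (reflected s v x)) x + ?c * 1) u"
    using step by (intro kill_mono) auto
  also have "\<dots> = surv (Suc k) (\<lambda>x. ennreal (reflected s v x)) u + ?c * surv k (\<lambda>_. 1) u"
    by (simp add: kill_add kill_cmult kill_Suc_right[of _ _ k] del: kill.simps mult_1_right)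
  finally show ?case by (simp add: algebra_simps add.assoc distrib_left del: kill.simps)
qed

lemma surv_reflected_le:
  assumes "l > 0" "v \<ge> 0" "u > 0" "l \<le> s"
  shows "surv k (\<lambda>x. ennreal (reflected s v x)) u \<le> ennreal (reflected (s + k) v u)
     + ennreal (caloric_const / l\<^sup>2) * (\<Sum>i<k. surv i (\<lambda>_. 1) u)
     + ennreal (2 / l) * (\<Sum>i<k. surv i excess u)"
  using assms(4)
proof (induction k arbitrary: s)
  case 0
  then show ?case using assms by simp
next
  case (Suc k)
  let ?c = "ennreal (caloric_const / l\<^sup>2)" and ?d = "ennreal (2 / l)"
  have step: "surv (Suc 0) (\<lambda>x. ennreal (reflected s v x)) x \<le> ennreal (reflected (s + 1) v x) + ?c * 1 + ?d * excess x" if "x > 0" for x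
  proof -
    have "ennreal (caloric_const / s\<^sup>2) \<le> ?c"
      using Suc.prems assms caloric_const_nonneg by (intro ennreal_leI divide_left_mono) (auto intro!: power_mono)
    moreover have "ennreal (2 / s) \<le> ?d"
      using Suc.prems assms by (intro ennreal_leI divide_left_mono) auto
    ultimately have "ennreal (reflected (s + 1) v x) + ennreal (caloric_const / s\<^sup>2) + ennreal (2 / s) * excess x
       \<le> ennreal (reflected (s + 1) v x) + ?c * 1 + ?d * excess x"
      by (intro add_mono mult_right_mono) auto
    with surv_reflected_step_le[of s v x] Suc.prems assms that show ?thesis by (meson less_le_trans order_trans)
  qed
  have "surv (Suc k) (\<lambda>x. ennreal (reflected s v x)) u = surv k (surv (Suc 0) (\<lambda>x. ennreal (reflected s v x))) u"
    by (rule kill_Suc_right)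
  also have "\<dots> \<le> surv k (\<lambda>x. ennreal (reflected (s + 1) v x) + ?c * 1 + ?d * excess x) u"
    using step by (intro kill_mono) auto
  also have "\<dots> = surv k (\<lambda>x. ennreal (reflected (s + 1) v x)) u + ?c * surv k (\<lambda>_. 1) u + ?d * surv k excess u"
    by (simp add: kill_add kill_cmult del: mult_1_right)
  also have "surv k (\<lambda>x. ennreal (reflected (s + 1) v x)) u \<le> ennreal (reflected (s + 1 + k) v u)
     + ?c * (\<Sum>i<k. surv i (\<lambda>_. 1) u) + ?d * (\<Sum>i<k. surv i excess u)"
    using Suc.IH[of "s + 1"] Suc.prems by simp
  finally show ?case by (simp add: algebra_simps distrib_left add_right_mono del: kill.simps)
qed

end

section \<open>Transition densities\<close>

text \<open>The density with respect to \<open>\<rho>\<close>, at \<open>v\<close>, of \<open>w - S\<^sub>n\<close> on the event that \<open>w - S\<^sub>k \<in> B\<close> for all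
  \<open>k \<le> n\<close>; the value at \<open>n = 0\<close> is a dummy.\<close>
fun dens :: "real measure \<Rightarrow> (real \<Rightarrow> real) \<Rightarrow> real set \<Rightarrow> nat \<Rightarrow> real \<Rightarrow> real \<Rightarrow> ennreal" where
  "dens \<rho> f B 0 w v = 0"
| "dens \<rho> f B (Suc 0) w v = ennreal (f (w - v)) * indicator B w * indicator B v"
| "dens \<rho> f B (Suc (Suc n)) w v =
     (\<integral>\<^sup>+u. dens \<rho> f B (Suc n) w u * ennreal (f (u - v)) \<partial>\<rho>) * indicator B v"

lemma dens_outside: "w \<notin> B \<or> v \<notin> B \<Longrightarrow> dens \<rho> f B n w v = 0"
  by (induction \<rho> f B n w v rule: dens.induct) auto

lemma dens_Suc:
  assumes "n \<ge> 1"
  shows "dens \<rho> f B (Suc n) w v = (\<integral>\<^sup>+u. dens \<rho> f B n w u * dens \<rho> f B (Suc 0) u v \<partial>\<rho>)"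
proof -
  obtain k where k: "n = Suc k" using assms by (cases n) auto
  have "dens \<rho> f B n w u * dens \<rho> f B (Suc 0) u v = dens \<rho> f B n w u * ennreal (f (u - v)) * indicator B v" for u
    by (cases "u \<in> B") (auto simp: dens_outside mult_ac)
  then show ?thesis unfolding k by (cases "v \<in> B") (auto simp: k)
qed

lemma dens_mono_set: "B \<subseteq> C \<Longrightarrow> dens \<rho> f B n w v \<le> dens \<rho> f C n w v"
proof (induction \<rho> f B n w v rule: dens.induct)
  case (2 \<rho> f B w v)
  then show ?case by (auto simp: indicator_def)
next
  case (3 \<rho> f B n w v)
  then show ?case
    by (auto simp del: dens.simps(2) simp: indicator_def intro!: nn_integral_mono mult_right_mono)
qed auto

text \<open>Covers Lebesgue measure with \<open>G\<close> the whole line and counting measure on a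
  countable group. Reflections are the changes of variable of a walk \<open>w - S\<close>; two of
  them make a translation.\<close>

locale group_measure = sigma_finite_measure \<rho> for \<rho> :: "real measure" +
  fixes G :: "real set"
  assumes sets_ref [measurable_cong, simp]: "sets \<rho> = sets borel"
    and zero_in_G [simp]: "0 \<in> G"
    and diff_in_G: "a \<in> G \<Longrightarrow> b \<in> G \<Longrightarrow> a - b \<in> G"
    and AE_in_G: "AE x in \<rho>. x \<in> G"
    and distr_reflect: "a \<in> G \<Longrightarrow> distr \<rho> borel (\<lambda>x. a - x) = \<rho>"
begin

lemma space_ref [simp]: "space \<rho> = UNIV"
  using sets_eq_imp_space_eq[OF sets_ref] by simp

lemma nn_integral_reflect:
  assumes "a \<in> G" and [measurable]: "F \<in> borel_measurable borel"
  shows "(\<integral>\<^sup>+x. F (a - x) \<partial>\<rho>) = (\<integral>\<^sup>+x. F x \<partial>\<rho>)"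
proof -
  have "(\<integral>\<^sup>+x. F x \<partial>\<rho>) = (\<integral>\<^sup>+x. F x \<partial>distr \<rho> borel (\<lambda>x. a - x))"
    using distr_reflect[OF assms(1)] by simp
  also have "\<dots> = (\<integral>\<^sup>+x. F (a - x) \<partial>\<rho>)" by (rule nn_integral_distr) auto
  finally show ?thesis by simp
qed

lemma dens_measurable_pair:
  assumes [measurable]: "f \<in> borel_measurable borel" "B \<in> sets borel"
  shows "(\<lambda>p. dens \<rho> f B n (fst p) (snd p)) \<in> borel_measurable (borel \<Otimes>\<^sub>M borel)"
proof (induction n rule: nat_less_induct)
  case (1 n)
  consider "n = 0" | "n = Suc 0" | k where "n = Suc (Suc k)" by (metis not0_implies_Suc)
  then show ?case
  proof cases
    case 3
    have IH: "(\<lambda>p. dens \<rho> f B (Suc k) (fst p) (snd p)) \<in> borel_measurable (borel \<Otimes>\<^sub>M borel)"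
      using 1 3 by simp
    have [measurable]: "(\<lambda>q. dens \<rho> f B (Suc k) (fst (fst q)) (snd q)) \<in> borel_measurable ((borel \<Otimes>\<^sub>M borel) \<Otimes>\<^sub>M borel)"
      using measurable_compose[OF _ IH, of "\<lambda>q. (fst (fst q), snd q)" "(borel \<Otimes>\<^sub>M borel) \<Otimes>\<^sub>M borel"] by simp
    show ?thesis unfolding 3 dens.simps by measurable
  qed simp_all
qed

lemma dens_measurable [measurable (raw)]:
  assumes "f \<in> borel_measurable borel" "B \<in> sets borel" and [measurable]: "g \<in> borel_measurable N" "h \<in> borel_measurable N"
  shows "(\<lambda>x. dens \<rho> f B n (g x) (h x)) \<in> borel_measurable N"
  using measurable_compose[OF _ dens_measurable_pair[OF assms(1,2)], of "\<lambda>x. (g x, h x)" N] by simp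

lemma dens_semigroup:
  assumes [measurable]: "f \<in> borel_measurable borel" "B \<in> sets borel" and m: "m \<ge> 1" and k: "k \<ge> 1"
  shows "dens \<rho> f B (m + k) w v = (\<integral>\<^sup>+u. dens \<rho> f B m w u * dens \<rho> f B k u v \<partial>\<rho>)"
  using k
proof (induction k arbitrary: v rule: dec_induct)
  case base
  then show ?case using dens_Suc[OF m, of \<rho> f B w v] by simp
next
  case (step k)
  interpret pair_sigma_finite \<rho> \<rho> ..
  have "dens \<rho> f B (m + Suc k) w v = (\<integral>\<^sup>+u. dens \<rho> f B (m + k) w u * dens \<rho> f B (Suc 0) u v \<partial>\<rho>)"
    using dens_Suc[of "m + k" \<rho> f B w v] step by simp
  also have "\<dots> = (\<integral>\<^sup>+u. (\<integral>\<^sup>+t. dens \<rho> f B m w t * dens \<rho> f B k t u * dens \<rho> f B (Suc 0) u v \<partial>\<rho>) \<partial>\<rho>)"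
    unfolding step.IH by (intro nn_integral_cong nn_integral_multc[symmetric]) measurable
  also have "\<dots> = (\<integral>\<^sup>+t. (\<integral>\<^sup>+u. dens \<rho> f B m w t * dens \<rho> f B k t u * dens \<rho> f B (Suc 0) u v \<partial>\<rho>) \<partial>\<rho>)"
    by (rule Fubini') measurable
  also have "\<dots> = (\<integral>\<^sup>+t. dens \<rho> f B m w t * (\<integral>\<^sup>+u. dens \<rho> f B k t u * dens \<rho> f B (Suc 0) u v \<partial>\<rho>) \<partial>\<rho>)"
    by (subst nn_integral_cmult[symmetric]) (auto simp: mult.assoc simp del: dens.simps)
  also have "\<dots> = (\<integral>\<^sup>+t. dens \<rho> f B m w t * dens \<rho> f B (Suc k) t v \<partial>\<rho>)"
    using dens_Suc[of k \<rho> f B _ v] step by simp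
  finally show ?case .
qed

text \<open>A path read backwards stays in the same set \<open>B\<close> and has reversed steps.
  Integrals over the starting point thus become survival quantities of the reversed walk, to which
  all moment estimates apply.\<close>

lemma dens_reverse:
  assumes [measurable]: "f \<in> borel_measurable borel" "B \<in> sets borel" and n: "n \<ge> 1"
  shows "dens \<rho> f B n w v = dens \<rho> (\<lambda>x. f (- x)) B n v w"
  using n
proof (induction n arbitrary: v rule: dec_induct)
  case base
  then show ?case by (simp add: mult_ac)
next
  case (step n)
  have one: "dens \<rho> f B (Suc 0) u v = dens \<rho> (\<lambda>x. f (- x)) B (Suc 0) v u" for u
    by (simp add: mult_ac)
  have "dens \<rho> f B (Suc n) w v = (\<integral>\<^sup>+u. dens \<rho> f B n w u * dens \<rho> f B (Suc 0) u v \<partial>\<rho>)"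
    using dens_Suc step by simp
  also have "\<dots> = (\<integral>\<^sup>+u. dens \<rho> (\<lambda>x. f (- x)) B (Suc 0) v u * dens \<rho> (\<lambda>x. f (- x)) B n u w \<partial>\<rho>)"
    unfolding step.IH one by (simp only: mult.commute)
  also have "\<dots> = dens \<rho> (\<lambda>x. f (- x)) B (Suc 0 + n) v w"
    using step by (intro dens_semigroup[symmetric]) auto
  finally show ?case by simp
qed

lemma kill_one_eq_dens:
  assumes [measurable]: "f \<in> borel_measurable borel" "B \<in> sets borel" "g \<in> borel_measurable borel"
    and w: "w \<in> G"
  shows "kill (density \<rho> (\<lambda>x. ennreal (f x))) B (Suc 0) g w = (\<integral>\<^sup>+v. dens \<rho> f B (Suc 0) w v * g v \<partial>\<rho>)"
proof -
  have "(\<integral>\<^sup>+x. g (w - x) * indicator B (w - x) \<partial>density \<rho> (\<lambda>x. ennreal (f x)))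
    = (\<integral>\<^sup>+x. ennreal (f x) * (g (w - x) * indicator B (w - x)) \<partial>\<rho>)"
    by (rule nn_integral_density) auto
  also have "\<dots> = (\<integral>\<^sup>+x. (\<lambda>v. ennreal (f (w - v)) * (g v * indicator B v)) (w - x) \<partial>\<rho>)" by simp
  also have "\<dots> = (\<integral>\<^sup>+v. ennreal (f (w - v)) * (g v * indicator B v) \<partial>\<rho>)"
    by (rule nn_integral_reflect[OF w]) auto
  finally show ?thesis by (cases "w \<in> B") (auto simp: mult_ac)
qed

lemma kill_eq_dens:
  assumes "real_distribution (density \<rho> (\<lambda>x. ennreal (f x)))"
    and [measurable]: "f \<in> borel_measurable borel" "B \<in> sets borel" "g \<in> borel_measurable borel"
    and n: "n \<ge> 1" and w: "w \<in> G"
  shows "kill (density \<rho> (\<lambda>x. ennreal (f x))) B n g w = (\<integral>\<^sup>+v. dens \<rho> f B n w v * g v \<partial>\<rho>)"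
  using n assms(4)
proof (induction n arbitrary: g rule: dec_induct)
  case base
  then show ?case using kill_one_eq_dens[of f B g w] w by simp
next
  case (step n)
  interpret D: real_distribution "density \<rho> (\<lambda>x. ennreal (f x))" by fact
  interpret pair_sigma_finite \<rho> \<rho> ..
  note [measurable] = step.prems
  \<comment> \<open>The substitution in the one-step formula is allowed only at points of
    \<open>G\<close>; the other points form a null set.\<close>
  have one: "AE u in \<rho>. kill (density \<rho> (\<lambda>x. ennreal (f x))) B (Suc 0) g u = (\<integral>\<^sup>+v. dens \<rho> f B (Suc 0) u v * g v \<partial>\<rho>)"
    using AE_in_G by eventually_elim (intro kill_one_eq_dens; measurable)
  have m1 [measurable]: "(\<lambda>u. \<integral>\<^sup>+v. dens \<rho> f B (Suc 0) u v * g v \<partial>\<rho>) \<in> borel_measurable borel"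
    by measurable
  have "kill (density \<rho> (\<lambda>x. ennreal (f x))) B (Suc n) g w
      = kill (density \<rho> (\<lambda>x. ennreal (f x))) B n (kill (density \<rho> (\<lambda>x. ennreal (f x))) B (Suc 0) g) w"
    by (rule kill_Suc_right)
  also have "\<dots> = (\<integral>\<^sup>+u. dens \<rho> f B n w u * kill (density \<rho> (\<lambda>x. ennreal (f x))) B (Suc 0) g u \<partial>\<rho>)"
    by (intro step.IH D.kill_measurable) auto
  also have "\<dots> = (\<integral>\<^sup>+u. dens \<rho> f B n w u * (\<integral>\<^sup>+v. dens \<rho> f B (Suc 0) u v * g v \<partial>\<rho>) \<partial>\<rho>)"
    using one by (intro nn_integral_cong_AE) auto
  also have "\<dots> = (\<integral>\<^sup>+u. (\<integral>\<^sup>+v. dens \<rho> f B n w u * dens \<rho> f B (Suc 0) u v * g v \<partial>\<rho>) \<partial>\<rho>)"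
    by (subst nn_integral_cmult[symmetric]) (auto simp: mult.assoc simp del: dens.simps)
  also have "\<dots> = (\<integral>\<^sup>+v. (\<integral>\<^sup>+u. dens \<rho> f B n w u * dens \<rho> f B (Suc 0) u v * g v \<partial>\<rho>) \<partial>\<rho>)"
    by (rule Fubini') measurable
  also have "\<dots> = (\<integral>\<^sup>+v. dens \<rho> f B (Suc n) w v * g v \<partial>\<rho>)"
    using dens_Suc[of n \<rho> f B w] step by (simp add: nn_integral_multc)
  finally show ?case .
qed

end

lemma (in fourth_moment_walk) uminus: "fourth_moment_walk (distr M borel uminus)"
proof -
  interpret D: real_distribution "distr M borel uminus" by (rule real_distribution_distr) auto
  show ?thesis
  proof
    show "integrable (distr M borel uminus) (\<lambda>x. x ^ 4)" by (subst integrable_distr_eq) auto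
    show "(\<integral>x. x \<partial>distr M borel uminus) = 0" by (subst integral_distr) (auto simp: mean_0)
    show "(\<integral>x. x\<^sup>2 \<partial>distr M borel uminus) = 1" by (subst integral_distr) (auto simp: variance_1)
  qed
qed

locale walk_density = group_measure +
  fixes f :: "real \<Rightarrow> real"
  assumes f_measurable [measurable]: "f \<in> borel_measurable borel"
    and f_nonneg: "0 \<le> f x"
    and walk: "fourth_moment_walk (density \<rho> (\<lambda>x. ennreal (f x)))"
begin

lemma walk_reverse: "fourth_moment_walk (density \<rho> (\<lambda>x. ennreal (f (- x))))"
proof -
  have "density \<rho> (\<lambda>x. ennreal (f (- x))) = density (distr \<rho> borel uminus) (\<lambda>x. ennreal (f (- x)))"
    using distr_reflect[of 0] by simp
  also have "\<dots> = distr (density \<rho> (\<lambda>x. ennreal (f x))) borel uminus"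
    by (subst density_distr) auto
  finally show ?thesis using fourth_moment_walk.uminus[OF walk] by simp
qed

sublocale fwd: fourth_moment_walk "density \<rho> (\<lambda>x. ennreal (f x))" by (rule walk)
sublocale bwd: fourth_moment_walk "density \<rho> (\<lambda>x. ennreal (f (- x)))" by (rule walk_reverse)

abbreviation "q \<equiv> dens \<rho> f {0<..}"
abbreviation "p \<equiv> dens \<rho> f UNIV"

lemma q_le_p: "q n w v \<le> p n w v" by (rule dens_mono_set) simp

lemma integral_q_fwd:
  assumes "n \<ge> 1" "w \<in> G" "g \<in> borel_measurable borel"
  shows "(\<integral>\<^sup>+v. q n w v * g v \<partial>\<rho>) = fwd.surv n g w"
  using assms fwd.real_distribution_axioms by (intro kill_eq_dens[symmetric]) auto

lemma integral_q_bwd: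
  assumes "n \<ge> 1" "v \<in> G" "g \<in> borel_measurable borel"
  shows "(\<integral>\<^sup>+w. q n w v * g w \<partial>\<rho>) = bwd.surv n g v"
  using assms bwd.real_distribution_axioms by (subst kill_eq_dens) (auto simp: dens_reverse[of f])

lemma integral_p_bwd:
  assumes "n \<ge> 1" "v \<in> G"
  shows "(\<integral>\<^sup>+w. p n w v \<partial>\<rho>) = 1"
proof -
  have "kill (density \<rho> (\<lambda>x. ennreal (f (- x)))) UNIV n (\<lambda>_. 1) v = 1" for n v
    by (induction n arbitrary: v) (auto simp: bwd.emeasure_space_1[simplified])
  then show ?thesis
    using kill_eq_dens[of "\<lambda>x. f (- x)" UNIV "\<lambda>_. 1" n v] assms bwd.real_distribution_axioms by (simp add: dens_reverse[of f])
qed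

lemma q_semigroup: "m \<ge> 1 \<Longrightarrow> k \<ge> 1 \<Longrightarrow> q (m + k) w v = (\<integral>\<^sup>+u. q m w u * q k u v \<partial>\<rho>)"
  by (rule dens_semigroup) auto

end

text \<open>\<open>L n\<close> is the coset that carries the \<open>n\<close>-step walk. It is
  needed because a lower bound for the free density can hold only there; \<open>L_add\<close> is the
  coset arithmetic for splitting a path at an intermediate time.\<close>

locale supported_walk_density = walk_density +
  fixes L :: "nat \<Rightarrow> real set"
  assumes support: "f x \<noteq> 0 \<Longrightarrow> x \<in> L 1"
    and L_add: "m \<ge> 1 \<Longrightarrow> k \<ge> 1 \<Longrightarrow> x \<in> L m \<Longrightarrow> x + y \<in> L (m + k) \<longleftrightarrow> y \<in> L k"
begin

lemma dens_support:
  assumes "n \<ge> 1" "dens \<rho> f B n w v \<noteq> 0"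
  shows "w - v \<in> L n"
  using assms
proof (induction n arbitrary: v rule: dec_induct)
  case base
  then have "f (w - v) \<noteq> 0" by auto
  then show ?case using support by simp
next
  case (step n)
  have nz: "(\<integral>\<^sup>+u. dens \<rho> f B n w u * dens \<rho> f B (Suc 0) u v \<partial>\<rho>) \<noteq> 0"
    using step dens_Suc[of n \<rho> f B w v] by simp
  have "\<exists>u. dens \<rho> f B n w u * dens \<rho> f B (Suc 0) u v \<noteq> 0"
  proof (rule ccontr)
    assume h: "\<nexists>u. dens \<rho> f B n w u * dens \<rho> f B (Suc 0) u v \<noteq> 0"
    have "(\<integral>\<^sup>+u. dens \<rho> f B n w u * dens \<rho> f B (Suc 0) u v \<partial>\<rho>) = (\<integral>\<^sup>+u. 0 \<partial>\<rho>)"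
      by (rule nn_integral_cong) (use h in blast)
    with nz show False by simp
  qed
  then obtain u where "dens \<rho> f B n w u * dens \<rho> f B (Suc 0) u v \<noteq> 0" by blast
  then have "dens \<rho> f B n w u \<noteq> 0" "f (u - v) \<noteq> 0" by auto
  then have "w - u \<in> L n" "u - v \<in> L 1" using step support by auto
  then show ?case using L_add[of n 1 "w - u" "u - v"] step by simp
qed

end

context fourth_moment_walk
begin

lemma surv_reflected_upper:
  assumes "l > 0" "v \<ge> 0" "u > 0"
  shows "surv k (\<lambda>x. ennreal (reflected l v x)) u \<le> ennreal (reflected (l + k) v u
     + caloric_const / l\<^sup>2 * (1 + 2 * surv_const * hb u * sqrt k) + 2 / l * (hb u - u))"
proof -
  have hbu: "hb u - u \<ge> 0" "hb u \<ge> 0" using assms by (auto simp: overshoot_bound_def barrier_shift_def)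
  have "surv k (\<lambda>x. ennreal (reflected l v x)) u \<le> ennreal (reflected (l + k) v u)
     + ennreal (caloric_const / l\<^sup>2) * (\<Sum>i<k. surv i (\<lambda>_. 1) u)
     + ennreal (2 / l) * (\<Sum>i<k. surv i excess u)"
    using assms by (intro surv_reflected_le) auto
  also have "\<dots> \<le> ennreal (reflected (l + k) v u)
     + ennreal (caloric_const / l\<^sup>2) * ennreal (1 + 2 * surv_const * hb u * sqrt k)
     + ennreal (2 / l) * ennreal (hb u - u)"
    using assms by (intro add_mono mult_left_mono sum_surv_one_le sum_surv_excess_le) auto
  also have "\<dots> = ennreal (reflected (l + k) v u
     + caloric_const / l\<^sup>2 * (1 + 2 * surv_const * hb u * sqrt k) + 2 / l * (hb u - u))"
    using assms hbu surv_const(1) caloric_const_nonneg reflected_nonneg[of "l + k" v u]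
    by (simp add: ennreal_mult'[symmetric] ennreal_plus[symmetric] del: ennreal_plus)
  finally show ?thesis .
qed

lemma surv_reflected_lower:
  assumes "l > 0" "v \<ge> 0" "u > 0"
  shows "ennreal (reflected (l + k) v u) \<le> surv k (\<lambda>x. ennreal (reflected l v x)) u
     + ennreal (caloric_const / l\<^sup>2 * (1 + 2 * surv_const * hb u * sqrt k))"
proof -
  have hbu: "hb u - u \<ge> 0" "hb u \<ge> 0" using assms by (auto simp: overshoot_bound_def barrier_shift_def)
  have "ennreal (reflected (l + k) v u) \<le> surv k (\<lambda>x. ennreal (reflected l v x)) u
     + ennreal (caloric_const / l\<^sup>2) * (\<Sum>i<k. surv i (\<lambda>_. 1) u)"
    using assms by (intro surv_reflected_ge) auto
  also have "\<dots> \<le> surv k (\<lambda>x. ennreal (reflected l v x)) u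
     + ennreal (caloric_const / l\<^sup>2) * ennreal (1 + 2 * surv_const * hb u * sqrt k)"
    using assms by (intro add_mono mult_left_mono sum_surv_one_le) auto
  also have "ennreal (caloric_const / l\<^sup>2) * ennreal (1 + 2 * surv_const * hb u * sqrt k)
     = ennreal (caloric_const / l\<^sup>2 * (1 + 2 * surv_const * hb u * sqrt k))"
    using caloric_const_nonneg by (subst ennreal_mult') auto
  finally show ?thesis .
qed

end

section \<open>Bounds obtained by splitting a path in time\<close>

context supported_walk_density
begin

lemma q_zero: "w \<le> 0 \<or> v \<le> 0 \<Longrightarrow> q n w v = 0"
  by (rule dens_outside) auto

lemma integral_q_one_fwd: "n \<ge> 1 \<Longrightarrow> w \<in> G \<Longrightarrow> (\<integral>\<^sup>+v. q n w v \<partial>\<rho>) = fwd.surv n (\<lambda>_. 1) w"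
  using integral_q_fwd[of n w "\<lambda>_. 1"] by simp

lemma integral_q_one_bwd: "n \<ge> 1 \<Longrightarrow> v \<in> G \<Longrightarrow> (\<integral>\<^sup>+w. q n w v \<partial>\<rho>) = bwd.surv n (\<lambda>_. 1) v"
  using integral_q_bwd[of n v "\<lambda>_. 1"] by simp

lemma q_sup_one:
  assumes "m \<ge> 1" "k \<ge> 1" "w \<in> G" "v \<in> G" and p: "\<And>w v. w \<in> G \<Longrightarrow> v \<in> G \<Longrightarrow> p k w v \<le> C"
  shows "q (m + k) w v \<le> C * fwd.surv m (\<lambda>_. 1) w"
proof -
  have "q (m + k) w v = (\<integral>\<^sup>+u. q m w u * q k u v \<partial>\<rho>)" using assms by (intro q_semigroup)
  also have "\<dots> \<le> (\<integral>\<^sup>+u. C * q m w u \<partial>\<rho>)"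
    using AE_in_G assms order_trans[OF q_le_p p]
    by (intro nn_integral_mono_AE) (auto simp: mult.commute[of C] intro!: mult_left_mono)
  also have "\<dots> = C * fwd.surv m (\<lambda>_. 1) w"
    using assms by (subst nn_integral_cmult) (auto simp: integral_q_one_fwd)
  finally show ?thesis .
qed

text \<open>Killing is used near both ends, forwards from \<open>w\<close> and backwards from
  \<open>v\<close>, and ignored in the middle, where only the supremum of the free density enters.
  Both survival factors are linear in the heights, which makes the bound small for \<open>v\<close>
  near the barrier.\<close>

lemma q_sup_two:
  assumes "m \<ge> 1" "k \<ge> 1" "l \<ge> 1" "w \<in> G" "v \<in> G"
    and p: "\<And>w v. w \<in> G \<Longrightarrow> v \<in> G \<Longrightarrow> p k w v \<le> C"
  shows "q (m + k + l) w v \<le> C * fwd.surv m (\<lambda>_. 1) w * bwd.surv l (\<lambda>_. 1) v"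
proof -
  have "q (m + k + l) w v = (\<integral>\<^sup>+u. q (m + k) w u * q l u v \<partial>\<rho>)" using assms by (intro q_semigroup) auto
  also have "\<dots> \<le> (\<integral>\<^sup>+u. C * fwd.surv m (\<lambda>_. 1) w * q l u v \<partial>\<rho>)"
    using AE_in_G assms by (intro nn_integral_mono_AE) (auto intro!: mult_right_mono q_sup_one)
  also have "\<dots> = C * fwd.surv m (\<lambda>_. 1) w * bwd.surv l (\<lambda>_. 1) v"
    using assms by (subst nn_integral_cmult) (auto simp: integral_q_one_bwd)
  finally show ?thesis .
qed

text \<open>Killing is ignored during the last \<open>l\<close> steps. The free Gaussian exceeds the
  reflected kernel by the image term \<open>gauss l (u + v)\<close>, at most
  \<open>gauss l v\<close>, which is small once \<open>v\<close> is large compared with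
  \<open>sqrt l\<close>.\<close>

lemma q_upper_split:
  assumes "m \<ge> 1" "l \<ge> 1" "w \<in> G" "v \<in> G" "v > 0" "\<kappa> \<ge> 0" "e \<ge> 0"
    and p: "\<And>u. u \<in> G \<Longrightarrow> p l u v \<le> ennreal (\<kappa> * gauss l (u - v) + e)"
  shows "q (m + l) w v \<le> ennreal \<kappa> * fwd.surv m (\<lambda>x. ennreal (reflected l v x)) w
     + ennreal (\<kappa> * gauss l v + e) * fwd.surv m (\<lambda>_. 1) w"
proof -
  let ?g = "\<lambda>u. ennreal \<kappa> * ennreal (reflected l v u) + ennreal (\<kappa> * gauss l v + e) * 1"
  have l0: "real l > 0" using assms by simp
  have "q m w u * q l u v \<le> q m w u * ?g u" if "u \<in> G" for u
  proof (cases "u > 0")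
    case True
    have "q l u v \<le> ennreal (\<kappa> * gauss l (u - v) + e)" using q_le_p p[OF that] by (rule order_trans)
    also have "\<dots> \<le> ennreal (\<kappa> * reflected l v u + (\<kappa> * gauss l v + e))"
    proof (intro ennreal_leI)
      have "gauss l (u + v) \<le> gauss l v" using True assms l0 by (intro gauss_antimono) auto
      then have "\<kappa> * gauss l (u + v) \<le> \<kappa> * gauss l v" using assms by (intro mult_left_mono)
      then show "\<kappa> * gauss l (u - v) + e \<le> \<kappa> * reflected l v u + (\<kappa> * gauss l v + e)"
        by (simp add: reflected_def algebra_simps)
    qed
    also have "\<dots> = ?g u"
      using True assms l0 reflected_nonneg[of l v u] gauss_nonneg[of l v] by (simp add: ennreal_mult)
    finally show ?thesis by (rule mult_left_mono) simp
  qed (simp add: q_zero)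
  then have "q (m + l) w v \<le> (\<integral>\<^sup>+u. q m w u * ?g u \<partial>\<rho>)"
    using q_semigroup[of m l w v] assms AE_in_G by (auto intro!: nn_integral_mono_AE)
  also have "\<dots> = fwd.surv m ?g w" using assms by (intro integral_q_fwd) auto
  also have "\<dots> = ennreal \<kappa> * fwd.surv m (\<lambda>x. ennreal (reflected l v x)) w
     + ennreal (\<kappa> * gauss l v + e) * fwd.surv m (\<lambda>_. 1) w"
    by (subst fwd.kill_add) (auto simp: fwd.kill_cmult simp del: mult_1_right)
  finally show ?thesis .
qed

text \<open>Replacing \<open>q\<close> by \<open>p\<close> in the last \<open>l\<close> steps
  overcounts the paths that die there. Since \<open>q m w u \<le> B\<close>, the surplus is at most
  \<open>B\<close> times the probability that the reversed walk from \<open>v\<close> dies within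
  \<open>l\<close> steps, hence at most \<open>B * l / v^2\<close>.\<close>

lemma q_lower_split:
  assumes "m \<ge> 1" "l \<ge> 1" "w \<in> G" "v \<in> G" "v > 0" "\<kappa> \<ge> 0" "e \<ge> 0" "B \<ge> 0"
    and p: "\<And>u. u \<in> G \<Longrightarrow> u - v \<in> L l \<Longrightarrow> ennreal (\<kappa> * gauss l (u - v) - e) \<le> p l u v"
    and B: "\<And>u. u \<in> G \<Longrightarrow> q m w u \<le> ennreal B"
    and wv: "w - v \<in> L (m + l)"
  shows "ennreal \<kappa> * fwd.surv m (\<lambda>x. ennreal (reflected l v x)) w
    \<le> q (m + l) w v + ennreal (B * (l / v\<^sup>2)) + ennreal e * fwd.surv m (\<lambda>_. 1) w"
proof -
  have l0: "real l > 0" using assms by simp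
  have pw: "q m w u * (ennreal \<kappa> * ennreal (reflected l v u)) \<le> q m w u * p l u v + ennreal e * q m w u"
    if "u \<in> G" for u
  proof (cases "q m w u = 0")
    case False
    then have "w - u \<in> L m" using assms by (intro dens_support) auto
    then have uv: "u - v \<in> L l" using wv L_add[of m l "w - u" "u - v"] assms by simp
    have "ennreal \<kappa> * ennreal (reflected l v u) \<le> ennreal ((\<kappa> * gauss l (u - v) - e) + e)"
    proof -
      have "\<kappa> * reflected l v u \<le> \<kappa> * gauss l (u - v)"
        using assms l0 gauss_nonneg[of l "u + v"] by (intro mult_left_mono) (auto simp: reflected_def)
      then show ?thesis using assms by (simp add: ennreal_mult'[symmetric] ennreal_leI)
    qed
    also have "\<dots> \<le> ennreal (\<kappa> * gauss l (u - v) - e) + ennreal e"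
      using assms by (intro ennreal_plus_le) auto
    also have "\<dots> \<le> p l u v + ennreal e" by (intro add_right_mono p that uv)
    finally have "q m w u * (ennreal \<kappa> * ennreal (reflected l v u)) \<le> q m w u * (p l u v + ennreal e)"
      by (rule mult_left_mono) simp
    then show ?thesis by (simp add: distrib_left mult.commute)
  qed simp
  let ?P = "\<integral>\<^sup>+u. q m w u * p l u v \<partial>\<rho>" and ?S = "ennreal B * bwd.surv l (\<lambda>_. 1) v"
  have "ennreal \<kappa> * fwd.surv m (\<lambda>x. ennreal (reflected l v x)) w
      = (\<integral>\<^sup>+u. q m w u * (ennreal \<kappa> * ennreal (reflected l v u)) \<partial>\<rho>)"
    using assms by (subst integral_q_fwd) (auto simp: fwd.kill_cmult)
  also have "\<dots> \<le> (\<integral>\<^sup>+u. q m w u * p l u v + ennreal e * q m w u \<partial>\<rho>)"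
    using AE_in_G pw by (intro nn_integral_mono_AE) auto
  also have "\<dots> = ?P + ennreal e * fwd.surv m (\<lambda>_. 1) w"
    using assms by (simp add: nn_integral_add nn_integral_cmult integral_q_one_fwd)
  finally have 1: "ennreal \<kappa> * fwd.surv m (\<lambda>x. ennreal (reflected l v x)) w \<le> ?P + ennreal e * fwd.surv m (\<lambda>_. 1) w" .
  \<comment> \<open>The inequality \<open>q m * (p - q) \<le> B * (p - q)\<close> in additive form:
    the rearrangement inequality exchanges \<open>p\<close> and \<open>q\<close> between the two
    products. The finite term \<open>?S\<close> is cancelled at the end.\<close>
  have "?P + ?S = (\<integral>\<^sup>+u. q m w u * p l u v + ennreal B * q l u v \<partial>\<rho>)"
    using assms by (simp add: nn_integral_add nn_integral_cmult integral_q_one_bwd)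
  also have "\<dots> \<le> (\<integral>\<^sup>+u. q m w u * q l u v + ennreal B * p l u v \<partial>\<rho>)"
    using AE_in_G B q_le_p by (intro nn_integral_mono_AE) (auto intro!: ennreal_rearrange)
  also have "\<dots> = q (m + l) w v + ennreal B"
    using assms by (simp add: nn_integral_add nn_integral_cmult integral_p_bwd q_semigroup)
  also have "ennreal B * 1 \<le> ennreal B * (bwd.surv l (\<lambda>_. 1) v + ennreal (l / v\<^sup>2))"
    using bwd.surv_one_ge[of v l v] assms by (intro mult_left_mono) auto
  then have "ennreal B \<le> ?S + ennreal (B * (l / v\<^sup>2))"
    using assms by (simp add: distrib_left ennreal_mult'[symmetric])
  finally have "?S + ?P \<le> ?S + (q (m + l) w v + ennreal (B * (l / v\<^sup>2)))"
    by (simp add: add_ac add_left_mono)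
  moreover have "?S \<noteq> \<top>"
  proof -
    have "?S \<le> ennreal B * 1" by (intro mult_left_mono bwd.surv_one_le_1) auto
    then show ?thesis by (auto simp: top_unique)
  qed
  ultimately have "?P \<le> q (m + l) w v + ennreal (B * (l / v\<^sup>2))"
    by (simp add: ennreal_add_left_cancel_le)
  with 1 show ?thesis by (meson add_right_mono order_trans)
qed

end

section \<open>The local limit theorem away from the barrier\<close>

lemma sqrt_le_linear: "0 < \<theta> \<Longrightarrow> 0 \<le> t \<Longrightarrow> sqrt t \<le> \<theta> / 2 * t + 1 / (2 * \<theta>)"
proof -
  assume a: "0 < \<theta>" "0 \<le> t"
  have "0 \<le> (\<theta> * sqrt t - 1)\<^sup>2" by simp
  then have "2 * \<theta> * sqrt t \<le> \<theta>\<^sup>2 * t + 1" using a by (simp add: power2_diff power_mult_distrib algebra_simps)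
  then show ?thesis using a by (simp add: field_simps power2_eq_square)
qed

lemma overshoot_bound_le:
  assumes "0 < \<theta>" "A \<ge> 0" "y \<ge> 2 / \<theta> * (A + \<theta> * A / 2 + 1 / (2 * \<theta>))"
  shows "overshoot_bound A y - y \<le> \<theta> * y"
proof -
  have y0: "0 \<le> y" by (rule order_trans[OF _ assms(3)]) (use assms in auto)
  have "A + \<theta> * A / 2 + 1 / (2 * \<theta>) \<le> \<theta> / 2 * y" using assms by (simp add: field_simps)
  moreover have "sqrt (y + A) \<le> \<theta> / 2 * (y + A) + 1 / (2 * \<theta>)"
    using assms y0 by (intro sqrt_le_linear) auto
  moreover have "overshoot_bound A y - y = A + sqrt (y + A)"
    using y0 assms by (simp add: overshoot_bound_def)
  moreover have "\<theta> / 2 * (y + A) = \<theta> / 2 * y + \<theta> * A / 2" by (simp add: algebra_simps)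
  ultimately show ?thesis by linarith
qed

lemma overshoot_bound_linear:
  fixes A v :: real
  assumes "A \<ge> 0" "v \<ge> 0"
  shows "overshoot_bound A v \<le> 2 * v + (2 * A + 1)"
proof -
  have "sqrt (v + A) \<le> (v + A) / 2 + 1 / 2" using sqrt_le_linear[of 1 "v + A"] assms by simp
  moreover have "overshoot_bound A v = v + A + sqrt (v + A)" using assms by (simp add: overshoot_bound_def)
  moreover have "v + A + s \<le> 2 * v + (2 * A + 1)" if "s \<le> (v + A) / 2 + 1 / 2" for s
    using that assms by (simp add: field_simps)
  ultimately show ?thesis by metis
qed

text \<open>\<open>exp (- x) \<le> 2 / x^2\<close> at \<open>x = 1 / (2 \<delta>^2)\<close>. The
  power \<open>\<delta>^4\<close> outweighs the factor \<open>1 / \<delta>^2\<close> that arises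
  when \<open>1 / sqrt s\<close> is taken at time \<open>\<delta>^4 N\<close> instead of
  \<open>N\<close>.\<close>

lemma gauss_far:
  assumes "0 < s" "0 < \<delta>" "s / \<delta>\<^sup>2 \<le> v\<^sup>2"
  shows "gauss s v \<le> 8 * \<delta> ^ 4 / sqrt s"
proof -
  define x where "x = 1 / (2 * \<delta>\<^sup>2)"
  have x: "x > 0" using assms by (simp add: x_def)
  have "- v\<^sup>2 / (2 * s) \<le> - x" using assms by (simp add: x_def field_simps)
  then have "exp (- v\<^sup>2 / (2 * s)) \<le> exp (- x)" by simp
  also have "\<dots> \<le> 8 * \<delta> ^ 4"
  proof -
    have "x\<^sup>2 / 2 \<le> exp x" using exp_lower_Taylor_quadratic[of x] x by simp
    then have "1 / exp x \<le> 1 / (x\<^sup>2 / 2)" using x by (intro divide_left_mono) auto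
    also have "\<dots> = 8 * \<delta> ^ 4" using assms by (simp add: x_def field_simps power2_eq_square power4_eq_xxxx)
    finally show ?thesis by (simp add: exp_minus inverse_eq_divide)
  qed
  finally have "exp (- v\<^sup>2 / (2 * s)) \<le> 8 * \<delta> ^ 4" .
  moreover have "sqrt s \<le> sqrt (2 * pi * s)" using assms pi_ge_two by (simp add: mult_le_cancel_right1)
  ultimately show ?thesis unfolding gauss_def using assms by (intro frac_le) auto
qed

text \<open>The sets \<open>L n\<close> carry \<open>S\<^sub>n\<close>; \<open>\<kappa>\<close> is the span in the lattice case and \<open>1\<close> otherwise.\<close>
locale llt_walk = supported_walk_density +
  fixes \<kappa> :: real
  assumes kappa_pos: "\<kappa> > 0"
    and llt_upper: "\<eta> > 0 \<Longrightarrow> \<forall>\<^sub>F n in sequentially. \<forall>w\<in>G. \<forall>v\<in>G.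
      p n w v \<le> ennreal (\<kappa> * gauss n (w - v) + \<eta> / sqrt n)"
    and llt_lower: "\<eta> > 0 \<Longrightarrow> \<forall>\<^sub>F n in sequentially. \<forall>w\<in>G. \<forall>v\<in>G. w - v \<in> L n \<longrightarrow>
      ennreal (\<kappa> * gauss n (w - v) - \<eta> / sqrt n) \<le> p n w v"
begin

abbreviation "Cf \<equiv> fwd.surv_const"
abbreviation "Cb \<equiv> bwd.surv_const"
abbreviation "cal \<equiv> fwd.caloric_const"

text \<open>The terms belong, in this order, to the caloric error, the overshoot, the image term
  with the error of the local limit theorem, the paths dying in the last steps, and, for small
  \<open>v\<close>, the killed density and the kernel itself.\<close>

definition "bulk_const = \<kappa> * cal * (1 + 4 * Cf) + 2 * \<kappa> + (8 * \<kappa> + 1) * 4 * Cf + 8 * (\<kappa> + 1) * Cf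
  + 270 * (\<kappa> + 1) * Cf * Cb + 2 * \<kappa>"

lemma bulk_const_ge:
  "\<kappa> * cal * (1 + 4 * Cf) + 2 * \<kappa> + (8 * \<kappa> + 1) * 4 * Cf \<le> bulk_const"
  "\<kappa> * cal * (1 + 4 * Cf) + 4 * Cf + 8 * (\<kappa> + 1) * Cf \<le> bulk_const"
  "270 * (\<kappa> + 1) * Cf * Cb \<le> bulk_const" "2 * \<kappa> \<le> bulk_const"
proof -
  have nn: "0 \<le> \<kappa> * cal * (1 + 4 * Cf)" "0 \<le> \<kappa> * Cf" "0 \<le> (\<kappa> + 1) * Cf" "0 \<le> (\<kappa> + 1) * Cf * Cb" "0 \<le> \<kappa>" "0 \<le> Cf"
    using kappa_pos fwd.caloric_const_nonneg fwd.surv_const(1) bwd.surv_const(1) by auto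
  then show "\<kappa> * cal * (1 + 4 * Cf) + 2 * \<kappa> + (8 * \<kappa> + 1) * 4 * Cf \<le> bulk_const"
  "\<kappa> * cal * (1 + 4 * Cf) + 4 * Cf + 8 * (\<kappa> + 1) * Cf \<le> bulk_const"
  "270 * (\<kappa> + 1) * Cf * Cb \<le> bulk_const" "2 * \<kappa> \<le> bulk_const"
    unfolding bulk_const_def by (simp_all add: algebra_simps, linarith+)
qed

text \<open>The last \<open>l \<approx> \<delta>\<^sup>4 N\<close> steps are cut off. If \<open>v \<ge> sqrt l / \<delta>\<close>, the walk read backwards from \<open>v\<close> hardly
  ever reaches the barrier within \<open>l\<close> steps, so that there \<open>q\<close> may be replaced by \<open>p\<close>; if \<open>v\<close> is
  smaller, both sides are negligible.\<close>
lemma bulk_at: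
  assumes \<delta>: "0 < \<delta>" "\<delta> \<le> 1/2" and N: "N \<ge> 16" "1 \<le> \<delta> ^ 4 * N" "1 \<le> \<delta> ^ 9 * sqrt N"
    and A2: "2 * bwd.barrier_shift + 1 \<le> \<delta> * sqrt N"
    and y: "y \<in> G" "y \<ge> 1" "fwd.hb y - y \<le> \<delta> ^ 5 * y" and v: "v \<in> G" "v > 0"
    and p1: "\<And>k w v. k \<ge> N div 4 \<Longrightarrow> w \<in> G \<Longrightarrow> v \<in> G \<Longrightarrow> p k w v \<le> ennreal ((\<kappa> + 1) / sqrt k)"
    and pu: "\<And>l u. real l \<ge> \<delta> ^ 4 * N \<Longrightarrow> u \<in> G \<Longrightarrow> p l u v \<le> ennreal (\<kappa> * gauss l (u - v) + \<delta> ^ 3 / sqrt l)"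
    and pl: "\<And>l u. real l \<ge> \<delta> ^ 4 * N \<Longrightarrow> u \<in> G \<Longrightarrow> u - v \<in> L l \<Longrightarrow>
       ennreal (\<kappa> * gauss l (u - v) - \<delta> ^ 3 / sqrt l) \<le> p l u v"
  shows "q N y v \<le> ennreal (\<kappa> * reflected N v y + bulk_const * \<delta> * (y / N))"
    and "y - v \<in> L N \<Longrightarrow> ennreal (\<kappa> * reflected N v y) \<le> q N y v + ennreal (bulk_const * \<delta> * (y / N))"
proof -
  define S where "S = sqrt N"
  define r where "r = y / N"
  define H where "H = fwd.hb y"
  define l where "l = nat \<lceil>\<delta> ^ 4 * N\<rceil>"
  define m where "m = N - l"
  have S: "S\<^sup>2 = N" "S \<ge> 1" "S > 0" using N by (auto simp: S_def)
  have r: "r = y / S\<^sup>2" "r \<ge> 0" using S y by (auto simp: r_def)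
  have \<delta>1: "\<delta> ^ 5 \<le> 1" "\<delta> ^ 4 \<le> 1/16" "\<delta>\<^sup>2 \<le> \<delta>"
  proof -
    show "\<delta> ^ 5 \<le> 1" using \<delta> by (intro power_le_one) auto
    have "\<delta> ^ 4 \<le> (1/2) ^ 4" using \<delta> by (intro power_mono) auto
    then show "\<delta> ^ 4 \<le> 1/16" by (simp add: power_divide)
    show "\<delta>\<^sup>2 \<le> \<delta>" using \<delta> by (simp add: power2_eq_square mult_left_le)
  qed
  have H: "H \<ge> 0" "H \<le> 2 * y" "H - y \<le> \<delta> ^ 5 * y"
  proof -
    have "\<delta> ^ 5 * y \<le> 1 * y" using \<delta>1 y by (intro mult_right_mono) auto
    then show "H \<le> 2 * y" "H - y \<le> \<delta> ^ 5 * y" using y unfolding H_def by linarith+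
  qed (simp add: H_def overshoot_bound_nonneg)
  have l: "\<delta> ^ 4 * N \<le> l" "l \<le> 2 * (\<delta> ^ 4 * N)" "l \<ge> 1"
  proof -
    show a: "\<delta> ^ 4 * N \<le> l" unfolding l_def by linarith
    show "l \<le> 2 * (\<delta> ^ 4 * N)" unfolding l_def using N by linarith
    show "l \<ge> 1" using a N by linarith
  qed
  have l8: "real l \<le> N / 8" using l(2) mult_right_mono[OF \<delta>1(2), of "real N"] by simp
  have m: "real m \<ge> 7 * N / 8" "m + l = N" "m \<ge> 1" "m \<le> N"
  proof -
    have "l \<le> N" using l8 by linarith
    then show "m + l = N" "m \<le> N" by (auto simp: m_def)
    then show "real m \<ge> 7 * N / 8" using l8 by linarith
    then show "m \<ge> 1" using N by linarith
  qed
  have sl: "sqrt l \<ge> \<delta>\<^sup>2 * S" "real l > 0" "(real l)\<^sup>2 \<ge> \<delta> ^ 8 * S ^ 4"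
  proof -
    show "real l > 0" using l by simp
    have "(\<delta>\<^sup>2 * S)\<^sup>2 \<le> real l" using l(1) S by (simp add: power_mult_distrib)
    then show "sqrt l \<ge> \<delta>\<^sup>2 * S" by (rule real_le_rsqrt)
    have "(\<delta> ^ 4 * N)\<^sup>2 \<le> (real l)\<^sup>2" using l(1) \<delta> by (intro power_mono) auto
    then show "(real l)\<^sup>2 \<ge> \<delta> ^ 8 * S ^ 4" unfolding S(1)[symmetric] by (simp add: power_mult_distrib)
  qed
  have half: "sqrt k \<ge> S / 2" if "real k \<ge> N / 4" for k :: nat
    using that S by (intro real_le_rsqrt) (simp add: power_divide)
  have third: "sqrt k \<ge> S / 3" if "real k \<ge> N / 9" for k :: nat
    using that S by (intro real_le_rsqrt) (simp add: power_divide)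
  have sm: "sqrt m \<ge> S / 2" "sqrt m \<le> S" "sqrt m > 0"
    using m half[of m] by (auto simp: S_def)
  have Cf: "Cf > 0" and Cb: "Cb > 0" by (rule fwd.surv_const(1), rule bwd.surv_const(1))
  have surv1: "fwd.surv k (\<lambda>_. 1) y \<le> ennreal (Cf * (2 * y) / sqrt k)" if "k \<ge> 1" for k
    using fwd.surv_const(2)[OF that, of y] H Cf y
    by (elim order_trans) (auto simp: H_def intro!: ennreal_leI divide_right_mono mult_left_mono)
  have survm: "fwd.surv m (\<lambda>_. 1) y \<le> ennreal (4 * Cf * y / S)"
  proof -
    have "Cf * (2 * y) / sqrt m \<le> Cf * (2 * y) / (S / 2)"
      using sm S Cf y by (intro divide_left_mono) auto
    then show ?thesis using surv1[OF m(3)] by (auto elim!: order_trans intro!: ennreal_leI simp: field_simps)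
  qed
  \<comment> \<open>The tolerance \<open>\<delta>^3\<close> in the local limit theorem becomes
    \<open>\<delta> / S\<close>, because the cut-off time satisfies
    \<open>sqrt l \<ge> \<delta>^2 * S\<close>.\<close>
  have e: "\<delta> ^ 3 / sqrt l \<le> \<delta> / S" "\<delta> ^ 3 / sqrt l \<ge> 0"
  proof -
    have "\<delta> ^ 3 / sqrt l \<le> \<delta> ^ 3 / (\<delta>\<^sup>2 * S)" using sl S \<delta> by (intro divide_left_mono) auto
    also have "\<dots> = \<delta> / S" using \<delta> S by (simp add: field_simps power2_eq_square power3_eq_cube)
    finally show "\<delta> ^ 3 / sqrt l \<le> \<delta> / S" .
  qed (use \<delta> in auto)
  \<comment> \<open>The accumulated caloric error is of order \<open>y S / l^2\<close>, that is
    \<open>y / N\<close> times \<open>1 / (\<delta>^8 S)\<close>; this is what the hypothesis with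
    \<open>\<delta>^9\<close> is for.\<close>
  have E1: "\<kappa> * (cal / (real l)\<^sup>2 * (1 + 2 * Cf * H * sqrt m)) \<le> \<kappa> * cal * (1 + 4 * Cf) * \<delta> * r"
  proof -
    have "1 + 2 * Cf * H * sqrt m \<le> y * S + 2 * Cf * (2 * y) * S"
      using y S H Cf sm mult_mono[of 1 y 1 S] by (intro add_mono mult_mono) auto
    also have "\<dots> = (1 + 4 * Cf) * (y * S)" by (simp add: algebra_simps)
    finally have "1 + 2 * Cf * H * sqrt m \<le> (1 + 4 * Cf) * (y * S)" .
    moreover have "cal / (real l)\<^sup>2 \<le> cal / (\<delta> ^ 8 * S ^ 4)"
      using sl \<delta> S fwd.caloric_const_nonneg by (intro divide_left_mono) auto
    ultimately have "\<kappa> * (cal / (real l)\<^sup>2 * (1 + 2 * Cf * H * sqrt m))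
       \<le> \<kappa> * (cal / (\<delta> ^ 8 * S ^ 4) * ((1 + 4 * Cf) * (y * S)))"
      using kappa_pos fwd.caloric_const_nonneg Cf H S \<delta> by (intro mult_left_mono mult_mono) auto
    also have "\<dots> = \<kappa> * cal * (1 + 4 * Cf) * r * (1 / (\<delta> ^ 8 * S))"
      using S(3) \<delta> by (simp add: r(1) field_simps power2_eq_square power4_eq_xxxx)
    also have "\<dots> \<le> \<kappa> * cal * (1 + 4 * Cf) * r * \<delta>"
    proof (intro mult_left_mono)
      have "\<delta> ^ 9 = \<delta> * \<delta> ^ 8" using power_Suc[of \<delta> 8] by simp
      then have "1 \<le> \<delta> * (\<delta> ^ 8 * S)" using N(3) by (simp add: S_def mult.assoc)
      then show "1 / (\<delta> ^ 8 * S) \<le> \<delta>" using S \<delta> by (simp add: divide_le_eq)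
      show "0 \<le> \<kappa> * cal * (1 + 4 * Cf) * r" using kappa_pos fwd.caloric_const_nonneg Cf r(2) by auto
    qed
    finally show ?thesis by (simp add: mult_ac)
  qed
  \<comment> \<open>The accuracy \<open>\<delta>^5\<close> required of the overshoot bound leaves
    one factor \<open>\<delta>\<close> after division by \<open>l\<close>, which is at least
    \<open>\<delta>^4 N\<close>.\<close>
  have E2: "\<kappa> * (2 / l * (H - y)) \<le> 2 * \<kappa> * \<delta> * r"
  proof -
    have H0: "H - y \<ge> 0" using y by (simp add: H_def overshoot_bound_def fwd.barrier_shift_def)
    have "2 / real l * (H - y) \<le> 2 / (\<delta> ^ 4 * S\<^sup>2) * (\<delta> ^ 5 * y)"
      using l(1) H H0 \<delta> S sl N by (intro mult_mono divide_left_mono) auto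
    also have "\<dots> = 2 * \<delta> * r"
      using \<delta> S(3) by (simp add: r(1) field_simps eval_nat_numeral)
    finally have "\<kappa> * (2 / l * (H - y)) \<le> \<kappa> * (2 * \<delta> * r)"
      using kappa_pos by (intro mult_left_mono) auto
    then show ?thesis by (simp only: mult_ac)
  qed
  have E4: "ennreal (\<delta> ^ 3 / sqrt l) * fwd.surv m (\<lambda>_. 1) y \<le> ennreal (4 * Cf * \<delta> * r)"
  proof -
    have "ennreal (\<delta> ^ 3 / sqrt l) * fwd.surv m (\<lambda>_. 1) y \<le> ennreal (\<delta> / S) * ennreal (4 * Cf * y / S)"
      using e survm by (intro mult_mono ennreal_leI) auto
    also have "\<dots> = ennreal (\<delta> / S * (4 * Cf * y / S))"
      using \<delta> S by (intro ennreal_mult'[symmetric]) auto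
    also have "\<delta> / S * (4 * Cf * y / S) = 4 * Cf * \<delta> * r" by (simp add: r(1) power2_eq_square)
    finally show ?thesis .
  qed
  have refl0: "0 \<le> reflected N v y" using N v y by (intro reflected_nonneg) auto
  have K: "bulk_const * \<delta> * r \<ge> c * \<delta> * r" if "c \<le> bulk_const" for c
    using that \<delta> r(2) by (intro mult_right_mono) auto
  have lm: "real l + real m = real N" using m by linarith
  consider (small) "v < sqrt l / \<delta>" | (large) "v \<ge> sqrt l / \<delta>" by linarith
  then have "q N y v \<le> ennreal (\<kappa> * reflected N v y + bulk_const * \<delta> * r) \<and>
    (y - v \<in> L N \<longrightarrow> ennreal (\<kappa> * reflected N v y) \<le> q N y v + ennreal (bulk_const * \<delta> * r))"
  proof cases
    case small
    have "sqrt l \<le> 2 * \<delta>\<^sup>2 * S"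
    proof (rule real_le_lsqrt)
      have "real l \<le> 2 * (\<delta>\<^sup>2 * S)\<^sup>2" using l(2) S by (simp add: power_mult_distrib)
      also have "\<dots> \<le> (2 * \<delta>\<^sup>2 * S)\<^sup>2" by (simp add: power_mult_distrib)
      finally show "real l \<le> (2 * \<delta>\<^sup>2 * S)\<^sup>2" .
    qed (use \<delta> S in auto)
    then have "sqrt l / \<delta> \<le> 2 * \<delta>\<^sup>2 * S / \<delta>" using \<delta> by (intro divide_right_mono) auto
    then have vS: "v \<le> 2 * \<delta> * S" using small \<delta> by (simp add: power2_eq_square)
    \<comment> \<open>Time is split into two pieces of length \<open>a\<close> and a rest, each at
      least \<open>N / 9\<close>, so that every factor \<open>1 / sqrt\<close> is at most
      \<open>3 / S\<close>. Together with the factors 2 and 5 in the height bounds this gives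
      \<open>27 * 10 = 270\<close>.\<close>
    define a where "a = N div 4"
    have a: "a \<ge> 1" "real a \<ge> N / 9" "real (N - 2 * a) \<ge> N / 9" "N - 2 * a \<ge> 1" "a + a + (N - 2 * a) = N"
    proof -
      have "N \<le> 4 * a + 3" "4 * a \<le> N" unfolding a_def by presburger+
      then show "a \<ge> 1" "real a \<ge> N / 9" "real (N - 2 * a) \<ge> N / 9" "N - 2 * a \<ge> 1" "a + a + (N - 2 * a) = N"
        using N by auto
    qed
    define b where "b = N - 2 * a"
    have "q (a + a + b) y v \<le> ennreal ((\<kappa> + 1) / sqrt a) * fwd.surv a (\<lambda>_. 1) y * bwd.surv b (\<lambda>_. 1) v"
      using a y v by (intro q_sup_two p1) (auto simp: a_def b_def)
    also have "\<dots> \<le> ennreal ((\<kappa> + 1) / (S / 3)) * ennreal (Cf * (2 * y) / (S / 3)) * ennreal (Cb * (5 * \<delta> * S) / (S / 3))"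
    proof (intro mult_mono)
      show "ennreal ((\<kappa> + 1) / sqrt a) \<le> ennreal ((\<kappa> + 1) / (S / 3))"
        using third[of a] a S kappa_pos by (intro ennreal_leI divide_left_mono) auto
      have "Cf * (2 * y) / sqrt a \<le> Cf * (2 * y) / (S / 3)"
        using third[of a] a S Cf y by (intro divide_left_mono) auto
      then show "fwd.surv a (\<lambda>_. 1) y \<le> ennreal (Cf * (2 * y) / (S / 3))"
        using surv1[OF a(1)] by (meson ennreal_leI order_trans)
      have "bwd.hb v \<le> 5 * \<delta> * S"
      proof -
        have "bwd.barrier_shift \<ge> 0" by (simp add: bwd.barrier_shift_def)
        from overshoot_bound_linear[OF this, of v] show ?thesis using v A2 vS unfolding S_def by linarith
      qed
      then have "Cb * bwd.hb v / sqrt b \<le> Cb * (5 * \<delta> * S) / (S / 3)"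
        using third[of b] a S Cb \<delta> by (intro frac_le mult_left_mono) (auto simp: b_def)
      then show "bwd.surv b (\<lambda>_. 1) v \<le> ennreal (Cb * (5 * \<delta> * S) / (S / 3))"
        using bwd.surv_const(2)[of b v] a(4) unfolding b_def[symmetric] by (meson ennreal_leI order_trans)
    qed auto
    also have "\<dots> = ennreal (((\<kappa> + 1) / (S / 3)) * (Cf * (2 * y) / (S / 3)) * (Cb * (5 * \<delta> * S) / (S / 3)))"
    proof -
      have "0 \<le> (\<kappa> + 1) / (S / 3)" "0 \<le> Cf * (2 * y) / (S / 3)" "0 \<le> Cb * (5 * \<delta> * S) / (S / 3)"
        using kappa_pos S Cf Cb y \<delta> by auto
      then show ?thesis by (simp only: ennreal_mult mult_nonneg_nonneg)
    qed
    also have "((\<kappa> + 1) / (S / 3)) * (Cf * (2 * y) / (S / 3)) * (Cb * (5 * \<delta> * S) / (S / 3))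
        = 270 * (\<kappa> + 1) * Cf * Cb * \<delta> * r"
      using S(3) by (simp add: r(1) field_simps power2_eq_square)
    also have "ennreal \<dots> \<le> ennreal (\<kappa> * reflected N v y + bulk_const * \<delta> * r)"
      using K[OF bulk_const_ge(3)] refl0 kappa_pos by (intro ennreal_leI add_increasing) auto
    finally have 1: "q N y v \<le> ennreal (\<kappa> * reflected N v y + bulk_const * \<delta> * r)" using a(5) by (simp add: b_def)
    have "reflected N v y \<le> 2 * y * v / (sqrt (2 * pi) * N * sqrt N)"
      using N y v by (intro reflected_upper) auto
    also have "\<dots> \<le> 2 * y * (2 * \<delta> * S) / (2 * N * S)"
      using sqrt_2pi_ge vS y v N S by (intro frac_le mult_mono mult_left_mono) (auto simp: S_def)
    also have "\<dots> = 2 * \<delta> * r" using S by (simp add: r_def)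
    finally have "\<kappa> * reflected N v y \<le> 2 * \<kappa> * \<delta> * r" using kappa_pos by simp
    also have "\<dots> \<le> bulk_const * \<delta> * r" by (rule K[OF bulk_const_ge(4)])
    finally have "ennreal (\<kappa> * reflected N v y) \<le> q N y v + ennreal (bulk_const * \<delta> * r)"
      by (intro add_increasing ennreal_leI) auto
    with 1 show ?thesis by blast
  next
    case large
    have v2: "l / \<delta>\<^sup>2 \<le> v\<^sup>2"
      using power_mono[OF large, of 2] \<delta> by (simp add: power_divide)
    have g: "\<kappa> * gauss l v + \<delta> ^ 3 / sqrt l \<le> (8 * \<kappa> + 1) * \<delta> / S"
    proof -
      have "gauss l v \<le> 8 * \<delta> ^ 4 / sqrt l" using sl(2) \<delta>(1) v2 by (rule gauss_far)
      also have "\<dots> \<le> 8 * \<delta> ^ 4 / (\<delta>\<^sup>2 * S)" using sl S \<delta> by (intro divide_left_mono) auto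
      also have "\<dots> = 8 * \<delta>\<^sup>2 / S" using \<delta> S by (simp add: field_simps power2_eq_square power4_eq_xxxx)
      also have "\<dots> \<le> 8 * \<delta> / S" using \<delta>1 S by (intro divide_right_mono) auto
      finally have "\<kappa> * gauss l v \<le> \<kappa> * (8 * \<delta> / S)" using kappa_pos by (intro mult_left_mono) auto
      then show ?thesis using e(1) by (simp add: algebra_simps add_divide_distrib)
    qed
    have ub: "fwd.surv m (\<lambda>x. ennreal (reflected l v x)) y \<le> ennreal (reflected (real l + real m) v y
       + cal / (real l)\<^sup>2 * (1 + 2 * Cf * H * sqrt m) + 2 / l * (H - y))"
      unfolding H_def using sl v y by (intro fwd.surv_reflected_upper) auto
    have "q (m + l) y v \<le> ennreal \<kappa> * fwd.surv m (\<lambda>x. ennreal (reflected l v x)) y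
       + ennreal (\<kappa> * gauss l v + \<delta> ^ 3 / sqrt l) * fwd.surv m (\<lambda>_. 1) y"
      using m l y v kappa_pos e pu[OF l(1)] by (intro q_upper_split) auto
    also have "\<dots> \<le> ennreal \<kappa> * ennreal (reflected (real l + real m) v y
       + cal / (real l)\<^sup>2 * (1 + 2 * Cf * H * sqrt m) + 2 / l * (H - y))
       + ennreal ((8 * \<kappa> + 1) * \<delta> / S) * ennreal (4 * Cf * y / S)"
      using g survm by (intro add_mono mult_mono[of "ennreal (_ + _)"] mult_left_mono ub ennreal_leI) auto
    also have "\<dots> = ennreal (\<kappa> * (reflected (real l + real m) v y
       + cal / (real l)\<^sup>2 * (1 + 2 * Cf * H * sqrt m) + 2 / l * (H - y)))
       + ennreal ((8 * \<kappa> + 1) * \<delta> / S * (4 * Cf * y / S))"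
      using kappa_pos \<delta> S by (subst (1 2) ennreal_mult') auto
    also have "\<dots> \<le> ennreal (\<kappa> * reflected N v y + (\<kappa> * cal * (1 + 4 * Cf) + 2 * \<kappa>) * \<delta> * r)
       + ennreal ((8 * \<kappa> + 1) * 4 * Cf * \<delta> * r)"
    proof (intro add_mono ennreal_leI)
      show "\<kappa> * (reflected (real l + real m) v y + cal / (real l)\<^sup>2 * (1 + 2 * Cf * H * sqrt m) + 2 / l * (H - y))
        \<le> \<kappa> * reflected N v y + (\<kappa> * cal * (1 + 4 * Cf) + 2 * \<kappa>) * \<delta> * r"
        using E1 E2 unfolding lm by (simp only: distrib_left distrib_right)
      show "(8 * \<kappa> + 1) * \<delta> / S * (4 * Cf * y / S) \<le> (8 * \<kappa> + 1) * 4 * Cf * \<delta> * r"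
        by (simp add: r(1) power2_eq_square add_divide_distrib algebra_simps)
    qed
    also have "\<dots> = ennreal (\<kappa> * reflected N v y + (\<kappa> * cal * (1 + 4 * Cf) + 2 * \<kappa>) * \<delta> * r + (8 * \<kappa> + 1) * 4 * Cf * \<delta> * r)"
      using kappa_pos fwd.caloric_const_nonneg Cf r(2) \<delta> refl0 by (intro ennreal_plus[symmetric]) auto
    also have "\<dots> \<le> ennreal (\<kappa> * reflected N v y + bulk_const * \<delta> * r)"
      using K[OF bulk_const_ge(1)] by (intro ennreal_leI) (simp add: algebra_simps)
    finally have 1: "q N y v \<le> ennreal (\<kappa> * reflected N v y + bulk_const * \<delta> * r)" using m by simp
    have 2: "ennreal (\<kappa> * reflected N v y) \<le> q N y v + ennreal (bulk_const * \<delta> * r)" if yv: "y - v \<in> L N"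
    proof -
      \<comment> \<open>A bound for \<open>q m y u\<close> uniform in \<open>u\<close>: survival
        over the first half of the \<open>m\<close> steps times the supremum of the free density
        over the second. Both halves are at least \<open>N / 4\<close>, so each gives a factor
        \<open>2 / S\<close>; the third 2 of the 8 comes from \<open>H \<le> 2 * y\<close>.\<close>
      define B where "B = 8 * (\<kappa> + 1) * Cf * r"
      have B0: "B \<ge> 0" using kappa_pos Cf r(2) by (simp add: B_def)
      define a where "a = m div 2"
      have a: "a \<ge> 1" "real a \<ge> N / 4" "real (m - a) \<ge> N / 4" "m - a \<ge> 1" "a + (m - a) = m" "m - a \<ge> N div 4"
      proof -
        have "m \<le> 2 * a + 1" "2 * a \<le> m" unfolding a_def by presburger+
        moreover have "8 * m \<ge> 7 * N" using m(1) by linarith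
        ultimately show "a \<ge> 1" "real a \<ge> N / 4" "real (m - a) \<ge> N / 4" "m - a \<ge> 1" "a + (m - a) = m" "m - a \<ge> N div 4"
          using N by auto
      qed
      have qB: "q m y u \<le> ennreal B" if "u \<in> G" for u
      proof -
        have "q (a + (m - a)) y u \<le> ennreal ((\<kappa> + 1) / sqrt (m - a)) * fwd.surv a (\<lambda>_. 1) y"
          using a y that by (intro q_sup_one p1) auto
        also have "\<dots> \<le> ennreal ((\<kappa> + 1) / (S / 2)) * ennreal (Cf * (2 * y) / (S / 2))"
        proof (intro mult_mono)
          show "ennreal ((\<kappa> + 1) / sqrt (m - a)) \<le> ennreal ((\<kappa> + 1) / (S / 2))"
            using half[of "m - a"] a S kappa_pos by (intro ennreal_leI divide_left_mono) auto
          have "Cf * (2 * y) / sqrt a \<le> Cf * (2 * y) / (S / 2)"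
            using half[of a] a S Cf y by (intro divide_left_mono) auto
          then show "fwd.surv a (\<lambda>_. 1) y \<le> ennreal (Cf * (2 * y) / (S / 2))"
            using surv1[OF a(1)] by (meson ennreal_leI order_trans)
        qed auto
        also have "\<dots> = ennreal (((\<kappa> + 1) / (S / 2)) * (Cf * (2 * y) / (S / 2)))"
          using kappa_pos S by (intro ennreal_mult'[symmetric]) auto
        also have "((\<kappa> + 1) / (S / 2)) * (Cf * (2 * y) / (S / 2)) = B"
          using S(3) by (simp add: B_def r(1) field_simps power2_eq_square)
        finally show ?thesis using a by simp
      qed
      have "ennreal (\<kappa> * reflected (real l + real m) v y) = ennreal \<kappa> * ennreal (reflected (real l + real m) v y)"
        using kappa_pos by (intro ennreal_mult') auto
      also have "\<dots> \<le> ennreal \<kappa> * (fwd.surv m (\<lambda>x. ennreal (reflected l v x)) y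
         + ennreal (cal / (real l)\<^sup>2 * (1 + 2 * Cf * H * sqrt m)))"
        unfolding H_def using fwd.surv_reflected_lower[of l v y m] sl v y by (intro mult_left_mono) auto
      also have "\<dots> = ennreal \<kappa> * fwd.surv m (\<lambda>x. ennreal (reflected l v x)) y
         + ennreal (\<kappa> * (cal / (real l)\<^sup>2 * (1 + 2 * Cf * H * sqrt m)))"
        using kappa_pos by (subst ennreal_mult', simp) (rule distrib_left)
      also have "\<dots> \<le> (q (m + l) y v + ennreal (B * (l / v\<^sup>2)) + ennreal (\<delta> ^ 3 / sqrt l) * fwd.surv m (\<lambda>_. 1) y)
         + ennreal (\<kappa> * cal * (1 + 4 * Cf) * \<delta> * r)"
        using m l y v kappa_pos e pl[OF l(1)] qB yv B0
        by (intro add_mono q_lower_split ennreal_leI E1) auto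
      also have "\<dots> \<le> (q (m + l) y v + ennreal (8 * (\<kappa> + 1) * Cf * \<delta> * r) + ennreal (4 * Cf * \<delta> * r))
         + ennreal (\<kappa> * cal * (1 + 4 * Cf) * \<delta> * r)"
      proof (intro add_mono E4 order_refl ennreal_leI)
        have "l / v\<^sup>2 \<le> \<delta>\<^sup>2" using v2 \<delta> v by (simp add: field_simps)
        then have "B * (l / v\<^sup>2) \<le> B * \<delta>" using B0 \<delta>1 by (intro mult_left_mono) auto
        then show "B * (l / v\<^sup>2) \<le> 8 * (\<kappa> + 1) * Cf * \<delta> * r" by (simp add: B_def mult_ac)
      qed
      also have "\<dots> = q N y v + ennreal (8 * (\<kappa> + 1) * Cf * \<delta> * r + 4 * Cf * \<delta> * r + \<kappa> * cal * (1 + 4 * Cf) * \<delta> * r)"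
      proof -
        have "0 \<le> 8 * (\<kappa> + 1) * Cf * \<delta> * r" "0 \<le> 4 * Cf * \<delta> * r" "0 \<le> \<kappa> * cal * (1 + 4 * Cf) * \<delta> * r"
          using kappa_pos fwd.caloric_const_nonneg Cf r(2) \<delta> by auto
        then show ?thesis unfolding m(2) by (simp only: ennreal_plus add_nonneg_nonneg add.assoc)
      qed
      also have "\<dots> \<le> q N y v + ennreal (bulk_const * \<delta> * r)"
        using K[OF bulk_const_ge(2)] by (intro add_left_mono ennreal_leI) (simp add: algebra_simps)
      finally show ?thesis unfolding lm .
    qed
    from 1 2 show ?thesis by blast
  qed
  then show "q N y v \<le> ennreal (\<kappa> * reflected N v y + bulk_const * \<delta> * (y / N))"
    and "y - v \<in> L N \<Longrightarrow> ennreal (\<kappa> * reflected N v y) \<le> q N y v + ennreal (bulk_const * \<delta> * (y / N))"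
    unfolding r_def by blast+
qed

end

context llt_walk
begin

text \<open>The threshold \<open>Y\<close> depends on \<open>\<delta>\<close> alone, and the
  eventual range of \<open>N\<close> does not depend on \<open>y\<close> and \<open>v\<close>. The
  uniformity in \<open>v\<close> allows summation over the intermediate position.\<close>

lemma bulk:
  assumes \<delta>: "0 < \<delta>" "\<delta> \<le> 1/2"
  shows "\<exists>Y. \<forall>\<^sub>F N in sequentially. \<forall>y\<in>G. \<forall>v\<in>G. y \<ge> Y \<longrightarrow> v > 0 \<longrightarrow>
    q N y v \<le> ennreal (\<kappa> * reflected N v y + bulk_const * \<delta> * (y / N)) \<and>
    (y - v \<in> L N \<longrightarrow> ennreal (\<kappa> * reflected N v y) \<le> q N y v + ennreal (bulk_const * \<delta> * (y / N)))"
proof -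
  obtain n1 where n1: "\<And>k w v. k \<ge> n1 \<Longrightarrow> w \<in> G \<Longrightarrow> v \<in> G \<Longrightarrow> p k w v \<le> ennreal (\<kappa> * gauss k (w - v) + 1 / sqrt k)"
    using llt_upper[of 1] unfolding eventually_sequentially by auto
  have \<delta>3: "\<delta> ^ 3 > 0" using \<delta> by simp
  obtain n2 where n2: "\<And>k w v. k \<ge> n2 \<Longrightarrow> w \<in> G \<Longrightarrow> v \<in> G \<Longrightarrow> p k w v \<le> ennreal (\<kappa> * gauss k (w - v) + \<delta> ^ 3 / sqrt k)"
    using llt_upper[OF \<delta>3] unfolding eventually_sequentially by auto
  obtain n3 where n3: "\<And>k w v. k \<ge> n3 \<Longrightarrow> w \<in> G \<Longrightarrow> v \<in> G \<Longrightarrow> w - v \<in> L k \<Longrightarrow>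
      ennreal (\<kappa> * gauss k (w - v) - \<delta> ^ 3 / sqrt k) \<le> p k w v"
    using llt_lower[OF \<delta>3] unfolding eventually_sequentially by auto
  have p1: "p k w v \<le> ennreal ((\<kappa> + 1) / sqrt k)" if "k \<ge> n1" "k \<ge> 1" "w \<in> G" "v \<in> G" for k w v
  proof -
    have "\<kappa> * gauss k (w - v) \<le> \<kappa> * (1 / sqrt k)" using that kappa_pos by (intro mult_left_mono gauss_le) auto
    then have "\<kappa> * gauss k (w - v) + 1 / sqrt k \<le> (\<kappa> + 1) / sqrt k" by (simp add: add_divide_distrib)
    then show ?thesis using n1[OF that(1,3,4)] by (meson ennreal_leI order_trans)
  qed
  have top: "filterlim (\<lambda>N. sqrt (real N)) at_top sequentially"
    by (rule filterlim_compose[OF sqrt_at_top filterlim_real_sequentially])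
  have big: "\<forall>\<^sub>F N in sequentially. c \<le> a * real N" if "a > 0" for a c :: real
    using eventually_ge_at_top[of "c / a"] filterlim_real_sequentially unfolding filterlim_iff
    using that by (auto simp: divide_le_eq mult.commute elim!: eventually_mono)
  have bigs: "\<forall>\<^sub>F N in sequentially. c \<le> a * sqrt (real N)" if "a > 0" for a c :: real
    using eventually_ge_at_top[of "c / a"] top unfolding filterlim_iff
    using that by (auto simp: divide_le_eq mult.commute elim!: eventually_mono)
  define A where "A = fwd.barrier_shift"
  define Y where "Y = max 1 (2 / \<delta> ^ 5 * (A + \<delta> ^ 5 * A / 2 + 1 / (2 * \<delta> ^ 5)))"
  have ev: "\<forall>\<^sub>F N in sequentially. N \<ge> 16 \<and> N \<ge> 4 * n1 + 4 \<and> 1 \<le> \<delta> ^ 4 * N \<and> 1 \<le> \<delta> ^ 9 * sqrt N \<and>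
     2 * bwd.barrier_shift + 1 \<le> \<delta> * sqrt N \<and> real (n2 + n3) \<le> \<delta> ^ 4 * N"
    using \<delta> by (intro eventually_conj eventually_ge_at_top big bigs) auto
  show ?thesis
  proof (intro exI[of _ Y])
    show "\<forall>\<^sub>F N in sequentially. \<forall>y\<in>G. \<forall>v\<in>G. y \<ge> Y \<longrightarrow> v > 0 \<longrightarrow>
      q N y v \<le> ennreal (\<kappa> * reflected N v y + bulk_const * \<delta> * (y / N)) \<and>
      (y - v \<in> L N \<longrightarrow> ennreal (\<kappa> * reflected N v y) \<le> q N y v + ennreal (bulk_const * \<delta> * (y / N)))"
      using ev
    proof eventually_elim
      case (elim N)
      show ?case
      proof (intro ballI impI)
        fix y v assume y: "y \<in> G" and v: "v \<in> G" "v > 0" and Y: "Y \<le> y"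
        have hb: "fwd.hb y - y \<le> \<delta> ^ 5 * y"
          using Y \<delta> by (intro overshoot_bound_le) (auto simp: Y_def A_def fwd.barrier_shift_def)
        have y1: "y \<ge> 1" using Y by (simp add: Y_def)
        have l: "l \<ge> n2 \<and> l \<ge> n3" if "\<delta> ^ 4 * N \<le> real l" for l
          using that elim by linarith
        have k: "k \<ge> n1 \<and> k \<ge> 1" if "k \<ge> N div 4" for k using that elim by linarith
        note B = bulk_at[OF \<delta> _ _ _ _ y y1 hb v, of N]
        show "q N y v \<le> ennreal (\<kappa> * reflected N v y + bulk_const * \<delta> * (y / N)) \<and>
          (y - v \<in> L N \<longrightarrow> ennreal (\<kappa> * reflected N v y) \<le> q N y v + ennreal (bulk_const * \<delta> * (y / N)))"
          using elim p1 k l n2 n3 v by (intro conjI impI B) auto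
      qed
    qed
  qed
qed

section \<open>The last steps read backwards and the limit of the ratio\<close>

text \<open>The constant in \<open>q n y z\<close> being asymptotic to
  \<open>\<kappa>' y z / (n sqrt n)\<close>. Since \<open>p n y z\<close> is asymptotic to
  \<open>\<kappa>' / (2 sqrt n)\<close>, it cancels in the quotient and leaves
  \<open>2 y z / n\<close>.\<close>

definition "\<kappa>' = 2 * \<kappa> / sqrt (2 * pi)"

lemma kappa'_pos: "\<kappa>' > 0"
  using kappa_pos by (simp add: \<kappa>'_def)

text \<open>At the intermediate position \<open>v\<close> the kernel is linear,
  \<open>a * v\<close>, with relative error \<open>(y + v) / sqrt N\<close>. Against the reversed
  killed walk from \<open>z\<close> the linear part gives a value between \<open>z\<close> and
  \<open>hb z\<close>, the constant error is multiplied by the survival probability, and the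
  relative error leads to the first two moments of \<open>v\<close>.\<close>

lemma assemble_at:
  assumes N: "N \<ge> 1" and m: "m \<ge> 1" and y: "y \<in> G" "y > 0" and z: "z \<in> G" "z > 0" and \<eta>: "\<eta> \<ge> 0"
    and bu: "\<And>v. v \<in> G \<Longrightarrow> v > 0 \<Longrightarrow> q N y v \<le> ennreal (\<kappa> * reflected N v y + \<eta> * (y / N))"
    and bl: "\<And>v. v \<in> G \<Longrightarrow> v > 0 \<Longrightarrow> y - v \<in> L N \<Longrightarrow> ennreal (\<kappa> * reflected N v y) \<le> q N y v + ennreal (\<eta> * (y / N))"
  shows "q (N + m) y z \<le> ennreal (\<kappa>' * y / (N * sqrt N) * bwd.hb z + \<eta> * (y / N) * (Cb * bwd.hb z / sqrt m))"
    and "y - z \<in> L (N + m) \<Longrightarrow> ennreal (\<kappa>' * y / (N * sqrt N) * z) \<le> q (N + m) y z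
       + ennreal (\<eta> * (y / N) * (Cb * bwd.hb z / sqrt m)
         + \<kappa>' * y / (N * sqrt N) / sqrt N * (y * bwd.hb z + (z\<^sup>2 + (1 + 2 * Cb * bwd.hb z * sqrt m))))"
proof -
  define a b where "a = \<kappa>' * y / (N * sqrt N)" and "b = \<eta> * (y / N)"
  have ab: "a \<ge> 0" "b \<ge> 0" using kappa'_pos y \<eta> by (auto simp: a_def b_def)
  have hb0: "bwd.hb z \<ge> 0" by (rule overshoot_bound_nonneg)
  have Cb: "Cb > 0" by (rule bwd.surv_const(1))
  have N0: "real N > 0" using N by simp
  have up: "\<kappa> * reflected N v y \<le> a * v" if "v > 0" for v
  proof -
    have "\<kappa> * reflected N v y \<le> \<kappa> * (2 * y * v / (sqrt (2 * pi) * N * sqrt N))"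
      using kappa_pos N0 y that by (intro mult_left_mono reflected_upper) auto
    then show ?thesis by (simp add: a_def \<kappa>'_def mult_ac)
  qed
  have lo: "a * v \<le> \<kappa> * reflected N v y + a / sqrt N * (y * v + v\<^sup>2)" if "v > 0" for v
  proof -
    have "\<kappa> * (2 * y * v / (sqrt (2 * pi) * N * sqrt N) * (1 - (y + v) / sqrt N)) \<le> \<kappa> * reflected N v y"
      using kappa_pos N0 y that by (intro mult_left_mono reflected_lower) auto
    moreover have "\<kappa> * (2 * y * v / (sqrt (2 * pi) * N * sqrt N) * (1 - (y + v) / sqrt N)) = a * v * (1 - (y + v) / sqrt N)"
      by (simp add: a_def \<kappa>'_def mult_ac)
    moreover have "a * v * (1 - (y + v) / sqrt N) = a * v - a / sqrt N * (y * v + v\<^sup>2)"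
      by (simp add: power2_eq_square algebra_simps add_divide_distrib)
    ultimately show ?thesis by linarith
  qed
  have split: "q (N + m) y z = (\<integral>\<^sup>+v. q N y v * q m v z \<partial>\<rho>)" using N m by (rule q_semigroup)
  have s1: "bwd.surv m (\<lambda>_. 1) z \<le> ennreal (Cb * bwd.hb z / sqrt m)" by (rule bwd.surv_const(2)[OF m])
  have s2: "bwd.surv m ennreal z \<le> ennreal (bwd.hb z)" by (rule bwd.surv_id_le)
  have s3: "bwd.surv m (\<lambda>u. ennreal (u\<^sup>2)) z \<le> ennreal (z\<^sup>2 + (1 + 2 * Cb * bwd.hb z * sqrt m))"
    using order_trans[OF bwd.surv_square_le[of m z] add_left_mono[OF bwd.sum_surv_one_le]] hb0 Cb
    by (subst ennreal_plus) auto
  let ?g = "\<lambda>v. ennreal a * ennreal v + ennreal b * 1"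
  have "q N y v * q m v z \<le> q m v z * ?g v" if "v \<in> G" for v
  proof (cases "v > 0")
    case True
    have "q N y v \<le> ennreal (a * v + b)"
      using bu[OF that True] up[OF True] by (auto elim!: order_trans intro!: ennreal_leI simp: b_def)
    also have "\<dots> = ?g v" using ab True by (simp add: ennreal_mult)
    finally have "q N y v * q m v z \<le> ?g v * q m v z" by (rule mult_right_mono) simp
    then show ?thesis by (simp only: mult.commute[of "q m v z"])
  qed (simp add: q_zero)
  then have "q (N + m) y z \<le> (\<integral>\<^sup>+v. q m v z * ?g v \<partial>\<rho>)"
    unfolding split using AE_in_G by (intro nn_integral_mono_AE) auto
  also have "\<dots> = bwd.surv m ?g z" using m z by (intro integral_q_bwd) auto
  also have "\<dots> = ennreal a * bwd.surv m ennreal z + ennreal b * bwd.surv m (\<lambda>_. 1) z"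
    by (subst bwd.kill_add) (auto simp: bwd.kill_cmult simp del: mult_1_right)
  also have "\<dots> \<le> ennreal a * ennreal (bwd.hb z) + ennreal b * ennreal (Cb * bwd.hb z / sqrt m)"
    by (intro add_mono mult_left_mono s1 s2) auto
  also have "\<dots> = ennreal (a * bwd.hb z + b * (Cb * bwd.hb z / sqrt m))"
  proof -
    have "0 \<le> a * bwd.hb z" "0 \<le> b * (Cb * bwd.hb z / sqrt m)" using ab hb0 Cb by auto
    then show ?thesis using ab by (simp only: ennreal_plus ennreal_mult')
  qed
  finally show "q (N + m) y z \<le> ennreal (\<kappa>' * y / (N * sqrt N) * bwd.hb z + \<eta> * (y / N) * (Cb * bwd.hb z / sqrt m))"
    unfolding a_def b_def .
  assume yz: "y - z \<in> L (N + m)"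
  define c where "c = a / sqrt N"
  have c0: "c \<ge> 0" using ab by (simp add: c_def)
  let ?h = "\<lambda>v. ennreal b * 1 + (ennreal (c * y) * ennreal v + ennreal c * ennreal (v\<^sup>2))"
  have pw: "q m v z * (ennreal a * ennreal v) \<le> q N y v * q m v z + q m v z * ?h v" if "v \<in> G" for v
  proof (cases "q m v z = 0")
    case False
    then have v: "v > 0" using q_zero[of v z m] by (cases "v > 0") auto
    \<comment> \<open>The lower estimate is available only on the right coset. A point
      \<open>v\<close> of positive weight differs from \<open>z\<close> by an element of
      \<open>L m\<close>, so the hypothesis on \<open>y - z\<close> forces
      \<open>y - v \<in> L N\<close>.\<close>
    have "v - z \<in> L m" using False m by (intro dens_support) auto
    then have yv: "y - v \<in> L N" using L_add[of m N "v - z" "y - v"] m N yz by (simp add: add.commute)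
    have "ennreal a * ennreal v \<le> ennreal (\<kappa> * reflected N v y + c * (y * v + v\<^sup>2))"
      using lo[OF v] ab by (simp add: ennreal_mult'[symmetric] ennreal_leI c_def)
    also have "\<dots> \<le> ennreal (\<kappa> * reflected N v y) + ennreal (c * (y * v + v\<^sup>2))"
      using c0 y v by (intro ennreal_plus_le) auto
    also have "\<dots> \<le> (q N y v + ennreal b) + ennreal (c * (y * v + v\<^sup>2))"
      unfolding b_def by (intro add_right_mono bl that v yv)
    also have "ennreal (c * (y * v + v\<^sup>2)) = ennreal (c * y) * ennreal v + ennreal c * ennreal (v\<^sup>2)"
      using c0 y v by (simp add: distrib_left ennreal_mult mult.assoc)
    finally have "q m v z * (ennreal a * ennreal v) \<le> q m v z * (q N y v + ennreal b
       + (ennreal (c * y) * ennreal v + ennreal c * ennreal (v\<^sup>2)))"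
      by (rule mult_left_mono) simp
    then show ?thesis by (simp add: distrib_left mult.commute add.assoc)
  qed simp
  have "ennreal (a * z) \<le> ennreal a * bwd.surv m ennreal z"
    using ab z by (subst ennreal_mult) (auto intro!: mult_left_mono bwd.surv_id_ge)
  also have "\<dots> = (\<integral>\<^sup>+v. q m v z * (ennreal a * ennreal v) \<partial>\<rho>)"
    using m z by (subst integral_q_bwd) (auto simp: bwd.kill_cmult)
  also have "\<dots> \<le> (\<integral>\<^sup>+v. q N y v * q m v z + q m v z * ?h v \<partial>\<rho>)"
    using AE_in_G pw by (intro nn_integral_mono_AE) auto
  also have "\<dots> = q (N + m) y z + (\<integral>\<^sup>+v. q m v z * ?h v \<partial>\<rho>)"
    unfolding split by (rule nn_integral_add) measurable
  also have "(\<integral>\<^sup>+v. q m v z * ?h v \<partial>\<rho>) = bwd.surv m ?h z"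
    using m z by (intro integral_q_bwd) auto
  also have "\<dots> = ennreal b * bwd.surv m (\<lambda>_. 1) z + (ennreal (c * y) * bwd.surv m ennreal z + ennreal c * bwd.surv m (\<lambda>u. ennreal (u\<^sup>2)) z)"
    by (simp add: bwd.kill_add bwd.kill_cmult del: mult_1_right)
  also have "\<dots> \<le> ennreal b * ennreal (Cb * bwd.hb z / sqrt m) + (ennreal (c * y) * ennreal (bwd.hb z)
     + ennreal c * ennreal (z\<^sup>2 + (1 + 2 * Cb * bwd.hb z * sqrt m)))"
    by (intro add_mono mult_left_mono s1 s2 s3) auto
  also have "\<dots> = ennreal (b * (Cb * bwd.hb z / sqrt m)
     + c * (y * bwd.hb z + (z\<^sup>2 + (1 + 2 * Cb * bwd.hb z * sqrt m))))"
  proof -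
    have nn: "0 \<le> b * (Cb * bwd.hb z / sqrt m)" "0 \<le> c * y * bwd.hb z" "0 \<le> c * (z\<^sup>2 + (1 + 2 * Cb * bwd.hb z * sqrt m))"
      "0 \<le> c * y"
      using ab c0 hb0 Cb y by auto
    have "c * (y * bwd.hb z + (z\<^sup>2 + (1 + 2 * Cb * bwd.hb z * sqrt m)))
       = c * y * bwd.hb z + c * (z\<^sup>2 + (1 + 2 * Cb * bwd.hb z * sqrt m))" by (simp add: distrib_left)
    then show ?thesis using nn ab c0 by (simp only: ennreal_plus ennreal_mult' add_nonneg_nonneg)
  qed
  finally show "ennreal (\<kappa>' * y / (N * sqrt N) * z) \<le> q (N + m) y z
       + ennreal (\<eta> * (y / N) * (Cb * bwd.hb z / sqrt m)
         + \<kappa>' * y / (N * sqrt N) / sqrt N * (y * bwd.hb z + (z\<^sup>2 + (1 + 2 * Cb * bwd.hb z * sqrt m))))"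
    unfolding a_def b_def c_def by (simp add: add_left_mono)
qed

end

context llt_walk
begin

lemma bulk_const_nonneg: "0 \<le> bulk_const"
  using bulk_const_ge(4) kappa_pos by linarith

definition "ratio_const = 14 + 16 * Cb + 4 * bulk_const * Cb / \<kappa>'"

text \<open>With \<open>m\<close> about \<open>\<delta> n\<close>, the bulk error contributes
  relatively \<open>\<delta> sqrt (n / m)\<close> and the spread of the reversed walk
  \<open>sqrt (m / n)\<close>, both of order \<open>sqrt \<delta>\<close>. The overshoot from
  \<open>z\<close> and the replacement of \<open>N\<close> by \<open>n\<close> cost
  \<open>O(\<delta>)\<close>, and \<open>small\<close> controls \<open>y / sqrt n\<close> and
  \<open>z / sqrt n\<close>.\<close>

lemma ratio_at:
  assumes \<delta>: "0 < \<delta>" "\<delta> \<le> 1/4" and m: "\<delta> * n / 2 \<le> real m" "real m \<le> \<delta> * n" "m \<ge> 1" and n: "N + m = n" "N \<ge> 1"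
    and y: "y \<in> G" "y > 0" and z: "z \<in> G" "z \<ge> 1" and yz: "y - z \<in> L n"
    and hz: "bwd.hb z - z \<le> \<delta> * z"
    and small: "y \<le> sqrt \<delta> / 2 * sqrt n" "z \<le> sqrt \<delta> / 2 * sqrt n" "1 \<le> sqrt \<delta> / 2 * sqrt n"
    and bu: "\<And>v. v \<in> G \<Longrightarrow> v > 0 \<Longrightarrow> q N y v \<le> ennreal (\<kappa> * reflected N v y + bulk_const * \<delta> * (y / N))"
    and bl: "\<And>v. v \<in> G \<Longrightarrow> v > 0 \<Longrightarrow> y - v \<in> L N \<Longrightarrow>
      ennreal (\<kappa> * reflected N v y) \<le> q N y v + ennreal (bulk_const * \<delta> * (y / N))"
  shows "\<bar>enn2real (q n y z) * (n * sqrt n / (\<kappa>' * y * z)) - 1\<bar> \<le> ratio_const * sqrt \<delta>"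
proof -
  define h where "h = bwd.hb z"
  define F where "F = n * sqrt n / (\<kappa>' * y * z)"
  \<comment> \<open>Normalising with \<open>n\<close> instead of \<open>N\<close> costs exactly the
    factor \<open>t * sqrt t\<close>, which lies between 1 and
    \<open>1 / (1 - \<delta>)^2\<close>.\<close>
  define t where "t = real n / real N"
  define e where "e = sqrt \<delta>"
  have e: "e > 0" "\<delta> = e\<^sup>2" using \<delta> by (auto simp: e_def)
  have e1: "e \<le> 1" using \<delta> by (simp add: e_def)
  have k': "\<kappa>' > 0" by (rule kappa'_pos)
  have Cb: "Cb > 0" by (rule bwd.surv_const(1))
  have h: "0 \<le> h" "h / z \<le> 1 + \<delta>" "h / z \<le> 2"
  proof -
    show "0 \<le> h" by (simp add: h_def overshoot_bound_nonneg)
    show "h / z \<le> 1 + \<delta>" using hz z unfolding h_def[symmetric] by (simp add: field_simps)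
    then show "h / z \<le> 2" using \<delta> by linarith
  qed
  have F: "F > 0" using n m k' y z by (auto simp: F_def)
  have Nn: "real N = real n - real m" using n by linarith
  have n0: "real n > 0" using n by linarith
  have N34: "real N \<ge> (1 - \<delta>) * n" using m(2) Nn by (simp add: algebra_simps)
  have N34': "3 / 4 * real n \<le> real N" using N34 mult_right_mono[OF \<delta>(2), of "real n"] by (simp add: algebra_simps)
  have N0: "real N > 0" using n by simp
  have t: "1 \<le> t" "t \<le> 4/3" "t \<le> 1 / (1 - \<delta>)"
  proof -
    show "1 \<le> t" using Nn N0 by (simp add: t_def)
    show "t \<le> 4/3" using N34' N0 by (simp add: t_def field_simps)
    show "t \<le> 1 / (1 - \<delta>)" using N34 N0 \<delta> by (simp add: t_def field_simps)
  qed
  have st: "1 \<le> sqrt t" "sqrt t \<le> t"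
  proof -
    show "1 \<le> sqrt t" using t by simp
    have "t * 1 \<le> t * t" using t by (intro mult_left_mono) auto
    then show "sqrt t \<le> t" using t by (intro real_le_lsqrt) (auto simp: power2_eq_square)
  qed
  have tt: "1 \<le> t * sqrt t" "t * sqrt t \<le> t\<^sup>2" "t * sqrt t \<le> 2"
  proof -
    show "1 \<le> t * sqrt t" using mult_mono[of 1 t 1 "sqrt t"] t st by simp
    show a: "t * sqrt t \<le> t\<^sup>2" using mult_left_mono[OF st(2), of t] t by (simp add: power2_eq_square)
    have "t\<^sup>2 \<le> (4/3)\<^sup>2" using t by (intro power_mono) auto
    then show "t * sqrt t \<le> 2" using a by (simp add: power_divide)
  qed
  have sn: "sqrt n = sqrt t * sqrt N" using N0 by (simp add: t_def real_sqrt_divide)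
  have nt: "real n = t * real N" using N0 by (simp add: t_def)
  have sm: "sqrt m > 0" using m by simp
  define a where "a = \<kappa>' * y / (N * sqrt N)"
  have aF: "a * c * F = t * sqrt t * (c / z)" for c
  proof -
    have "a * c * F = \<kappa>' * y * c * (real n * sqrt n) / ((N * sqrt N) * (\<kappa>' * y * z))"
      by (simp add: a_def F_def)
    also have "\<dots> = (real n * sqrt n) / (N * sqrt N) * (c / z)" using k' y by (simp add: mult_ac)
    also have "(real n * sqrt n) / (N * sqrt N) = t * sqrt t" using N0 unfolding sn by (subst nt) simp
    finally show ?thesis .
  qed
  define b where "b = bulk_const * \<delta> * (y / N) * (Cb * h / sqrt m)"
  have bF: "b * F \<le> 4 * bulk_const * Cb / \<kappa>' * e"
  proof -
    have snm: "sqrt n / sqrt m \<le> 3 / 2 / e"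
    proof -
      have "\<delta> * n \<le> (3 / 2)\<^sup>2 * m" using m(1) by (simp add: power2_eq_square)
      then have "sqrt (\<delta> * n) \<le> sqrt ((3/2)\<^sup>2 * m)" by (rule real_sqrt_le_mono)
      then have "e * sqrt n \<le> 3 / 2 * sqrt m" by (simp add: real_sqrt_mult e_def)
      then show ?thesis using e sm by (simp add: field_simps)
    qed
    have "b * F = bulk_const * Cb / \<kappa>' * e\<^sup>2 * ((h / z) * (t * (sqrt n / sqrt m)))"
      using k' y z N0 sm by (simp add: b_def F_def e(2) t_def mult_ac)
    also have "\<dots> \<le> bulk_const * Cb / \<kappa>' * e\<^sup>2 * (2 * (4 / 3 * (3 / 2 / e)))"
      using h t snm e Cb k' z bulk_const_nonneg sm by (intro mult_left_mono mult_mono) auto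
    also have "\<dots> = 4 * bulk_const * Cb / \<kappa>' * e" using e by (simp add: power2_eq_square)
    finally show ?thesis .
  qed
  have b0: "b \<ge> 0" using bulk_const_nonneg \<delta> y Cb h sm by (simp add: b_def)
  have yN: "c / sqrt N \<le> e" if "c \<le> e / 2 * sqrt n" for c
  proof -
    have "c \<le> e / 2 * (sqrt t * sqrt N)" using that sn by simp
    also have "\<dots> \<le> e / 2 * (2 * sqrt N)" using st t e by (intro mult_left_mono mult_right_mono) auto
    finally show ?thesis using N0 by (simp add: divide_le_eq)
  qed
  define g where "g = a / sqrt N * (y * h + (z\<^sup>2 + (1 + 2 * Cb * h * sqrt m)))"
  have gF: "g * F \<le> (8 + 16 * Cb) * e"
  proof -
    have "g * F = a * ((y * h + (z\<^sup>2 + (1 + 2 * Cb * h * sqrt m))) / sqrt N) * F" by (simp add: g_def)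
    also have "\<dots> = t * sqrt t * ((y * h + (z\<^sup>2 + (1 + 2 * Cb * h * sqrt m))) / sqrt N / z)" by (rule aF)
    also have "(y * h + (z\<^sup>2 + (1 + 2 * Cb * h * sqrt m))) / sqrt N / z
       = (y / sqrt N) * (h / z) + z / sqrt N + (1 / sqrt N) * (1 / z) + 2 * Cb * (h / z) * (sqrt m / sqrt N)"
      using z N0 by (simp add: field_simps power2_eq_square)
    also have "t * sqrt t * \<dots> \<le> 2 * (e * 2 + e + e * 1 + 2 * Cb * 2 * (2 * e))"
    proof (intro mult_mono add_mono mult_left_mono)
      show "sqrt m / sqrt N \<le> 2 * e"
      proof -
        have "real m \<le> \<delta> * (4 / 3 * N)" using m(2) N34' \<delta> by (elim order_trans) (intro mult_left_mono; simp)
        also have "\<dots> \<le> (2 * e)\<^sup>2 * N" using e N0 by (simp add: power_mult_distrib)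
        finally have "sqrt m \<le> sqrt ((2 * e)\<^sup>2 * N)" by (rule real_sqrt_le_mono)
        then show ?thesis using e N0 by (simp add: real_sqrt_mult divide_le_eq)
      qed
    qed (use tt h z e y Cb N0 st t yN small in \<open>auto simp: e_def[symmetric] intro!: add_nonneg_nonneg\<close>)
    also have "\<dots> = (8 + 16 * Cb) * e" by (simp add: algebra_simps)
    finally show ?thesis .
  qed
  have g0: "g \<ge> 0" using k' y h Cb by (auto simp: g_def a_def)
  have \<eta>: "bulk_const * \<delta> \<ge> 0" using bulk_const_nonneg \<delta> by simp
  have z0: "z > 0" using z by simp
  have U: "q n y z \<le> ennreal (a * h + b)"
    using assemble_at(1)[OF n(2) m(3) y z(1) z0 \<eta> bu bl] unfolding n(1) a_def b_def h_def by simp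
  have Lo: "ennreal (a * z) \<le> q n y z + ennreal (b + g)"
    using assemble_at(2)[OF n(2) m(3) y z(1) z0 \<eta> bu bl] yz unfolding n(1) a_def b_def h_def g_def by simp
  define Q where "Q = enn2real (q n y z)"
  have Q: "q n y z = ennreal Q" "Q \<ge> 0"
  proof -
    have "q n y z < \<top>" using U by (rule le_less_trans) simp
    then show "q n y z = ennreal Q" "Q \<ge> 0" by (auto simp: Q_def)
  qed
  have a0: "a \<ge> 0" using k' y by (simp add: a_def)
  have "Q \<le> a * h + b" using U a0 h(1) b0 unfolding Q(1) by (subst (asm) ennreal_le_iff) auto
  then have "Q * F \<le> (a * h + b) * F" using F by (intro mult_right_mono) auto
  also have "\<dots> = a * h * F + b * F" by (simp add: distrib_right)
  also have "\<dots> \<le> t * sqrt t * (h / z) + 4 * bulk_const * Cb / \<kappa>' * e" using bF aF by simp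
  also have "t * sqrt t * (h / z) \<le> (1 / (1 - \<delta>))\<^sup>2 * (1 + \<delta>)"
  proof (intro mult_mono h)
    have "t\<^sup>2 \<le> (1 / (1 - \<delta>))\<^sup>2" using t by (intro power_mono) auto
    then show "t * sqrt t \<le> (1 / (1 - \<delta>))\<^sup>2" using tt by linarith
  qed (use h z in auto)
  \<comment> \<open>Multiplied out, this is
    \<open>\<delta> * (3 - 11 \<delta> + 6 \<delta>^2) \<ge> 0\<close>, which the bound
    \<open>\<delta> \<le> 1/4\<close> ensures.\<close>
  also have "(1 / (1 - \<delta>))\<^sup>2 * (1 + \<delta>) \<le> 1 + 6 * \<delta>"
  proof -
    have "0 \<le> \<delta> * (3 - 11 * \<delta> + 6 * \<delta>\<^sup>2)" using \<delta> by (intro mult_nonneg_nonneg add_nonneg_nonneg) auto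
    then have "1 + \<delta> \<le> (1 + 6 * \<delta>) * (1 - \<delta>)\<^sup>2" by (simp add: power2_eq_square algebra_simps)
    then show ?thesis using \<delta> by (simp add: power_divide divide_le_eq)
  qed
  also have "6 * \<delta> \<le> 6 * e" using e e1 by (simp add: power2_eq_square mult_left_le)
  finally have up: "Q * F \<le> 1 + 6 * e + 4 * bulk_const * Cb / \<kappa>' * e" by simp
  have "ennreal (a * z) \<le> ennreal (Q + (b + g))"
    using Lo Q b0 g0 by (simp add: ennreal_plus)
  then have "a * z \<le> Q + (b + g)" using Q b0 g0 by (subst (asm) ennreal_le_iff) auto
  then have "a * z * F \<le> (Q + (b + g)) * F" using F by (intro mult_right_mono) auto
  moreover have "a * z * F = t * sqrt t" using aF[of z] z by simp
  moreover have "(Q + (b + g)) * F = Q * F + b * F + g * F" by (simp add: algebra_simps)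
  ultimately have lo: "1 - 4 * bulk_const * Cb / \<kappa>' * e - (8 + 16 * Cb) * e \<le> Q * F"
    using tt(1) bF gF by linarith
  have pos: "0 \<le> Cb * e" "0 \<le> 4 * bulk_const * Cb / \<kappa>' * e" using Cb e bulk_const_nonneg k' by auto
  have "ratio_const * e = 14 * e + 16 * (Cb * e) + 4 * bulk_const * Cb / \<kappa>' * e"
    by (simp add: ratio_const_def algebra_simps)
  moreover have "(8 + 16 * Cb) * e = 8 * e + 16 * (Cb * e)" by (simp add: algebra_simps)
  ultimately have "\<bar>Q * F - 1\<bar> \<le> ratio_const * e" using up lo pos e(1) by (simp add: abs_le_iff)
  then show ?thesis unfolding Q_def F_def e_def .
qed

theorem killed_density_limit:
  fixes y z :: "nat \<Rightarrow> real"
  assumes G: "\<forall>\<^sub>F n in sequentially. y n \<in> G \<and> z n \<in> G \<and> y n - z n \<in> L n"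
    and y: "filterlim y at_top sequentially" "(\<lambda>n. y n / sqrt n) \<longlonglongrightarrow> 0"
    and z: "filterlim z at_top sequentially" "(\<lambda>n. z n / sqrt n) \<longlonglongrightarrow> 0"
  shows "(\<lambda>n. enn2real (q n (y n) (z n)) * (n * sqrt n / (\<kappa>' * y n * z n))) \<longlonglongrightarrow> 1"
proof -
  let ?X = "\<lambda>n. enn2real (q n (y n) (z n)) * (n * sqrt n / (\<kappa>' * y n * z n))"
  have main: "\<forall>\<^sub>F n in sequentially. \<bar>?X n - 1\<bar> \<le> ratio_const * sqrt \<delta>" if \<delta>: "0 < \<delta>" "\<delta> \<le> 1/4" for \<delta>
  proof -
    obtain Y where "\<forall>\<^sub>F N in sequentially. \<forall>y\<in>G. \<forall>v\<in>G. y \<ge> Y \<longrightarrow> v > 0 \<longrightarrow>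
      q N y v \<le> ennreal (\<kappa> * reflected N v y + bulk_const * \<delta> * (y / N)) \<and>
      (y - v \<in> L N \<longrightarrow> ennreal (\<kappa> * reflected N v y) \<le> q N y v + ennreal (bulk_const * \<delta> * (y / N)))"
      using bulk[of \<delta>] \<delta> by auto
    then obtain N0 where N0: "\<And>N y v. N \<ge> N0 \<Longrightarrow> y \<in> G \<Longrightarrow> v \<in> G \<Longrightarrow> y \<ge> Y \<Longrightarrow> v > 0 \<Longrightarrow>
      q N y v \<le> ennreal (\<kappa> * reflected N v y + bulk_const * \<delta> * (y / N)) \<and>
      (y - v \<in> L N \<longrightarrow> ennreal (\<kappa> * reflected N v y) \<le> q N y v + ennreal (bulk_const * \<delta> * (y / N)))"
      unfolding eventually_sequentially by blast
    define Z where "Z = 2 / \<delta> * (bwd.barrier_shift + \<delta> * bwd.barrier_shift / 2 + 1 / (2 * \<delta>))"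
    have e0: "sqrt \<delta> / 2 > 0" using \<delta> by simp
    have top: "filterlim (\<lambda>N. sqrt (real N)) at_top sequentially"
      by (rule filterlim_compose[OF sqrt_at_top filterlim_real_sequentially])
    have ev1: "\<forall>\<^sub>F n in sequentially. y n \<ge> max 1 Y" "\<forall>\<^sub>F n in sequentially. z n \<ge> max 1 Z"
      using y(1) z(1) unfolding filterlim_at_top by blast+
    have ev2: "\<forall>\<^sub>F n in sequentially. y n / sqrt n < sqrt \<delta> / 2" "\<forall>\<^sub>F n in sequentially. z n / sqrt n < sqrt \<delta> / 2"
      using order_tendstoD(2)[OF y(2) e0] order_tendstoD(2)[OF z(2) e0] by auto
    have ev3: "\<forall>\<^sub>F n in sequentially. sqrt (real n) \<ge> 1 / (sqrt \<delta> / 2)"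
      using top unfolding filterlim_at_top by blast
    have ev4: "\<forall>\<^sub>F n in sequentially. real n \<ge> 2 / \<delta> + 2 * real N0 + 4"
      using filterlim_real_sequentially unfolding filterlim_at_top by blast
    show ?thesis
      using G ev1 ev2 ev3 ev4
    proof eventually_elim
      case (elim n)
      define m where "m = nat \<lfloor>\<delta> * n\<rfloor>"
      define N where "N = n - m"
      have dn: "\<delta> * n \<ge> 2"
      proof -
        have "real n \<ge> 2 / \<delta>" using elim \<delta> by linarith
        then show ?thesis using \<delta> by (simp add: field_simps)
      qed
      have m: "\<delta> * n / 2 \<le> real m" "real m \<le> \<delta> * n" "m \<ge> 1"
        using dn unfolding m_def by linarith+
      have mn: "real m \<le> n / 4" using m(2) mult_right_mono[OF \<delta>(2), of "real n"] by simp
      have "0 \<le> 2 / \<delta>" using \<delta> by simp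
      then have n4: "real n \<ge> 2 * real N0 + 4" using elim by linarith
      have N: "N + m = n" "N \<ge> 1" "N \<ge> N0"
      proof -
        show a: "N + m = n" using mn unfolding N_def by linarith
        then show "N \<ge> 1" "N \<ge> N0" using mn n4 by linarith+
      qed
      have n0: "sqrt n > 0" using n4 by simp
      show ?case
      proof (rule ratio_at[OF \<delta> m N(1,2)])
        show "bwd.hb (z n) - z n \<le> \<delta> * z n"
          using elim \<delta> by (intro overshoot_bound_le) (auto simp: Z_def bwd.barrier_shift_def)
        show "y n \<le> sqrt \<delta> / 2 * sqrt n" "z n \<le> sqrt \<delta> / 2 * sqrt n" "1 \<le> sqrt \<delta> / 2 * sqrt n"
          using elim n0 e0 \<delta> by (auto simp: divide_less_eq divide_le_eq mult.commute)
      qed (use elim N0 N(3) in auto)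
    qed
  qed
  have rc: "ratio_const > 0"
    using bwd.surv_const(1) bulk_const_nonneg kappa'_pos unfolding ratio_const_def
    by (intro add_pos_nonneg) auto
  show ?thesis
  proof (rule tendstoI)
    fix e :: real assume e: "e > 0"
    define \<delta> where "\<delta> = min (1/4) ((e / (2 * ratio_const))\<^sup>2)"
    have \<delta>: "0 < \<delta>" "\<delta> \<le> 1/4" using e rc by (auto simp: \<delta>_def)
    have "sqrt \<delta> \<le> e / (2 * ratio_const)" using e rc by (intro real_le_lsqrt) (auto simp: \<delta>_def)
    then have "ratio_const * sqrt \<delta> \<le> ratio_const * (e / (2 * ratio_const))" using rc by (intro mult_left_mono) auto
    also have "\<dots> = e / 2" using rc by simp
    finally have "ratio_const * sqrt \<delta> < e" using e by linarith
    then show "\<forall>\<^sub>F n in sequentially. dist (?X n) 1 < e"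
      using main[OF \<delta>] by (auto simp: dist_real_def elim!: eventually_mono)
  qed
qed

lemma free_density_limit:
  fixes y z :: "nat \<Rightarrow> real"
  assumes G: "\<forall>\<^sub>F n in sequentially. y n \<in> G \<and> z n \<in> G \<and> y n - z n \<in> L n"
    and lim: "(\<lambda>n. (y n - z n) / sqrt n) \<longlonglongrightarrow> 0"
  shows "(\<lambda>n. enn2real (p n (y n) (z n)) * sqrt n) \<longlonglongrightarrow> \<kappa>' / 2"
    and "\<forall>\<^sub>F n in sequentially. p n (y n) (z n) < \<top>"
proof -
  let ?g = "\<lambda>n. \<kappa> * gauss n (y n - z n) * sqrt n"
  have "(\<lambda>n. \<kappa> / sqrt (2 * pi) * exp (- (((y n - z n) / sqrt n)\<^sup>2) / 2)) \<longlonglongrightarrow> \<kappa> / sqrt (2 * pi) * exp (- (0\<^sup>2) / 2)"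
    by (intro tendsto_intros lim) auto
  moreover have "\<forall>\<^sub>F n in sequentially. \<kappa> / sqrt (2 * pi) * exp (- (((y n - z n) / sqrt n)\<^sup>2) / 2) = ?g n"
    using eventually_gt_at_top[of 0] by eventually_elim (simp add: gauss_scale)
  ultimately have g: "?g \<longlonglongrightarrow> \<kappa>' / 2"
    by (simp add: \<kappa>'_def filterlim_cong)
  have near: "\<forall>\<^sub>F n in sequentially. p n (y n) (z n) < \<top> \<and> \<bar>enn2real (p n (y n) (z n)) * sqrt n - ?g n\<bar> \<le> \<eta>"
    if \<eta>: "\<eta> > 0" for \<eta>
    using G llt_upper[OF \<eta>] llt_lower[OF \<eta>] eventually_gt_at_top[of 0]
  proof eventually_elim
    case (elim n)
    define P where "P = enn2real (p n (y n) (z n))"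
    have u: "p n (y n) (z n) \<le> ennreal (\<kappa> * gauss n (y n - z n) + \<eta> / sqrt n)"
      and l: "ennreal (\<kappa> * gauss n (y n - z n) - \<eta> / sqrt n) \<le> p n (y n) (z n)"
      using elim by auto
    have fin: "p n (y n) (z n) < \<top>" using u by (rule le_less_trans) simp
    then have P: "p n (y n) (z n) = ennreal P" "P \<ge> 0" by (auto simp: P_def)
    have g0: "0 \<le> \<kappa> * gauss n (y n - z n)" using kappa_pos by (simp add: gauss_nonneg)
    have s: "sqrt n > 0" using elim by simp
    have u': "P \<le> \<kappa> * gauss n (y n - z n) + \<eta> / sqrt n"
      using u g0 \<eta> unfolding P by (subst (asm) ennreal_le_iff) auto
    have l': "\<kappa> * gauss n (y n - z n) - \<eta> / sqrt n \<le> P"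
      using l P by (cases "0 \<le> \<kappa> * gauss n (y n - z n) - \<eta> / sqrt n") (auto simp: ennreal_le_iff)
    have "P * sqrt n \<le> ?g n + \<eta>" "?g n - \<eta> \<le> P * sqrt n"
      using mult_right_mono[OF u', of "sqrt n"] mult_right_mono[OF l', of "sqrt n"] s
      by (auto simp: algebra_simps)
    then show ?case using fin unfolding P_def by (auto simp: abs_le_iff)
  qed
  show "\<forall>\<^sub>F n in sequentially. p n (y n) (z n) < \<top>"
    using near[of 1] by (auto elim!: eventually_mono)
  have "(\<lambda>n. enn2real (p n (y n) (z n)) * sqrt n - ?g n) \<longlonglongrightarrow> 0"
  proof (rule tendstoI)
    fix e :: real assume "e > 0"
    then show "\<forall>\<^sub>F n in sequentially. dist (enn2real (p n (y n) (z n)) * sqrt n - ?g n) 0 < e"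
      using near[of "e / 2"] by (auto simp: dist_real_def elim!: eventually_mono)
  qed
  from tendsto_add[OF this g] show "(\<lambda>n. enn2real (p n (y n) (z n)) * sqrt n) \<longlonglongrightarrow> \<kappa>' / 2" by simp
qed

theorem density_ratio_limit:
  fixes y z :: "nat \<Rightarrow> real"
  assumes G: "\<forall>\<^sub>F n in sequentially. y n \<in> G \<and> z n \<in> G \<and> y n - z n \<in> L n"
    and y: "filterlim y at_top sequentially" "(\<lambda>n. y n / sqrt n) \<longlonglongrightarrow> 0"
    and z: "filterlim z at_top sequentially" "(\<lambda>n. z n / sqrt n) \<longlonglongrightarrow> 0"
  shows "(\<lambda>n. enn2real (q n (y n) (z n)) / enn2real (p n (y n) (z n)) / (2 * y n * z n / real n)) \<longlonglongrightarrow> 1"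
    and "\<forall>\<^sub>F n in sequentially. 0 < p n (y n) (z n) \<and> p n (y n) (z n) < \<top>"
proof -
  let ?P = "\<lambda>n. enn2real (p n (y n) (z n))" and ?Q = "\<lambda>n. enn2real (q n (y n) (z n))"
  have P: "(\<lambda>n. ?P n * sqrt n) \<longlonglongrightarrow> \<kappa>' / 2" and fin: "\<forall>\<^sub>F n in sequentially. p n (y n) (z n) < \<top>"
    using free_density_limit[OF G] tendsto_diff[OF y(2) z(2)] by (auto simp: diff_divide_distrib)
  have k': "\<kappa>' > 0" by (rule kappa'_pos)
  have pos: "\<forall>\<^sub>F n in sequentially. 0 < ?P n * sqrt n"
    using order_tendstoD(1)[OF P, of 0] k' by auto
  show "\<forall>\<^sub>F n in sequentially. 0 < p n (y n) (z n) \<and> p n (y n) (z n) < \<top>"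
    using pos fin by eventually_elim (auto simp: zero_less_iff_neq_zero)
  have "(\<lambda>n. ?Q n * (n * sqrt n / (\<kappa>' * y n * z n)) * (\<kappa>' / 2) / (?P n * sqrt n)) \<longlonglongrightarrow> 1 * (\<kappa>' / 2) / (\<kappa>' / 2)"
    using k' by (intro tendsto_intros killed_density_limit[OF G y z] P) auto
  moreover have "\<forall>\<^sub>F n in sequentially. ?Q n * (n * sqrt n / (\<kappa>' * y n * z n)) * (\<kappa>' / 2) / (?P n * sqrt n)
     = ?Q n / ?P n / (2 * y n * z n / real n)"
    using eventually_gt_at_top[of 0] pos by eventually_elim (use k' in \<open>simp add: field_simps\<close>)
  ultimately show "(\<lambda>n. ?Q n / ?P n / (2 * y n * z n / real n)) \<longlonglongrightarrow> 1"
    using k' by (simp add: filterlim_cong)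
qed

end

section \<open>Fourier inversion and the local limit theorem\<close>

lemma integrable_exp_square: "c > 0 \<Longrightarrow> integrable lborel (\<lambda>s :: real. exp (- s\<^sup>2 / c))"
proof -
  assume c: "c > 0"
  have "integrable lborel (\<lambda>s. sqrt (pi * c) * normal_density 0 (sqrt (c / 2)) s)"
    using c by (intro integrable_mult_right integrable_normal_density) auto
  also have "(\<lambda>s. sqrt (pi * c) * normal_density 0 (sqrt (c / 2)) s) = (\<lambda>s. exp (- s\<^sup>2 / c))"
    using c by (auto simp: normal_density_def)
  finally show ?thesis .
qed

section \<open>Powers of the characteristic function\<close>

context fourth_moment_walk
begin

lemma char_taylor: "cmod (char M t - (1 - t\<^sup>2 / 2)) \<le> \<bar>t\<bar> ^ 3 * abs_moment_3 / 6"
proof -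
  have v: "variance (\<lambda>x. x) = 1" by (simp add: mean_0 variance_1)
  have "cmod (char M t - (1 - t\<^sup>2 * 1 / 2)) \<le> t\<^sup>2 / 6 * expectation (\<lambda>x. min (6 * x\<^sup>2) (\<bar>t\<bar> * \<bar>x\<bar> ^ 3))"
    using char_approx3[OF _ _ _ v, of t] by (simp add: mean_0)
  also have "\<dots> \<le> t\<^sup>2 / 6 * expectation (\<lambda>x. \<bar>t\<bar> * \<bar>x\<bar> ^ 3)"
    by (intro mult_left_mono integral_mono integrable_min) auto
  also have "\<dots> = \<bar>t\<bar> ^ 3 * abs_moment_3 / 6"
    by (simp add: abs_moment_3_def power2_eq_square power3_eq_cube)
  finally show ?thesis by simp
qed

lemma char_near_0: "\<exists>r>0. \<forall>t. \<bar>t\<bar> \<le> r \<longrightarrow> cmod (char M t) \<le> exp (- t\<^sup>2 / 4)"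
proof (intro exI conjI allI impI)
  \<comment> \<open>On this interval the cubic Taylor error is at most \<open>t^2 / 4\<close>, half
    of the quadratic term. The added 1 keeps the denominator positive.\<close>
  let ?r = "min 1 (3 / (2 * (abs_moment_3 + 1)))"
  show "?r > 0" using abs_moment_3_nonneg by simp
  fix t assume t: "\<bar>t\<bar> \<le> ?r"
  have t1: "t\<^sup>2 \<le> 1" using t by (simp add: abs_square_le_1)
  have "\<bar>t\<bar> * (abs_moment_3 + 1) \<le> 3 / 2"
    using t abs_moment_3_nonneg by (simp add: field_simps)
  then have "\<bar>t\<bar> * abs_moment_3 \<le> 3 / 2" by (simp add: algebra_simps)
  then have "t\<^sup>2 * (\<bar>t\<bar> * abs_moment_3) \<le> t\<^sup>2 * (3 / 2)" by (intro mult_left_mono) auto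
  then have "\<bar>t\<bar> ^ 3 * abs_moment_3 / 6 \<le> t\<^sup>2 / 4" by (simp add: power2_eq_square power3_eq_cube)
  then have "cmod (char M t - (1 - t\<^sup>2 / 2)) \<le> t\<^sup>2 / 4" using char_taylor[of t] by linarith
  moreover have "cmod (complex_of_real (1 - t\<^sup>2 / 2)) = 1 - t\<^sup>2 / 2"
    unfolding norm_of_real using t1 by simp
  ultimately have "cmod (char M t) \<le> 1 - t\<^sup>2 / 4"
    using norm_triangle_sub[of "char M t" "complex_of_real (1 - t\<^sup>2 / 2)"] by simp
  also have "\<dots> \<le> exp (- t\<^sup>2 / 4)" using exp_ge_add_one_self[of "- t\<^sup>2 / 4"] by simp
  finally show "cmod (char M t) \<le> exp (- t\<^sup>2 / 4)" .
qed

lemma char_power_tendsto: "(\<lambda>n. char M (s / sqrt n) ^ n) \<longlonglongrightarrow> complex_of_real (exp (- s\<^sup>2 / 2))"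
proof -
  \<comment> \<open>The range \<open>n \<ge> s^2 / 4\<close> puts the base
    \<open>1 - s^2 / (2 n)\<close> into the unit ball, where the difference of two
    \<open>n\<close>-th powers is at most \<open>n\<close> times the difference of the
    bases.\<close>
  have main: "\<forall>\<^sub>F n in sequentially. cmod (char M (s / sqrt n) ^ n - complex_of_real ((1 + (- s\<^sup>2 / 2) / n) ^ n))
     \<le> \<bar>s\<bar> ^ 3 * abs_moment_3 / 6 * inverse (sqrt n)"
    using eventually_ge_at_top[of "Suc (nat \<lceil>s\<^sup>2 / 4\<rceil>)"]
  proof eventually_elim
    case (elim n)
    have n: "real n > 0" "real n \<ge> s\<^sup>2 / 4" using elim by linarith+
    have eq: "1 + (- s\<^sup>2 / 2) / n = 1 - (s / sqrt n)\<^sup>2 / 2" using n by (simp add: power_divide)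
    have "\<bar>1 + (- s\<^sup>2 / 2) / n\<bar> \<le> 1" using n by (intro abs_leI) (auto simp: field_simps)
    then have "cmod (complex_of_real (1 + (- s\<^sup>2 / 2) / n)) \<le> 1" unfolding norm_of_real .
    then have "cmod (char M (s / sqrt n) ^ n - complex_of_real (1 + (- s\<^sup>2 / 2) / n) ^ n)
       \<le> n * cmod (char M (s / sqrt n) - complex_of_real (1 + (- s\<^sup>2 / 2) / n))"
      by (intro norm_power_diff cmod_char_le_1)
    also have "\<dots> \<le> n * (\<bar>s / sqrt n\<bar> ^ 3 * abs_moment_3 / 6)"
      unfolding eq using char_taylor[of "s / sqrt n"] by (intro mult_left_mono) auto
    also have "\<dots> = \<bar>s\<bar> ^ 3 * abs_moment_3 / 6 * inverse (sqrt n)"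
    proof -
      have "sqrt n ^ 3 = n * sqrt n" using n by (simp add: power3_eq_cube)
      then show ?thesis using n by (simp add: abs_divide power_divide field_simps)
    qed
    finally show ?case by simp
  qed
  have "(\<lambda>n. inverse (sqrt (real n))) \<longlonglongrightarrow> 0"
    by (intro tendsto_inverse_0_at_top filterlim_compose[OF sqrt_at_top filterlim_real_sequentially])
  then have z: "(\<lambda>n. \<bar>s\<bar> ^ 3 * abs_moment_3 / 6 * inverse (sqrt (real n))) \<longlonglongrightarrow> 0"
    by (rule tendsto_mult_right_zero)
  have "(\<lambda>n. complex_of_real ((1 + (- s\<^sup>2 / 2) / n) ^ n)) \<longlonglongrightarrow> complex_of_real (exp (- s\<^sup>2 / 2))"
    by (rule isCont_tendsto_compose [OF _ tendsto_exp_limit_sequentially]) auto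
  then show ?thesis by (rule Lim_transform) (rule Lim_null_comparison[OF main z])
qed

text \<open>For \<open>\<bar>s\<bar> \<le> r sqrt n\<close> there is pointwise convergence with a
  Gaussian majorant. Outside, inside \<open>D\<close>, the modulus is at most \<open>c < 1\<close>:
  the factor \<open>c ^ (n - n0)\<close> is split off, and the remaining power \<open>n0\<close> is
  integrable, its integral growing only like \<open>sqrt n\<close> by scaling.\<close>

lemma char_power_integral_limit:
  assumes D [measurable]: "D \<in> sets borel" and r0: "r0 > 0" "{- r0..r0} \<subseteq> D"
    and int: "integrable lborel (\<lambda>t. indicator D t * cmod (char M t) ^ n0)"
    and away: "\<And>r. r > 0 \<Longrightarrow> \<exists>c<1. \<forall>t\<in>D. r \<le> \<bar>t\<bar> \<longrightarrow> cmod (char M t) \<le> c"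
  shows "(\<lambda>n. \<integral>s. cmod (indicator D (s / sqrt n) * char M (s / sqrt n) ^ n - complex_of_real (exp (- s\<^sup>2 / 2))) \<partial>lborel) \<longlonglongrightarrow> 0"
    and "n \<ge> 1 \<Longrightarrow> n \<ge> n0 \<Longrightarrow> integrable lborel (\<lambda>s. indicator D (s / sqrt n) * char M (s / sqrt n) ^ n)"
proof -
  obtain r1 where r1: "r1 > 0" "\<And>t. \<bar>t\<bar> \<le> r1 \<Longrightarrow> cmod (char M t) \<le> exp (- t\<^sup>2 / 4)"
    using char_near_0 by blast
  define r where "r = min r0 r1"
  have r: "r > 0" using r0 r1 by (simp add: r_def)
  obtain c0 where c0: "c0 < 1" "\<And>t. t \<in> D \<Longrightarrow> r \<le> \<bar>t\<bar> \<Longrightarrow> cmod (char M t) \<le> c0" using away[OF r] by blast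
  \<comment> \<open>\<open>c0\<close> may fail to be positive, for instance if no point of
    \<open>D\<close> has modulus at least \<open>r\<close>; the maximum makes division by
    \<open>c ^ n0\<close> possible.\<close>
  define c where "c = max c0 (1/2)"
  have c: "0 < c" "c < 1" "\<And>t. t \<in> D \<Longrightarrow> r \<le> \<bar>t\<bar> \<Longrightarrow> cmod (char M t) \<le> c"
    using c0 by (auto simp: c_def le_max_iff_disj)
  let ?e = "\<lambda>s :: real. exp (- s\<^sup>2 / 2)"
  \<comment> \<open>The difference near 0, continued by the mere Gaussian tail. This part has the
    majorant \<open>2 * exp (- s^2 / 4)\<close> for all \<open>n\<close>, and the far part of the
    characteristic function is treated separately.\<close>
  define A where "A = (\<lambda>n s. if \<bar>s\<bar> \<le> r * sqrt (real n) then cmod (char M (s / sqrt n) ^ n - ?e s) else ?e s)"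
  define I0 where "I0 = (\<integral>t. indicator D t * cmod (char M t) ^ n0 \<partial>lborel)"
  have sc: "integrable lborel (\<lambda>s. indicator D (s / sqrt n) * cmod (char M (s / sqrt n)) ^ n0)"
    "(\<integral>s. indicator D (s / sqrt n) * cmod (char M (s / sqrt n)) ^ n0 \<partial>lborel) = sqrt n * I0" if "n \<ge> 1" for n :: nat
  proof -
    have n: "1 / sqrt n \<noteq> 0" using that by simp
    show "integrable lborel (\<lambda>s. indicator D (s / sqrt n) * cmod (char M (s / sqrt n)) ^ n0)"
      using lborel_integrable_real_affine[OF int n, of 0] by simp
    have "I0 = \<bar>1 / sqrt n\<bar> *\<^sub>R (\<integral>s. indicator D (0 + 1 / sqrt n * s) * cmod (char M (0 + 1 / sqrt n * s)) ^ n0 \<partial>lborel)"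
      unfolding I0_def by (rule lborel_integral_real_affine[OF n])
    then show "(\<integral>s. indicator D (s / sqrt n) * cmod (char M (s / sqrt n)) ^ n0 \<partial>lborel) = sqrt n * I0"
      using that by (simp add: field_simps)
  qed
  have pw: "cmod (char M (s / sqrt n)) ^ n \<le> exp (- s\<^sup>2 / 4)" if "\<bar>s\<bar> \<le> r * sqrt n" "n \<ge> 1" for s and n :: nat
  proof -
    have "\<bar>s / sqrt n\<bar> \<le> r1" using that by (simp add: r_def min_mult_distrib_right divide_le_eq)
    then have "cmod (char M (s / sqrt n)) ^ n \<le> exp (- (s / sqrt n)\<^sup>2 / 4) ^ n"
      by (intro power_mono r1) auto
    also have "\<dots> = exp (real n * (- (s / sqrt n)\<^sup>2 / 4))" by (simp only: exp_of_nat_mult)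
    also have "real n * (- (s / sqrt n)\<^sup>2 / 4) = - s\<^sup>2 / 4" using that by (simp add: power_divide)
    finally show ?thesis .
  qed
  have e24: "?e s \<le> exp (- s\<^sup>2 / 4)" for s by simp
  have Abd: "\<bar>A n s\<bar> \<le> 2 * exp (- s\<^sup>2 / 4)" if "n \<ge> 1" for n s
  proof (cases "\<bar>s\<bar> \<le> r * sqrt n")
    case True
    have "cmod (char M (s / sqrt n) ^ n - ?e s) \<le> cmod (char M (s / sqrt n) ^ n) + cmod (complex_of_real (?e s))"
      by (rule norm_triangle_ineq4)
    also have "\<dots> \<le> exp (- s\<^sup>2 / 4) + exp (- s\<^sup>2 / 4)"
      using pw[OF True that] e24[of s] unfolding norm_of_real norm_power by (intro add_mono) auto
    finally show ?thesis using True by (simp add: A_def)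
  next
    case False
    have "?e s \<le> 2 * exp (- s\<^sup>2 / 4)" using e24[of s] exp_ge_zero[of "- s\<^sup>2 / 4"] by linarith
    then show ?thesis using False by (simp add: A_def)
  qed
  have meas [measurable]: "A n \<in> borel_measurable borel" for n unfolding A_def by measurable
  have intA: "integrable lborel (A n)" if "n \<ge> 1" for n
    by (rule Bochner_Integration.integrable_bound[where f = "\<lambda>s. 2 * exp (- s\<^sup>2 / 4)"])
      (use Abd[OF that] integrable_exp_square in auto)
  have limA: "(\<lambda>n. \<integral>s. A n s \<partial>lborel) \<longlonglongrightarrow> 0"
  proof -
    have "(\<lambda>n. \<integral>s. A (Suc n) s \<partial>lborel) \<longlonglongrightarrow> (\<integral>s. 0 \<partial>(lborel :: real measure))"
    proof (rule integral_dominated_convergence[where w = "\<lambda>s. 2 * exp (- s\<^sup>2 / 4)"])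
      show "AE s in lborel. (\<lambda>n. A (Suc n) s) \<longlonglongrightarrow> 0"
      proof (rule AE_I2)
        fix s :: real
        have "(\<lambda>n. cmod (char M (s / sqrt n) ^ n - ?e s)) \<longlonglongrightarrow> cmod (complex_of_real (?e s) - complex_of_real (?e s))"
          by (intro tendsto_intros char_power_tendsto)
        moreover have "\<forall>\<^sub>F n in sequentially. cmod (char M (s / sqrt n) ^ n - ?e s) = A n s"
        proof -
          have "\<forall>\<^sub>F n in sequentially. \<bar>s\<bar> / r \<le> sqrt (real n)"
            using filterlim_compose[OF sqrt_at_top filterlim_real_sequentially]
            unfolding filterlim_at_top by blast
          then show ?thesis by eventually_elim (use r in \<open>simp add: A_def field_simps\<close>)
        qed
        ultimately have "(\<lambda>n. A n s) \<longlonglongrightarrow> 0" by (simp add: filterlim_cong)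
        then show "(\<lambda>n. A (Suc n) s) \<longlonglongrightarrow> 0" by (rule LIMSEQ_Suc)
      qed
      show "AE s in lborel. norm (A (Suc n) s) \<le> 2 * exp (- s\<^sup>2 / 4)" for n
        using Abd[of "Suc n"] by auto
    qed (use integrable_exp_square in auto)
    then show ?thesis unfolding integral_zero by (rule LIMSEQ_imp_Suc)
  qed
  have C: "cmod (indicator D (s / sqrt n) * char M (s / sqrt n) ^ n - ?e s)
    \<le> A n s + c ^ (n - n0) * (indicator D (s / sqrt n) * cmod (char M (s / sqrt n)) ^ n0)"
    if "n \<ge> 1" "n \<ge> n0" for n s
  proof (cases "\<bar>s\<bar> \<le> r * sqrt n")
    case True
    then have "\<bar>s / sqrt n\<bar> \<le> r0" using that by (simp add: r_def min_mult_distrib_right divide_le_eq)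
    then have "s / sqrt n \<in> {- r0..r0}" unfolding atLeastAtMost_iff by linarith
    then have "s / sqrt n \<in> D" using r0(2) by blast
    then show ?thesis using True c by (simp add: A_def)
  next
    case False
    then have a: "r \<le> \<bar>s / sqrt n\<bar>" using that by (simp add: le_divide_eq)
    show ?thesis
    proof (cases "s / sqrt n \<in> D")
      case True
      have "cmod (char M (s / sqrt n) ^ n) = cmod (char M (s / sqrt n)) ^ (n - n0) * cmod (char M (s / sqrt n)) ^ n0"
        using that by (simp add: norm_power power_add[symmetric])
      also have "\<dots> \<le> c ^ (n - n0) * cmod (char M (s / sqrt n)) ^ n0"
        using c True a by (intro mult_right_mono power_mono) auto
      finally have "cmod (char M (s / sqrt n) ^ n - ?e s) \<le> c ^ (n - n0) * cmod (char M (s / sqrt n)) ^ n0 + ?e s"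
        using norm_triangle_ineq4[of "char M (s / sqrt n) ^ n" "complex_of_real (?e s)"] unfolding norm_of_real by simp
      then show ?thesis using True False by (simp add: A_def)
    next
      case no: False
      then show ?thesis using False by (simp add: A_def norm_exp_eq_Re)
    qed
  qed
  have intJ: "integrable lborel (\<lambda>s. cmod (indicator D (s / sqrt n) * char M (s / sqrt n) ^ n - ?e s))"
    if "n \<ge> 1" "n \<ge> n0" for n :: nat
    by (rule Bochner_Integration.integrable_bound[where f =
      "\<lambda>s. A n s + c ^ (n - n0) * (indicator D (s / sqrt n) * cmod (char M (s / sqrt n)) ^ n0)"])
      (use C[OF that] intA[OF that(1)] sc(1)[OF that(1)] in \<open>auto intro: order_trans[OF _ abs_ge_self]\<close>)
  have up: "(\<integral>s. cmod (indicator D (s / sqrt n) * char M (s / sqrt n) ^ n - ?e s) \<partial>lborel)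
     \<le> (\<integral>s. A n s \<partial>lborel) + c ^ (n - n0) * (sqrt n * I0)" if "n \<ge> 1" "n \<ge> n0" for n :: nat
  proof -
    have "(\<integral>s. cmod (indicator D (s / sqrt n) * char M (s / sqrt n) ^ n - ?e s) \<partial>lborel)
       \<le> (\<integral>s. A n s + c ^ (n - n0) * (indicator D (s / sqrt n) * cmod (char M (s / sqrt n)) ^ n0) \<partial>lborel)"
      using intJ[OF that] intA[OF that(1)] sc(1)[OF that(1)] C[OF that] by (intro integral_mono) auto
    also have "\<dots> = (\<integral>s. A n s \<partial>lborel) + c ^ (n - n0) * (sqrt n * I0)"
      using intA[OF that(1)] sc[OF that(1)] by simp
    finally show ?thesis .
  qed
  have I0: "I0 \<ge> 0" unfolding I0_def by (intro integral_nonneg_AE) auto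
  have lim0: "(\<lambda>n. c ^ (n - n0) * (sqrt n * I0)) \<longlonglongrightarrow> 0"
  proof (rule tendsto_sandwich[OF _ _ tendsto_const])
    have "(\<lambda>n. real n * c ^ n) \<longlonglongrightarrow> 0" using c by (intro powser_times_n_limit_0) auto
    from tendsto_mult_left[OF this, of "I0 / c ^ n0"]
    show "(\<lambda>n. I0 / c ^ n0 * (real n * c ^ n)) \<longlonglongrightarrow> 0" by simp
    show "\<forall>\<^sub>F n in sequentially. c ^ (n - n0) * (sqrt n * I0) \<le> I0 / c ^ n0 * (real n * c ^ n)"
      using eventually_ge_at_top[of "max 1 n0"]
    proof eventually_elim
      case (elim n)
      have "c ^ (n - n0) = c ^ n / c ^ n0" using c elim by (simp add: power_diff)
      moreover have "sqrt n \<le> real n"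
        using elim mult_mono[of 1 "real n" 1 "real n"] by (intro real_le_lsqrt) (auto simp: power2_eq_square)
      ultimately have "c ^ (n - n0) * (sqrt n * I0) \<le> c ^ n / c ^ n0 * (real n * I0)"
        using c I0 by (auto intro!: mult_left_mono mult_right_mono divide_right_mono)
      then show ?case by (simp add: mult_ac)
    qed
    show "\<forall>\<^sub>F n in sequentially. 0 \<le> c ^ (n - n0) * (sqrt n * I0)" using c I0 by simp
  qed
  show "(\<lambda>n. \<integral>s. cmod (indicator D (s / sqrt n) * char M (s / sqrt n) ^ n - ?e s) \<partial>lborel) \<longlonglongrightarrow> 0"
  proof (rule tendsto_sandwich[OF _ _ tendsto_const])
    show "(\<lambda>n. (\<integral>s. A n s \<partial>lborel) + c ^ (n - n0) * (sqrt n * I0)) \<longlonglongrightarrow> 0"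
      using tendsto_add[OF limA lim0] by simp
    show "\<forall>\<^sub>F n in sequentially. (\<integral>s. cmod (indicator D (s / sqrt n) * char M (s / sqrt n) ^ n - ?e s) \<partial>lborel)
       \<le> (\<integral>s. A n s \<partial>lborel) + c ^ (n - n0) * (sqrt n * I0)"
      using eventually_ge_at_top[of "max 1 n0"] by eventually_elim (use up in auto)
    show "\<forall>\<^sub>F n in sequentially. 0 \<le> (\<integral>s. cmod (indicator D (s / sqrt n) * char M (s / sqrt n) ^ n - ?e s) \<partial>lborel)"
      by (intro always_eventually allI integral_nonneg_AE) auto
  qed
  assume n: "n \<ge> 1" "n \<ge> n0"
  show "integrable lborel (\<lambda>s. indicator D (s / sqrt n) * char M (s / sqrt n) ^ n)"
  proof (rule Bochner_Integration.integrable_bound[OF sc(1)[OF n(1)]])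
    have "cmod (char M t) ^ n \<le> cmod (char M t) ^ n0" for t
      using n cmod_char_le_1 by (intro power_decreasing) auto
    then show "AE s in lborel. norm (indicator D (s / sqrt n) * char M (s / sqrt n) ^ n)
       \<le> norm (indicator D (s / sqrt n) * cmod (char M (s / sqrt n)) ^ n0)"
      by (auto simp: norm_mult norm_power indicator_def)
  qed measurable
qed

end

lemma gauss_fourier:
  assumes n: "n \<ge> 1"
  shows "complex_of_real (gauss (real n) x) = (\<integral>s. complex_of_real (exp (- s\<^sup>2 / 2)) * iexp (- (s * x / sqrt n)) \<partial>lborel) / (2 * pi * sqrt n)"
    and "integrable lborel (\<lambda>s. complex_of_real (exp (- s\<^sup>2 / 2)) * iexp (- (s * x / sqrt n)))"
proof -
  have "integrable lborel (\<lambda>s :: real. exp (- s\<^sup>2 / 2))" by (rule integrable_exp_square) simp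
  then show "integrable lborel (\<lambda>s. complex_of_real (exp (- s\<^sup>2 / 2)) * iexp (- (s * x / sqrt n)))"
    by (rule Bochner_Integration.integrable_bound) (auto simp: norm_mult)
  have "complex_of_real (exp (- (x / sqrt n)\<^sup>2 / 2)) = char std_normal_distribution (- (x / sqrt n))"
    by (simp add: char_std_normal_distribution)
  also have "\<dots> = (\<integral>s. std_normal_density s *\<^sub>R iexp (- (x / sqrt n) * s) \<partial>lborel)"
    unfolding char_def by (rule integral_density) (auto simp: normal_density_nonneg)
  also have "\<dots> = (\<integral>s. (1 / sqrt (2 * pi)) *\<^sub>R (complex_of_real (exp (- s\<^sup>2 / 2)) * iexp (- (s * x / sqrt n))) \<partial>lborel)"
    by (intro Bochner_Integration.integral_cong) (auto simp: std_normal_density_def scaleR_conv_of_real mult_ac)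
  also have "\<dots> = (1 / sqrt (2 * pi)) *\<^sub>R (\<integral>s. complex_of_real (exp (- s\<^sup>2 / 2)) * iexp (- (s * x / sqrt n)) \<partial>lborel)"
    by (rule integral_scaleR_right)
  finally have e: "complex_of_real (exp (- (x / sqrt n)\<^sup>2 / 2))
    = (\<integral>s. complex_of_real (exp (- s\<^sup>2 / 2)) * iexp (- (s * x / sqrt n)) \<partial>lborel) / sqrt (2 * pi)"
    by (simp add: scaleR_conv_of_real)
  have tp: "complex_of_real (sqrt (2 * pi)) * complex_of_real (sqrt (2 * pi)) = 2 * complex_of_real pi"
  proof -
    have "sqrt (2 * pi) * sqrt (2 * pi) = 2 * pi" by simp
    then show ?thesis unfolding of_real_mult[symmetric] by simp
  qed
  have "complex_of_real (gauss (real n) x) = complex_of_real (exp (- (x / sqrt n)\<^sup>2 / 2)) / sqrt (2 * pi) / sqrt n"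
    using n by (subst gauss_scale) auto
  also have "\<dots> = (\<integral>s. complex_of_real (exp (- s\<^sup>2 / 2)) * iexp (- (s * x / sqrt n)) \<partial>lborel) / (complex_of_real (sqrt (2 * pi)) * complex_of_real (sqrt (2 * pi))) / sqrt n"
    unfolding e by simp
  also have "\<dots> = (\<integral>s. complex_of_real (exp (- s\<^sup>2 / 2)) * iexp (- (s * x / sqrt n)) \<partial>lborel) / (2 * complex_of_real pi) / sqrt n"
    unfolding tp ..
  finally show "complex_of_real (gauss (real n) x) = (\<integral>s. complex_of_real (exp (- s\<^sup>2 / 2)) * iexp (- (s * x / sqrt n)) \<partial>lborel) / (2 * pi * sqrt n)"
    by simp
qed

section \<open>The inversion formula for convolution powers and the local limit theorem\<close>

lemma (in group_measure) distr_translate: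
  assumes "v \<in> G"
  shows "distr \<rho> borel (\<lambda>x. v + x) = \<rho>"
proof -
  have "distr \<rho> borel (\<lambda>x. v + x) = distr (distr \<rho> borel (\<lambda>x. 0 - x)) borel (\<lambda>x. v - x)"
    by (subst distr_distr) (auto simp: comp_def)
  then show ?thesis using distr_reflect[OF assms] distr_reflect[of 0] by simp
qed

lemma (in group_measure) integral_translate:
  fixes F :: "real \<Rightarrow> 'b :: {banach, second_countable_topology}"
  assumes "v \<in> G" and [measurable]: "F \<in> borel_measurable borel"
  shows "(\<integral>x. F (v + x) \<partial>\<rho>) = (\<integral>x. F x \<partial>\<rho>)"
    and "integrable \<rho> (\<lambda>x. F (v + x)) \<longleftrightarrow> integrable \<rho> F"
proof -
  have "(\<integral>x. F x \<partial>distr \<rho> borel (\<lambda>x. v + x)) = (\<integral>x. F (v + x) \<partial>\<rho>)" by (rule integral_distr) auto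
  then show "(\<integral>x. F (v + x) \<partial>\<rho>) = (\<integral>x. F x \<partial>\<rho>)" unfolding distr_translate[OF assms(1)] by simp
  have "integrable (distr \<rho> borel (\<lambda>x. v + x)) F \<longleftrightarrow> integrable \<rho> (\<lambda>x. F (v + x))"
    by (rule integrable_distr_eq) auto
  then show "integrable \<rho> (\<lambda>x. F (v + x)) \<longleftrightarrow> integrable \<rho> F" unfolding distr_translate[OF assms(1)] by simp
qed

text \<open>\<open>D\<close> is the whole line with \<open>\<kappa> = 1\<close> for densities, and
  one period of length \<open>2 pi / d\<close> with \<open>\<kappa> = d\<close> for lattice laws of
  span \<open>d\<close>.\<close>

definition fourier_inverse :: "real \<Rightarrow> real set \<Rightarrow> (real \<Rightarrow> complex) \<Rightarrow> real \<Rightarrow> complex" where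
  "fourier_inverse \<kappa> D \<psi> x = \<kappa> / (2 * pi) * (\<integral>t. indicator D t * \<psi> t * iexp (- (t * x)) \<partial>lborel)"

text \<open>Inversion is demanded only for the power \<open>n0\<close> and almost everywhere: the
  pointwise convolution of a density may differ from its continuous version, or be infinite, at
  exceptional points. One more convolution removes the exceptions.\<close>

locale inversion_walk = supported_walk_density +
  fixes \<kappa> :: real and D :: "real set" and n0 :: nat
  assumes kappa_pos: "\<kappa> > 0" and D_measurable [measurable]: "D \<in> sets borel"
    and D_nhd: "\<exists>r>0. {- r..r} \<subseteq> D" and n0: "n0 \<ge> 1"
    and int_n0: "integrable lborel (\<lambda>t. indicator D t * cmod (char (density \<rho> (\<lambda>x. ennreal (f x))) t) ^ n0)"
    and away: "r > 0 \<Longrightarrow> \<exists>c<1. \<forall>t\<in>D. r \<le> \<bar>t\<bar> \<longrightarrow> cmod (char (density \<rho> (\<lambda>x. ennreal (f x))) t) \<le> c"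
    and inversion_base: "w \<in> G \<Longrightarrow> AE v in \<rho>. w - v \<in> L n0 \<longrightarrow>
       0 \<le> Re (fourier_inverse \<kappa> D (\<lambda>t. char (density \<rho> (\<lambda>x. ennreal (f x))) t ^ n0) (w - v)) \<and>
       dens \<rho> f UNIV n0 w v = ennreal (Re (fourier_inverse \<kappa> D (\<lambda>t. char (density \<rho> (\<lambda>x. ennreal (f x))) t ^ n0) (w - v)))"
begin

abbreviation "\<phi> \<equiv> char (density \<rho> (\<lambda>x. ennreal (f x)))"
abbreviation "inv_n n \<equiv> fourier_inverse \<kappa> D (\<lambda>t. \<phi> t ^ n)"

lemma integrable_f: "integrable \<rho> f" "(\<integral>x. f x \<partial>\<rho>) = 1"
proof -
  have "integrable (density \<rho> (\<lambda>x. ennreal (f x))) (\<lambda>_. 1 :: real)" by simp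
  then show "integrable \<rho> f" using f_nonneg by (subst (asm) integrable_density) auto
  have "(\<integral>x. 1 \<partial>density \<rho> (\<lambda>x. ennreal (f x))) = (\<integral>x. f x *\<^sub>R (1 :: real) \<partial>\<rho>)"
    using f_nonneg by (intro integral_density) auto
  then show "(\<integral>x. f x \<partial>\<rho>) = 1" by simp
qed

lemma phi_eq: "\<phi> t = (\<integral>x. f x *\<^sub>R iexp (t * x) \<partial>\<rho>)"
  unfolding char_def using f_nonneg by (intro integral_density) auto

lemma integrable_phi_power: "n \<ge> n0 \<Longrightarrow> integrable lborel (\<lambda>t. indicator D t * \<phi> t ^ n)"
proof (rule Bochner_Integration.integrable_bound[OF int_n0])
  assume n: "n \<ge> n0"
  have "cmod (\<phi> t) ^ n \<le> cmod (\<phi> t) ^ n0" for t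
    using n fwd.cmod_char_le_1 by (intro power_decreasing) auto
  then show "AE t in lborel. norm (indicator D t * \<phi> t ^ n) \<le> norm (indicator D t * cmod (\<phi> t) ^ n0)"
    by (auto simp: norm_mult norm_power indicator_def)
qed measurable

lemma inv_n_measurable [measurable]: "inv_n n \<in> borel_measurable borel"
  unfolding fourier_inverse_def[abs_def] by measurable

text \<open>By Fubini, convolution with \<open>f\<close> inserts one more factor
  \<open>\<phi> t\<close> under the Fourier integral. Absolute integrability holds from
  \<open>n0\<close> on.\<close>

lemma inv_n_step:
  assumes n: "n \<ge> n0" and w: "w \<in> G" and v: "v \<in> G"
  shows "integrable \<rho> (\<lambda>u. inv_n n (w - u) * complex_of_real (f (u - v)))"
    and "(\<integral>u. inv_n n (w - u) * complex_of_real (f (u - v)) \<partial>\<rho>) = inv_n (Suc n) (w - v)"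
proof -
  interpret P: pair_sigma_finite lborel \<rho> ..
  define h where "h = (\<lambda>t. indicator D t * \<phi> t ^ n)"
  have h: "integrable lborel h" unfolding h_def by (rule integrable_phi_power[OF n])
  have [measurable]: "h \<in> borel_measurable borel" unfolding h_def by measurable
  let ?F = "\<lambda>t u. h t * (iexp (- (t * (w - u))) * complex_of_real (f (u - v)))"
  have fv: "integrable \<rho> (\<lambda>u. f (u - v))" "(\<integral>u. f (u - v) \<partial>\<rho>) = 1"
  proof -
    show "integrable \<rho> (\<lambda>u. f (u - v))"
      using integral_translate(2)[OF v, of "\<lambda>u. f (u - v)"] integrable_f by simp
    show "(\<integral>u. f (u - v) \<partial>\<rho>) = 1"
      using integral_translate(1)[OF v, of "\<lambda>u. f (u - v)"] integrable_f by simp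
  qed
  have nF: "norm (?F t u) = cmod (h t) * f (u - v)" for t u
    using f_nonneg by (simp add: norm_mult)
  have intF: "integrable (lborel \<Otimes>\<^sub>M \<rho>) (case_prod ?F)"
  proof (rule P.Fubini_integrable)
    show "integrable lborel (\<lambda>t. \<integral>u. norm (case_prod ?F (t, u)) \<partial>\<rho>)"
      unfolding prod.case nF using h fv by simp
    show "AE t in lborel. integrable \<rho> (\<lambda>u. case_prod ?F (t, u))"
    proof (rule AE_I2)
      fix t
      have "integrable \<rho> (\<lambda>u. cmod (h t) * f (u - v))" using fv by simp
      then show "integrable \<rho> (\<lambda>u. case_prod ?F (t, u))"
        by (rule Bochner_Integration.integrable_bound) (use nF f_nonneg in \<open>auto simp: norm_mult\<close>)
    qed
  qed measurable
  have inner: "(\<integral>u. ?F t u \<partial>\<rho>) = indicator D t * \<phi> t ^ Suc n * iexp (- (t * (w - v)))" for t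
  proof -
    have "(\<integral>u. ?F t u \<partial>\<rho>) = h t * (\<integral>u. iexp (- (t * (w - u))) * complex_of_real (f (u - v)) \<partial>\<rho>)"
      by simp
    also have "(\<integral>u. iexp (- (t * (w - u))) * complex_of_real (f (u - v)) \<partial>\<rho>)
        = (\<integral>x. iexp (- (t * (w - (v + x)))) * complex_of_real (f ((v + x) - v)) \<partial>\<rho>)"
      by (rule integral_translate(1)[OF v, symmetric]) measurable
    also have "\<dots> = (\<integral>x. iexp (- (t * (w - v))) * (f x *\<^sub>R iexp (t * x)) \<partial>\<rho>)"
    proof (rule Bochner_Integration.integral_cong[OF refl])
      fix x
      have "iexp (- (t * (w - (v + x)))) = iexp (- (t * (w - v))) * iexp (t * x)"
        unfolding exp_add[symmetric] by (rule arg_cong[where f = exp]) (simp add: algebra_simps)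
      then show "iexp (- (t * (w - (v + x)))) * complex_of_real (f (v + x - v)) = iexp (- (t * (w - v))) * (f x *\<^sub>R iexp (t * x))"
        by (simp only: scaleR_conv_of_real add_diff_cancel_left' mult_ac)
    qed
    also have "\<dots> = iexp (- (t * (w - v))) * \<phi> t"
      unfolding phi_eq by (rule integral_mult_right_zero)
    finally show ?thesis by (simp add: h_def mult_ac)
  qed
  have eq: "inv_n n (w - u) * complex_of_real (f (u - v)) = \<kappa> / (2 * pi) * (\<integral>t. ?F t u \<partial>lborel)" for u
  proof -
    have "(\<integral>t. ?F t u \<partial>lborel) = (\<integral>t. h t * iexp (- (t * (w - u))) * complex_of_real (f (u - v)) \<partial>lborel)"
      by (simp add: mult.assoc)
    also have "\<dots> = (\<integral>t. h t * iexp (- (t * (w - u))) \<partial>lborel) * complex_of_real (f (u - v))"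
      by (rule integral_mult_left_zero)
    finally show ?thesis by (simp add: fourier_inverse_def h_def)
  qed
  have "integrable \<rho> (\<lambda>u. \<integral>t. ?F t u \<partial>lborel)" using P.integrable_snd[OF intF] .
  then show "integrable \<rho> (\<lambda>u. inv_n n (w - u) * complex_of_real (f (u - v)))"
    unfolding eq by (intro integrable_mult_right)
  have "(\<integral>u. inv_n n (w - u) * complex_of_real (f (u - v)) \<partial>\<rho>) = \<kappa> / (2 * pi) * (\<integral>u. (\<integral>t. ?F t u \<partial>lborel) \<partial>\<rho>)"
    unfolding eq by (rule integral_mult_right_zero)
  also have "(\<integral>u. (\<integral>t. ?F t u \<partial>lborel) \<partial>\<rho>) = (\<integral>t. (\<integral>u. ?F t u \<partial>\<rho>) \<partial>lborel)"
    by (rule P.Fubini_integral[OF intF])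
  also have "\<kappa> / (2 * pi) * \<dots> = inv_n (Suc n) (w - v)"
    unfolding inner fourier_inverse_def ..
  finally show "(\<integral>u. inv_n n (w - u) * complex_of_real (f (u - v)) \<partial>\<rho>) = inv_n (Suc n) (w - v)" .
qed

text \<open>The integral over \<open>u\<close> does not see null sets, so the identity almost
  everywhere at \<open>n\<close> yields the identity everywhere at \<open>n + 1\<close>. The sign
  belongs to the induction because \<open>ennreal\<close> sends negative numbers to 0.\<close>

lemma p_eq_inv_n_step:
  assumes n: "n \<ge> n0" and w: "w \<in> G" and v: "v \<in> G" and wv: "w - v \<in> L (Suc n)"
    and ae: "AE u in \<rho>. w - u \<in> L n \<longrightarrow> 0 \<le> Re (inv_n n (w - u)) \<and> p n w u = ennreal (Re (inv_n n (w - u)))"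
  shows "0 \<le> Re (inv_n (Suc n) (w - v)) \<and> p (Suc n) w v = ennreal (Re (inv_n (Suc n) (w - v)))"
proof -
  have n1: "n \<ge> 1" using n n0 by simp
  let ?r = "\<lambda>u. Re (inv_n n (w - u)) * f (u - v)"
  have Lu: "w - u \<in> L n" if "f (u - v) \<noteq> 0" for u
    using support[OF that] L_add[of 1 n "u - v" "w - u"] n1 wv by simp
  have r0: "AE u in \<rho>. 0 \<le> ?r u"
    using ae by eventually_elim (metis Lu f_nonneg mult_nonneg_nonneg mult_zero_right order_refl)
  have re: "AE u in \<rho>. p n w u * dens \<rho> f UNIV (Suc 0) u v = ennreal (?r u)"
    using ae
  proof eventually_elim
    case (elim u)
    then show ?case using Lu[of u] f_nonneg[of "u - v"] by (cases "f (u - v) = 0") (auto simp: ennreal_mult)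
  qed
  have Re_eq: "?r u = Re (inv_n n (w - u) * complex_of_real (f (u - v)))" for u by simp
  have ri: "integrable \<rho> ?r" unfolding Re_eq by (intro integrable_Re inv_n_step[OF n w v])
  have rI: "(\<integral>u. ?r u \<partial>\<rho>) = Re (inv_n (Suc n) (w - v))"
    unfolding Re_eq inv_n_step(2)[OF n w v, symmetric] by (rule integral_Re[OF inv_n_step(1)[OF n w v]])
  have "p (Suc n) w v = (\<integral>\<^sup>+u. p n w u * dens \<rho> f UNIV (Suc 0) u v \<partial>\<rho>)" by (rule dens_Suc[OF n1])
  also have "\<dots> = (\<integral>\<^sup>+u. ennreal (?r u) \<partial>\<rho>)" by (rule nn_integral_cong_AE[OF re])
  also have "\<dots> = ennreal (\<integral>u. ?r u \<partial>\<rho>)" by (rule nn_integral_eq_integral[OF ri r0])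
  finally show ?thesis using integral_nonneg_AE[OF r0] unfolding rI by simp
qed

lemma p_eq_inv_n_AE:
  assumes "n \<ge> n0" "w \<in> G"
  shows "AE u in \<rho>. w - u \<in> L n \<longrightarrow> 0 \<le> Re (inv_n n (w - u)) \<and> p n w u = ennreal (Re (inv_n n (w - u)))"
  using assms(1)
proof (induction n rule: dec_induct)
  case base
  show ?case by (rule inversion_base[OF assms(2)])
next
  case (step n)
  show ?case using AE_in_G
    by eventually_elim (intro impI p_eq_inv_n_step[OF step(1) assms(2) _ _ step.IH])
qed

lemma p_eq_inv_n:
  assumes n: "n \<ge> Suc n0" and w: "w \<in> G" and v: "v \<in> G" and wv: "w - v \<in> L n"
  shows "p n w v = ennreal (Re (inv_n n (w - v)))"
proof -
  obtain k where "n = Suc k" "k \<ge> n0" using n by (cases n) auto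
  then show ?thesis using p_eq_inv_n_step[OF _ w v _ p_eq_inv_n_AE[OF _ w]] wv by blast
qed

text \<open>After the substitution \<open>t = s / sqrt n\<close> both sides are Fourier integrals
  with the same unimodular factor. The \<open>L1\<close> distance of the other factors bounds their
  difference, whatever \<open>x\<close> is.\<close>

lemma inv_n_approx:
  assumes \<eta>: "\<eta> > 0"
  shows "\<forall>\<^sub>F n in sequentially. \<forall>x. \<bar>Re (inv_n n x) - \<kappa> * gauss n x\<bar> \<le> \<eta> / sqrt n"
proof -
  obtain r0 where r0: "r0 > 0" "{- r0..r0} \<subseteq> D" using D_nhd by blast
  define I where "I = (\<lambda>n. \<integral>s. cmod (indicator D (s / sqrt n) * \<phi> (s / sqrt n) ^ n - complex_of_real (exp (- s\<^sup>2 / 2))) \<partial>lborel)"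
  have lim: "I \<longlonglongrightarrow> 0"
    unfolding I_def by (rule fwd.char_power_integral_limit(1)[OF D_measurable r0 int_n0 away])
  have "2 * pi / \<kappa> * \<eta> > 0" using \<eta> kappa_pos by simp
  from order_tendstoD(2)[OF lim this] have "\<forall>\<^sub>F n in sequentially. I n < 2 * pi / \<kappa> * \<eta>" .
  then show ?thesis using eventually_ge_at_top[of "max 1 n0"]
  proof eventually_elim
    case (elim n)
    show ?case
    proof
      fix x
      have n: "n \<ge> 1" "n \<ge> n0" using elim by auto
      have c: "1 / sqrt n \<noteq> 0" using n by simp
      let ?h = "\<lambda>s. indicator D (s / sqrt n) * \<phi> (s / sqrt n) ^ n"
      let ?E = "\<lambda>s. iexp (- (s * x / sqrt n))"
      let ?g = "\<lambda>s. complex_of_real (exp (- s\<^sup>2 / 2))"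
      have h: "integrable lborel ?h"
        by (rule fwd.char_power_integral_limit(2)[OF D_measurable r0 int_n0 away n])
      have hE: "integrable lborel (\<lambda>s. ?h s * ?E s)"
        by (rule Bochner_Integration.integrable_bound[OF h]) (auto simp: norm_mult)
      note gE = gauss_fourier(2)[OF n(1), of x]
      have "(\<integral>t. indicator D t * \<phi> t ^ n * iexp (- (t * x)) \<partial>lborel)
         = \<bar>1 / sqrt n\<bar> *\<^sub>R (\<integral>s. indicator D (0 + 1 / sqrt n * s) * \<phi> (0 + 1 / sqrt n * s) ^ n * iexp (- ((0 + 1 / sqrt n * s) * x)) \<partial>lborel)"
        by (rule lborel_integral_real_affine[OF c])
      also have "\<dots> = (\<integral>s. ?h s * ?E s \<partial>lborel) / sqrt n"
        by (simp add: scaleR_conv_of_real)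
      finally have "inv_n n x = \<kappa> / (2 * pi) * ((\<integral>s. ?h s * ?E s \<partial>lborel) / sqrt n)"
        unfolding fourier_inverse_def by simp
      moreover have "complex_of_real (\<kappa> * gauss n x) = \<kappa> / (2 * pi) * ((\<integral>s. ?g s * ?E s \<partial>lborel) / sqrt n)"
        unfolding of_real_mult gauss_fourier(1)[OF n(1)] by simp
      ultimately have "inv_n n x - complex_of_real (\<kappa> * gauss n x)
         = \<kappa> / (2 * pi) * (((\<integral>s. ?h s * ?E s \<partial>lborel) - (\<integral>s. ?g s * ?E s \<partial>lborel)) / sqrt n)"
        by (simp only: right_diff_distrib diff_divide_distrib)
      also have "(\<integral>s. ?h s * ?E s \<partial>lborel) - (\<integral>s. ?g s * ?E s \<partial>lborel) = (\<integral>s. ?h s * ?E s - ?g s * ?E s \<partial>lborel)"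
        by (rule Bochner_Integration.integral_diff[OF hE gE, symmetric])
      finally have "cmod (inv_n n x - complex_of_real (\<kappa> * gauss n x))
         = \<kappa> / (2 * pi) * (cmod (\<integral>s. ?h s * ?E s - ?g s * ?E s \<partial>lborel) / sqrt n)"
        using kappa_pos by (simp add: norm_mult norm_divide)
      also have "\<dots> \<le> \<kappa> / (2 * pi) * (I n / sqrt n)"
      proof (intro mult_left_mono divide_right_mono)
        have "cmod (\<integral>s. ?h s * ?E s - ?g s * ?E s \<partial>lborel) \<le> (\<integral>s. cmod (?h s * ?E s - ?g s * ?E s) \<partial>lborel)"
          by (rule integral_norm_bound)
        also have "\<dots> = (\<integral>s. cmod (?h s - ?g s) * cmod (?E s) \<partial>lborel)"
          unfolding norm_mult[symmetric] by (simp only: left_diff_distrib)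
        also have "\<dots> = I n" by (simp add: I_def)
        finally show "cmod (\<integral>s. ?h s * ?E s - ?g s * ?E s \<partial>lborel) \<le> I n" .
      qed (use kappa_pos in auto)
      also have "\<dots> \<le> \<kappa> / (2 * pi) * ((2 * pi / \<kappa> * \<eta>) / sqrt n)"
        using elim kappa_pos by (intro mult_left_mono divide_right_mono) auto
      also have "\<dots> = \<eta> / sqrt n" using kappa_pos by simp
      finally show "\<bar>Re (inv_n n x) - \<kappa> * gauss n x\<bar> \<le> \<eta> / sqrt n"
        using abs_Re_le_cmod[of "inv_n n x - complex_of_real (\<kappa> * gauss n x)"] by simp
    qed
  qed
qed

lemma llt_walk: "llt_walk \<rho> G f L \<kappa>"
proof
  show "\<kappa> > 0" by (rule kappa_pos)
next
  fix \<eta> :: real assume \<eta>: "\<eta> > 0"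
  show "\<forall>\<^sub>F n in sequentially. \<forall>w\<in>G. \<forall>v\<in>G. p n w v \<le> ennreal (\<kappa> * gauss n (w - v) + \<eta> / sqrt n)"
    using inv_n_approx[OF \<eta>] eventually_ge_at_top[of "Suc n0"]
  proof eventually_elim
    case (elim n)
    show ?case
    proof (intro ballI)
      fix w v assume wv: "w \<in> G" "v \<in> G"
      show "p n w v \<le> ennreal (\<kappa> * gauss n (w - v) + \<eta> / sqrt n)"
      proof (cases "w - v \<in> L n")
        case True
        have "Re (inv_n n (w - v)) \<le> \<kappa> * gauss n (w - v) + \<eta> / sqrt n"
          using elim by (auto simp: abs_le_iff algebra_simps dest: spec[of _ "w - v"])
        then show ?thesis using p_eq_inv_n[OF elim(2) wv True] by (simp add: ennreal_leI)
      next
        \<comment> \<open>Off the coset the density vanishes and the upper bound is trivial; the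
          lower bound is claimed on the coset only.\<close>
        case False
        then have "p n w v = 0" using dens_support[of n UNIV w v] elim by auto
        then show ?thesis by simp
      qed
    qed
  qed
  show "\<forall>\<^sub>F n in sequentially. \<forall>w\<in>G. \<forall>v\<in>G. w - v \<in> L n \<longrightarrow>
      ennreal (\<kappa> * gauss n (w - v) - \<eta> / sqrt n) \<le> p n w v"
    using inv_n_approx[OF \<eta>] eventually_ge_at_top[of "Suc n0"]
  proof eventually_elim
    case (elim n)
    show ?case
    proof (intro ballI impI)
      fix w v assume wv: "w \<in> G" "v \<in> G" "w - v \<in> L n"
      have "\<kappa> * gauss n (w - v) - \<eta> / sqrt n \<le> Re (inv_n n (w - v))"
        using elim by (auto simp: abs_le_iff algebra_simps dest: spec[of _ "w - v"])
      then show "ennreal (\<kappa> * gauss n (w - v) - \<eta> / sqrt n) \<le> p n w v"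
        using p_eq_inv_n[OF elim(2) wv] by (simp add: ennreal_leI)
    qed
  qed
qed

end

section \<open>Inversion for integrable characteristic functions\<close>

context real_distribution begin

text \<open>Levy's formula is a limit of truncated integrals. The kernel has modulus at most
  \<open>b - a\<close>, so with an integrable characteristic function dominated convergence gives
  the integral over the line.\<close>

lemma levy_limit_integral:
  assumes ab: "a < b" and at: "measure M {a} = 0" "measure M {b} = 0" and int: "integrable lborel (char M)"
  shows "complex_of_real (measure M {a<..b}) = 1 / (2 * pi) * (\<integral>t. (iexp (- (t * a)) - iexp (- (t * b))) / (\<i> * t) * char M t \<partial>lborel)"
    and "integrable lborel (\<lambda>t. (iexp (- (t * a)) - iexp (- (t * b))) / (\<i> * t) * char M t)"
proof -
  let ?F = "\<lambda>t :: real. (iexp (- (t * a)) - iexp (- (t * b))) / (\<i> * t)"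
  have bd: "cmod (?F t) \<le> b - a" if "t \<noteq> 0" for t
    using Levy_Inversion_aux2[of "- b" "- a" t] ab that by simp
  have i: "integrable lborel (\<lambda>t. ?F t * char M t)"
  proof (rule Bochner_Integration.integrable_bound)
    show "integrable lborel (\<lambda>t. (b - a) * cmod (char M t))" using int by simp
    show "AE t in lborel. norm (?F t * char M t) \<le> norm ((b - a) * cmod (char M t))"
      using AE_lborel_singleton[of 0]
    proof eventually_elim
      case (elim t)
      have "cmod (?F t) * cmod (char M t) \<le> (b - a) * cmod (char M t)"
        using bd[OF elim] by (rule mult_right_mono) simp
      then show ?case using ab unfolding norm_mult real_norm_def abs_mult by simp
    qed
  qed measurable
  then show "integrable lborel (\<lambda>t. ?F t * char M t)" .
  have lev: "(\<lambda>T. 1 / (2 * pi) * (CLBINT t=-T..T. ?F t * char M t)) \<longlonglongrightarrow> measure M {a<..b}"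
    using ab at by (intro Levy_Inversion) auto
  have "(\<lambda>T::nat. CLBINT t=ereal (real_of_int (- int T))..ereal (real T). ?F t * char M t) \<longlonglongrightarrow> (\<integral>t. ?F t * char M t \<partial>lborel)"
  proof -
    have eq: "(CLBINT t=ereal (real_of_int (- int T))..ereal (real T). h t) = (\<integral>t. indicator {- real T<..<real T} t *\<^sub>R h t \<partial>lborel)"
      for T :: nat and h :: "real \<Rightarrow> complex"
    proof -
      have "ereal (- real T) \<le> ereal (real T)" by simp
      then show ?thesis
        unfolding interval_lebesgue_integral_def set_lebesgue_integral_def by simp
    qed
    show ?thesis unfolding eq
    proof (rule integral_dominated_convergence[where w = "\<lambda>t. norm (?F t * char M t)"])
      show "AE t in lborel. (\<lambda>T. indicator {- real T<..<real T} t *\<^sub>R (?F t * char M t)) \<longlonglongrightarrow> ?F t * char M t"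
      proof (rule AE_I2)
        fix t :: real
        have "\<forall>\<^sub>F T in sequentially. indicator {- real T<..<real T} t *\<^sub>R (?F t * char M t) = ?F t * char M t"
          using eventually_gt_at_top[of "nat \<lceil>\<bar>t\<bar>\<rceil>"]
        proof eventually_elim
          case (elim T)
          then have "\<bar>t\<bar> < real T" by linarith
          then have "t \<in> {- real T<..<real T}" by auto
          then show ?case by simp
        qed
        then show "(\<lambda>T. indicator {- real T<..<real T} t *\<^sub>R (?F t * char M t)) \<longlonglongrightarrow> ?F t * char M t"
          by (rule tendsto_eventually)
      qed
    qed (use i in \<open>auto simp: indicator_def\<close>)
  qed
  from LIMSEQ_unique[OF lev tendsto_mult_left[OF this]]
  show "complex_of_real (measure M {a<..b}) = 1 / (2 * pi) * (\<integral>t. ?F t * char M t \<partial>lborel)" by simp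
qed

end

lemma integral_iexp:
  assumes "a \<le> b" "t \<noteq> 0"
  shows "(\<integral>x. indicator {a..b} x *\<^sub>R iexp (- (t * x)) \<partial>lborel) = (iexp (- (t * a)) - iexp (- (t * b))) / (\<i> * t)"
proof -
  let ?F = "\<lambda>x :: real. iexp (- (t * x)) / (- \<i> * t)"
  have "(\<integral>x. indicator {a..b} x *\<^sub>R iexp (- (t * x)) \<partial>lborel) = ?F b - ?F a"
  proof (rule integral_FTC_Icc)
    show "(?F has_vector_derivative iexp (- (t * x))) (at x within {a..b})" for x
    proof -
      have "((\<lambda>z. exp (- (\<i> * t * z)) / (- \<i> * t)) has_field_derivative exp (- (\<i> * t * complex_of_real x))) (at (complex_of_real x))"
        using assms(2) by (auto intro!: derivative_eq_intros)
      from has_vector_derivative_real_field[OF this] show ?thesis by (simp add: mult_ac)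
    qed
    show "continuous_on {a..b} (\<lambda>x. iexp (- (t * x)))" by (intro continuous_intros)
  qed (rule assms)
  then show ?thesis using assms(2) by (simp add: field_simps)
qed


context real_distribution begin

text \<open>Levy's kernel is itself the integral of \<open>iexp (- (t * x))\<close> over
  \<open>{a..b}\<close>. Exchanging the two integrations exhibits the inverse transform as a density
  on the interval.\<close>

lemma integral_fourier_inverse:
  assumes ab: "a < b" and at: "\<And>x. measure M {x} = 0" and int: "integrable lborel (char M)"
  defines "g \<equiv> fourier_inverse 1 UNIV (char M)"
  shows "integrable lborel (\<lambda>x. indicator {a..b} x *\<^sub>R g x)"
    and "complex_of_real (measure M {a<..b}) = (\<integral>x. indicator {a..b} x *\<^sub>R g x \<partial>lborel)"
proof -
  let ?F = "\<lambda>t x. char M t * (indicator {a..b} x *\<^sub>R iexp (- (t * x)))"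
  have nF: "norm (?F t x) = cmod (char M t) * indicator {a..b} x" for t x :: real
    by (simp add: norm_mult)
  have intF: "integrable (lborel \<Otimes>\<^sub>M lborel) (case_prod ?F)"
  proof (rule lborel_pair.Fubini_integrable)
    show "integrable lborel (\<lambda>t. \<integral>x. norm (case_prod ?F (t, x)) \<partial>lborel)"
      unfolding prod.case nF using int by simp
    show "AE t in lborel. integrable lborel (\<lambda>x. case_prod ?F (t, x))"
    proof (rule AE_I2)
      fix t :: real
      have "integrable lborel (\<lambda>x :: real. cmod (char M t) * indicator {a..b} x)"
        using ab by (intro integrable_mult_right integrable_real_indicator) auto
      then show "integrable lborel (\<lambda>x. case_prod ?F (t, x))"
        by (rule Bochner_Integration.integrable_bound) (auto simp: norm_mult)
    qed
  qed measurable
  have eq: "indicator {a..b} x *\<^sub>R g x = 1 / (2 * pi) * (\<integral>t. ?F t x \<partial>lborel)" for x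
    by (simp add: g_def fourier_inverse_def indicator_def)
  have "integrable lborel (\<lambda>x. \<integral>t. ?F t x \<partial>lborel)" using lborel_pair.integrable_snd[OF intF] .
  then show "integrable lborel (\<lambda>x. indicator {a..b} x *\<^sub>R g x)"
    unfolding eq by (intro integrable_mult_right)
  have "(\<integral>x. indicator {a..b} x *\<^sub>R g x \<partial>lborel) = 1 / (2 * pi) * (\<integral>x. (\<integral>t. ?F t x \<partial>lborel) \<partial>lborel)"
    unfolding eq by (rule integral_mult_right_zero)
  also have "(\<integral>x. (\<integral>t. ?F t x \<partial>lborel) \<partial>lborel) = (\<integral>t. (\<integral>x. ?F t x \<partial>lborel) \<partial>lborel)"
    by (rule lborel_pair.Fubini_integral[OF intF])
  also have "\<dots> = (\<integral>t. (iexp (- (t * a)) - iexp (- (t * b))) / (\<i> * t) * char M t \<partial>lborel)"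
  proof (rule Bochner_Integration.integral_cong_AE)
    show "AE t in lborel. (\<integral>x. ?F t x \<partial>lborel) = (iexp (- (t * a)) - iexp (- (t * b))) / (\<i> * t) * char M t"
      using AE_lborel_singleton[of 0]
    proof eventually_elim
      case (elim t)
      have "(\<integral>x. ?F t x \<partial>lborel) = char M t * (\<integral>x. indicator {a..b} x *\<^sub>R iexp (- (t * x)) \<partial>lborel)"
        by (rule integral_mult_right_zero)
      then show ?case unfolding integral_iexp[OF less_imp_le[OF ab] elim] by (simp only: mult.commute)
    qed
  qed measurable
  also have "1 / (2 * pi) * \<dots> = complex_of_real (measure M {a<..b})"
    using levy_limit_integral(1)[OF ab at at int] by simp
  finally show "complex_of_real (measure M {a<..b}) = (\<integral>x. indicator {a..b} x *\<^sub>R g x \<partial>lborel)" by simp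
qed

lemma isCont_fourier_inverse:
  assumes int: "integrable lborel (char M)"
  shows "isCont (fourier_inverse 1 UNIV (char M)) x"
  unfolding continuous_at_sequentially
proof safe
  fix X assume X: "X \<longlonglongrightarrow> x"
  have "(\<lambda>n. \<integral>t. indicator UNIV t * char M t * iexp (- (t * X n)) \<partial>lborel)
    \<longlonglongrightarrow> (\<integral>t. indicator UNIV t * char M t * iexp (- (t * x)) \<partial>lborel)"
    by (rule integral_dominated_convergence[where w = "\<lambda>t. cmod (char M t)"])
      (use int in \<open>auto intro!: tendsto_intros X simp: norm_mult\<close>)
  from tendsto_mult_left[OF this, of "complex_of_real (1 / (2 * pi))"]
  show "(fourier_inverse 1 UNIV (char M) \<circ> X) \<longlonglongrightarrow> fourier_inverse 1 UNIV (char M) x"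
    unfolding comp_def fourier_inverse_def .
qed

text \<open>Continuity makes the sign hold at every point: if \<open>g\<close> were negative
  somewhere, it would be so on a short interval, whose measure would be negative. The identity
  follows since half-open intervals determine the measure and densities are unique almost
  everywhere.\<close>

theorem density_inversion:
  assumes h [measurable]: "h \<in> borel_measurable borel" and M: "M = density lborel h"
    and int: "integrable lborel (char M)"
  defines "g \<equiv> \<lambda>x. Re (fourier_inverse 1 UNIV (char M) x)"
  shows "0 \<le> g x" and "AE x in lborel. h x = ennreal (g x)"
proof -
  have at: "measure M {x} = 0" for x
  proof -
    have "emeasure M {x} = (\<integral>\<^sup>+y. h y * indicator {x} y \<partial>lborel)"
      using emeasure_density[of h lborel "{x}"] unfolding M[symmetric] by simp
    also have "\<dots> = (\<integral>\<^sup>+y. 0 \<partial>(lborel :: real measure))"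
      by (rule nn_integral_cong_AE) (use AE_lborel_singleton[of x] in eventually_elim, auto)
    finally show ?thesis by (simp add: measure_def)
  qed
  have gm [measurable]: "g \<in> borel_measurable borel"
    unfolding g_def fourier_inverse_def by measurable
  have ind: "indicator {a..b} x * g x = Re (indicator {a..b} x *\<^sub>R fourier_inverse 1 UNIV (char M) x)" for a b x :: real
    by (simp add: g_def)
  have ig: "integrable lborel (\<lambda>x. indicator {a..b} x * g x)" if "a < b" for a b
    unfolding ind by (intro integrable_Re integral_fourier_inverse[OF that at int])
  have meas: "measure M {a<..b} = (\<integral>x. indicator {a..b} x * g x \<partial>lborel)" if "a < b" for a b
  proof -
    have "measure M {a<..b} = Re (\<integral>x. indicator {a..b} x *\<^sub>R fourier_inverse 1 UNIV (char M) x \<partial>lborel)"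
      unfolding integral_fourier_inverse(2)[OF that at int, symmetric] by simp
    also have "\<dots> = (\<integral>x. Re (indicator {a..b} x *\<^sub>R fourier_inverse 1 UNIV (char M) x) \<partial>lborel)"
      by (rule integral_Re[symmetric]) (rule integral_fourier_inverse(1)[OF that at int])
    finally show ?thesis unfolding ind .
  qed
  have pos: "0 \<le> g x" for x
  proof (rule ccontr)
    assume neg: "\<not> 0 \<le> g x"
    have "isCont g x" unfolding g_def by (intro isCont_Re isCont_fourier_inverse int)
    moreover have "g x < g x / 2" using neg by simp
    ultimately have "\<forall>\<^sub>F y in nhds x. g y < g x / 2"
      unfolding isCont_def tendsto_at_iff_tendsto_nhds by (rule order_tendstoD(2))
    then obtain e where e: "e > 0" "\<And>y. dist y x < e \<Longrightarrow> g y < g x / 2"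
      unfolding eventually_nhds_metric by blast
    define b where "b = x + e / 2"
    have b: "x < b" using e by (simp add: b_def)
    have "0 \<le> measure M {x<..b}" by simp
    also have "\<dots> = (\<integral>y. indicator {x..b} y * g y \<partial>lborel)" by (rule meas[OF b])
    also have "\<dots> \<le> (\<integral>y. indicator {x..b} y * (g x / 2) \<partial>lborel)"
    proof (rule integral_mono[OF ig[OF b]])
      show "integrable lborel (\<lambda>y. indicator {x..b} y * (g x / 2))"
        using b by (intro integrable_mult_left integrable_real_indicator) auto
      show "indicator {x..b} y * g y \<le> indicator {x..b} y * (g x / 2)" for y
        using e(2)[of y] e(1) by (auto simp: indicator_def b_def dist_real_def intro!: less_imp_le)
    qed
    also have "\<dots> = (b - x) * (g x / 2)" using b by simp
    also have "\<dots> < 0" using b neg by (intro mult_pos_neg) auto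
    finally show False by simp
  qed
  then show "0 \<le> g x" .
  have "density lborel (\<lambda>x. ennreal (g x)) = M"
  proof (rule measure_eqI_generator_eq[where E = "range (\<lambda>(a, b). {a<..b::real})" and \<Omega> = UNIV
        and A = "\<lambda>i. {- real i<..real i}"])
    show "Int_stable (range (\<lambda>(a, b). {a<..b::real}))"
      by (auto simp: Int_stable_def)
    show "sets (density lborel (\<lambda>x. ennreal (g x))) = sigma_sets UNIV (range (\<lambda>(a, b). {a<..b::real}))"
      "sets M = sigma_sets UNIV (range (\<lambda>(a, b). {a<..b::real}))"
      by (simp_all add: borel_sigma_sets_Ioc)
    have eq: "emeasure (density lborel (\<lambda>x. ennreal (g x))) {a<..b} = emeasure M {a<..b}" for a b
    proof (cases "a < b")
      case True
      have "emeasure (density lborel (\<lambda>x. ennreal (g x))) {a<..b} = (\<integral>\<^sup>+x. ennreal (g x) * indicator {a<..b} x \<partial>lborel)"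
        by (rule emeasure_density) auto
      also have "\<dots> = (\<integral>\<^sup>+x. ennreal (indicator {a..b} x * g x) \<partial>lborel)"
        by (rule nn_integral_cong_AE) (use AE_lborel_singleton[of a] in eventually_elim, auto simp: indicator_def)
      also have "\<dots> = ennreal (\<integral>x. indicator {a..b} x * g x \<partial>lborel)"
        by (rule nn_integral_eq_integral[OF ig[OF True]]) (use pos in auto)
      also have "\<dots> = emeasure M {a<..b}" unfolding meas[OF True, symmetric] by (simp add: emeasure_eq_measure)
      finally show ?thesis .
    qed simp
    show "emeasure (density lborel (\<lambda>x. ennreal (g x))) X = emeasure M X" if "X \<in> range (\<lambda>(a, b). {a<..b::real})" for X
      using that eq by auto
    show "emeasure (density lborel (\<lambda>x. ennreal (g x))) {- real i<..real i} \<noteq> \<infinity>" for i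
      unfolding eq by simp
    show "(\<Union>i. {- real i<..real i}) = UNIV"
    proof (intro set_eqI iffI UNIV_I)
      fix x :: real
      obtain n :: nat where "\<bar>x\<bar> < real n" using reals_Archimedean2 by blast
      then show "x \<in> (\<Union>i. {- real i<..real i})" by (intro UN_I[of n]) auto
    qed
  qed auto
  then have "density lborel h = density lborel (\<lambda>x. ennreal (g x))" using M by simp
  then show "AE x in lborel. h x = ennreal (g x)"
    by (subst (asm) sigma_finite_measure.density_unique_iff[OF sigma_finite_lborel]) auto
qed

text \<open>Equality in the triangle inequality for the mean: after rotation by the argument
  \<open>\<theta>\<close>, the nonnegative variable \<open>1 - cos (t * x - \<theta>)\<close> has
  mean 0, so \<open>t * x - \<theta>\<close> is almost surely a multiple of
  \<open>2 pi\<close>.\<close>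

lemma char_norm_1_lattice:
  assumes "t \<noteq> 0" "cmod (char M t) = 1"
  shows "\<exists>a. AE x in M. \<exists>k :: int. x = a + of_int k * (2 * pi / \<bar>t\<bar>)"
proof -
  define \<theta> where "\<theta> = Arg (char M t)"
  have \<theta>: "char M t = cis \<theta>"
    using rcis_cmod_Arg[of "char M t"] assms(2) by (simp add: rcis_def \<theta>_def)
  have i: "integrable M (\<lambda>x. iexp (t * x))" by (intro integrable_const_bound[where B = 1]) auto
  have i2: "integrable M (\<lambda>x. Re (cis (- \<theta>) * iexp (t * x)))" using i by (intro integrable_Re integrable_mult_right)
  have Re_eq: "Re (cis (- \<theta>) * iexp (t * x)) = cos (t * x - \<theta>)" for x
    unfolding cis_conv_exp[symmetric] cis_mult by (simp add: algebra_simps)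
  have "(\<integral>x. Re (cis (- \<theta>) * iexp (t * x)) \<partial>M) = Re (\<integral>x. cis (- \<theta>) * iexp (t * x) \<partial>M)"
    using i by (intro integral_Re integrable_mult_right)
  also have "(\<integral>x. cis (- \<theta>) * iexp (t * x) \<partial>M) = cis (- \<theta>) * char M t"
    unfolding char_def by (rule integral_mult_right_zero)
  also have "Re (cis (- \<theta>) * char M t) = 1" unfolding \<theta> cis_mult by simp
  finally have "(\<integral>x. 1 - cos (t * x - \<theta>) \<partial>M) = 0"
    using i2 prob_space unfolding Re_eq by simp
  moreover have "integrable M (\<lambda>x. 1 - cos (t * x - \<theta>))" using i2 unfolding Re_eq by simp
  ultimately have "AE x in M. 1 - cos (t * x - \<theta>) = 0"
    by (subst (asm) integral_nonneg_eq_0_iff_AE) auto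
  then have "AE x in M. \<exists>k :: int. x = \<theta> / t + of_int k * (2 * pi / \<bar>t\<bar>)"
  proof eventually_elim
    case (elim x)
    then obtain k :: int where k: "t * x - \<theta> = of_int k * (2 * pi)"
      using cos_one_2pi_int[of "t * x - \<theta>"] by auto
    then have x: "x = \<theta> / t + of_int k * (2 * pi) / t" using assms(1) by (simp add: field_simps)
    show ?case
    proof (cases "t > 0")
      case True
      then show ?thesis using x by (intro exI[of _ k]) simp
    next
      case False
      then show ?thesis using x by (intro exI[of _ "- k"]) simp
    qed
  qed
  then show ?thesis by blast
qed

lemma char_bounded_away:
  assumes r: "0 < r" and ne: "\<And>t. r \<le> \<bar>t\<bar> \<Longrightarrow> \<bar>t\<bar> \<le> b \<Longrightarrow> cmod (char M t) \<noteq> 1"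
  shows "\<exists>c<1. \<forall>t. r \<le> \<bar>t\<bar> \<longrightarrow> \<bar>t\<bar> \<le> b \<longrightarrow> cmod (char M t) \<le> c"
proof -
  define K where "K = {- b..- r} \<union> {r..b}"
  have K: "t \<in> K" if "r \<le> \<bar>t\<bar>" "\<bar>t\<bar> \<le> b" for t using that by (auto simp: K_def)
  have K': "r \<le> \<bar>t\<bar> \<and> \<bar>t\<bar> \<le> b" if "t \<in> K" for t using that r by (auto simp: K_def)
  show ?thesis
  proof (cases "K = {}")
    case True
    then show ?thesis using K by (intro exI[of _ 0]) auto
  next
    case False
    have "compact K" unfolding K_def by (intro compact_Un compact_Icc)
    moreover have "continuous_on K (\<lambda>t. cmod (char M t))"
      by (intro continuous_on_norm continuous_at_imp_continuous_on ballI isCont_char)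
    ultimately obtain s where s: "s \<in> K" "\<And>t. t \<in> K \<Longrightarrow> cmod (char M t) \<le> cmod (char M s)"
      using continuous_attains_sup[of K "\<lambda>t. cmod (char M t)"] False by blast
    have "cmod (char M s) \<noteq> 1" using ne K'[OF s(1)] by blast
    then have "cmod (char M s) < 1" using cmod_char_le_1[of s] by linarith
    then show ?thesis using s K by (intro exI[of _ "cmod (char M s)"]) auto
  qed
qed

end

context fourth_moment_walk
begin

lemma char_lipschitz: "cmod (char M s - char M t) \<le> \<bar>s - t\<bar> * (\<integral>x. \<bar>x\<bar> \<partial>M)"
proof -
  have i: "integrable M (\<lambda>x. iexp (s * x))" for s by (intro integrable_const_bound[where B = 1]) auto
  have pw: "cmod (iexp (s * x) - iexp (t * x)) \<le> \<bar>s - t\<bar> * \<bar>x\<bar>" for x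
  proof -
    have "iexp (s * x) - iexp (t * x) = iexp (t * x) * (iexp ((s - t) * x) - 1)"
      by (simp add: algebra_simps exp_add[symmetric])
    then have "cmod (iexp (s * x) - iexp (t * x)) = cmod (iexp ((s - t) * x) - 1)" by (simp add: norm_mult)
    also have "\<dots> \<le> \<bar>(s - t) * x\<bar>" using iexp_approx1[of "(s - t) * x" 0] by simp
    finally show ?thesis by (simp add: abs_mult)
  qed
  have "cmod (char M s - char M t) = cmod (\<integral>x. iexp (s * x) - iexp (t * x) \<partial>M)"
    unfolding char_def by (subst Bochner_Integration.integral_diff[OF i i]) simp
  also have "\<dots> \<le> (\<integral>x. cmod (iexp (s * x) - iexp (t * x)) \<partial>M)" by (rule integral_norm_bound)
  also have "\<dots> \<le> (\<integral>x. \<bar>s - t\<bar> * \<bar>x\<bar> \<partial>M)"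
    by (intro integral_mono integrable_norm Bochner_Integration.integrable_diff i pw) auto
  finally show ?thesis by simp
qed

text \<open>If the modulus exceeds \<open>1/2\<close> at \<open>t\<close>, the Lipschitz bound keeps
  it above \<open>1/4\<close> on an interval of fixed radius \<open>\<delta>\<close>. That interval
  contributes at least \<open>2 \<delta> (1/4)^n\<close> to the integral of the power, more than its
  tail can hold when \<open>t\<close> is far out.\<close>

lemma char_decay:
  assumes int: "integrable lborel (\<lambda>t. cmod (char M t) ^ n)"
  shows "\<exists>T. \<forall>t. T \<le> \<bar>t\<bar> \<longrightarrow> cmod (char M t) \<le> 1 / 2"
proof -
  define B where "B = (\<integral>x. \<bar>x\<bar> \<partial>M) + 1"
  have B: "B > 0" "(\<integral>x. \<bar>x\<bar> \<partial>M) \<le> B" by (auto simp: B_def add_nonneg_pos)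
  define \<delta> where "\<delta> = 1 / (4 * B)"
  have \<delta>: "\<delta> > 0" using B by (simp add: \<delta>_def)
  let ?h = "\<lambda>t. cmod (char M t) ^ n"
  have "(\<lambda>T. \<integral>s. indicator {s. real T < \<bar>s\<bar>} s * ?h s \<partial>lborel) \<longlonglongrightarrow> (\<integral>s. 0 \<partial>(lborel :: real measure))"
  proof (rule integral_dominated_convergence[where w = ?h])
    show "AE s in lborel. (\<lambda>T. indicator {s. real T < \<bar>s\<bar>} s * ?h s) \<longlonglongrightarrow> 0"
    proof (rule AE_I2)
      fix s :: real
      have "\<forall>\<^sub>F T in sequentially. indicator {s. real T < \<bar>s\<bar>} s * ?h s = 0"
        using eventually_gt_at_top[of "nat \<lceil>\<bar>s\<bar>\<rceil>"]
      proof eventually_elim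
        case (elim T)
        then have "\<not> real T < \<bar>s\<bar>" by linarith
        then show ?case by simp
      qed
      then show "(\<lambda>T. indicator {s. real T < \<bar>s\<bar>} s * ?h s) \<longlonglongrightarrow> 0" by (rule tendsto_eventually)
    qed
  qed (use int in \<open>auto simp: indicator_def\<close>)
  then have "(\<lambda>T. \<integral>s. indicator {s. real T < \<bar>s\<bar>} s * ?h s \<partial>lborel) \<longlonglongrightarrow> 0" by simp
  moreover have pos: "2 * \<delta> * (1 / 4) ^ n > 0" using \<delta> by simp
  ultimately have "\<forall>\<^sub>F T in sequentially. (\<integral>s. indicator {s. real T < \<bar>s\<bar>} s * ?h s \<partial>lborel) < 2 * \<delta> * (1 / 4) ^ n"
    by (rule order_tendstoD(2))
  then obtain T :: nat where T: "(\<integral>s. indicator {s. real T < \<bar>s\<bar>} s * ?h s \<partial>lborel) < 2 * \<delta> * (1 / 4) ^ n"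
    unfolding eventually_sequentially by blast
  have "cmod (char M t) \<le> 1 / 2" if t: "real T + \<delta> + 1 \<le> \<bar>t\<bar>" for t
  proof (rule ccontr)
    assume neg: "\<not> cmod (char M t) \<le> 1 / 2"
    have near: "1 / 4 \<le> cmod (char M s)" if "s \<in> {t - \<delta>..t + \<delta>}" for s
    proof -
      have "cmod (char M t - char M s) \<le> \<bar>t - s\<bar> * (\<integral>x. \<bar>x\<bar> \<partial>M)" by (rule char_lipschitz)
      also have "\<dots> \<le> \<delta> * B" using that B \<delta> by (intro mult_mono) (auto simp: abs_le_iff)
      also have "\<dots> = 1 / 4" using B by (simp add: \<delta>_def)
      finally show ?thesis using neg norm_triangle_sub[of "char M t" "char M s"] by linarith
    qed
    have "2 * \<delta> * (1 / 4) ^ n = (\<integral>s. indicator {t - \<delta>..t + \<delta>} s * (1 / 4) ^ n \<partial>lborel)"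
      using \<delta> by simp
    also have "\<dots> \<le> (\<integral>s. indicator {s. real T < \<bar>s\<bar>} s * ?h s \<partial>lborel)"
    proof (rule integral_mono)
      show "integrable lborel (\<lambda>s. indicator {t - \<delta>..t + \<delta>} s * (1 / 4 :: real) ^ n)"
        using \<delta> by (intro integrable_mult_left integrable_real_indicator) auto
      show "integrable lborel (\<lambda>s. indicator {s. real T < \<bar>s\<bar>} s * ?h s)"
        by (rule Bochner_Integration.integrable_bound[OF int]) (auto simp: indicator_def)
      show "indicator {t - \<delta>..t + \<delta>} s * (1 / 4) ^ n \<le> indicator {s. real T < \<bar>s\<bar>} s * ?h s" for s
      proof (cases "s \<in> {t - \<delta>..t + \<delta>}")
        case True
        then have "real T < \<bar>s\<bar>" using t \<delta> by (auto simp: abs_if split: if_splits)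
        moreover have "(1 / 4) ^ n \<le> ?h s" using near[OF True] by (intro power_mono) auto
        ultimately show ?thesis using True by simp
      qed simp
    qed
    finally show False using T by simp
  qed
  then show ?thesis by blast
qed

end

context real_distribution
begin

text \<open>The law of \<open>w - S\<^sub>n\<close>.\<close>
primrec step_measure :: "real \<Rightarrow> nat \<Rightarrow> real measure" where
  "step_measure w 0 = return borel w"
| "step_measure w (Suc n) = distr (step_measure w n \<Otimes>\<^sub>M M) borel (\<lambda>p. fst p - snd p)"

lemma step_measure_distribution: "real_distribution (step_measure w n)"
proof (induction n)
  case 0
  show ?case
    by (simp add: real_distribution_def real_distribution_axioms_def prob_space_return)
next
  case (Suc n)
  interpret N: real_distribution "step_measure w n" by fact
  interpret P: pair_prob_space "step_measure w n" M ..
  show ?case by (simp add: P.real_distribution_distr)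
qed

lemma char_step_measure: "char (step_measure w n) t = iexp (t * w) * char M (- t) ^ n"
proof (induction n)
  case 0
  show ?case by (simp add: char_def integral_return)
next
  case (Suc n)
  interpret N: real_distribution "step_measure w n" by (rule step_measure_distribution)
  interpret P: pair_prob_space "step_measure w n" M ..
  have int: "integrable (step_measure w n \<Otimes>\<^sub>M M) (\<lambda>p. iexp (t * (fst p - snd p)))"
    by (intro P.integrable_const_bound[where B = 1]) auto
  have "char (step_measure w (Suc n)) t = (\<integral>p. iexp (t * (fst p - snd p)) \<partial>(step_measure w n \<Otimes>\<^sub>M M))"
    unfolding char_def step_measure.simps by (rule integral_distr) auto
  also have "\<dots> = (\<integral>u. (\<integral>x. iexp (t * (u - x)) \<partial>M) \<partial>step_measure w n)"
    using P.integral_fst'[OF int] by simp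
  also have "\<dots> = (\<integral>u. iexp (t * u) * char M (- t) \<partial>step_measure w n)"
  proof (rule Bochner_Integration.integral_cong[OF refl])
    fix u
    have "iexp (t * (u - x)) = iexp (t * u) * iexp (- t * x)" for x
      unfolding exp_add[symmetric] by (rule arg_cong[where f = exp]) (simp add: algebra_simps)
    then have "(\<integral>x. iexp (t * (u - x)) \<partial>M) = (\<integral>x. iexp (t * u) * iexp (- t * x) \<partial>M)" by simp
    also have "\<dots> = iexp (t * u) * char M (- t)" unfolding char_def by (rule integral_mult_right_zero)
    finally show "(\<integral>x. iexp (t * (u - x)) \<partial>M) = iexp (t * u) * char M (- t)" .
  qed
  also have "\<dots> = char (step_measure w n) t * char M (- t)"
    unfolding char_def[of "step_measure w n"] by (rule integral_mult_left_zero)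
  finally show ?case using Suc by simp
qed

lemma nn_integral_step_measure:
  assumes [measurable]: "g \<in> borel_measurable borel"
  shows "(\<integral>\<^sup>+u. g u \<partial>step_measure w n) = kill M UNIV n g w"
  using assms
proof (induction n arbitrary: g)
  case 0
  then show ?case by (simp add: nn_integral_return)
next
  case (Suc n)
  note [measurable] = Suc.prems
  interpret N: real_distribution "step_measure w n" by (rule step_measure_distribution)
  interpret P: pair_prob_space "step_measure w n" M ..
  have "(\<integral>\<^sup>+u. g u \<partial>step_measure w (Suc n)) = (\<integral>\<^sup>+p. g (fst p - snd p) \<partial>(step_measure w n \<Otimes>\<^sub>M M))"
    unfolding step_measure.simps by (rule nn_integral_distr) auto
  also have "\<dots> = (\<integral>\<^sup>+u. (\<integral>\<^sup>+x. g (u - x) \<partial>M) \<partial>step_measure w n)"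
    using nn_integral_fst[of "\<lambda>p. g (fst p - snd p)" "step_measure w n"] by simp
  also have "\<dots> = (\<integral>\<^sup>+u. kill M UNIV (Suc 0) g u \<partial>step_measure w n)" by simp
  also have "\<dots> = kill M UNIV n (kill M UNIV (Suc 0) g) w" by (rule Suc.IH) (rule kill_measurable; measurable)
  also have "\<dots> = kill M UNIV (Suc n) g w" by (rule kill_Suc_right[symmetric])
  finally show ?case .
qed

end

section \<open>The continuous case of the inversion hypotheses\<close>

lemma group_measure_lborel: "group_measure (lborel :: real measure) UNIV"
proof -
  interpret sigma_finite_measure "lborel :: real measure" by (rule sigma_finite_lborel)
  show ?thesis
  proof
    fix a :: real
    have "(lborel :: real measure) = density (distr lborel borel (\<lambda>x. a + (- 1) * x)) (\<lambda>_. ennreal \<bar>- 1\<bar>)"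
      by (rule lborel_real_affine) simp
    also have "\<dots> = distr lborel borel (\<lambda>x. a - x)" by (simp add: density_1)
    finally show "distr lborel borel (\<lambda>x. a - x) = (lborel :: real measure)" by simp
  qed auto
qed

text \<open>The law of \<open>w - S\<close> after \<open>n\<close> steps has an integrable
  characteristic function, so its density can be inverted. A law with a density does not charge a
  countable lattice, hence the modulus is below 1 off the origin; compactness treats bounded
  frequencies and \<open>char_decay\<close> the others.\<close>

theorem inversion_walk_lborel:
  assumes f [measurable]: "f \<in> borel_measurable borel" "\<And>x. 0 \<le> f x"
    and walk: "fourth_moment_walk (density lborel (\<lambda>x. ennreal (f x)))"
    and n: "n \<ge> 1" and int: "integrable lborel (\<lambda>t. cmod (char (density lborel (\<lambda>x. ennreal (f x))) t) ^ n)"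
  shows "inversion_walk lborel UNIV f (\<lambda>_. UNIV) 1 UNIV n"
proof -
  interpret group_measure lborel UNIV by (rule group_measure_lborel)
  define \<mu> where "\<mu> = density lborel (\<lambda>x. ennreal (f x))"
  interpret W: fourth_moment_walk \<mu> unfolding \<mu>_def by (rule walk)
  have ne1: "cmod (char \<mu> t) \<noteq> 1" if t: "t \<noteq> 0" for t
  proof
    assume "cmod (char \<mu> t) = 1"
    then obtain a where a: "AE x in \<mu>. \<exists>k :: int. x = a + of_int k * (2 * pi / \<bar>t\<bar>)"
      using W.char_norm_1_lattice[OF t] by blast
    let ?S = "range (\<lambda>k :: int. a + of_int k * (2 * pi / \<bar>t\<bar>))"
    have "countable ?S" by simp
    then have "AE x in lborel. x \<notin> ?S" by (rule AE_not_in[OF countable_imp_null_set_lborel])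
    then have "AE x in \<mu>. x \<notin> ?S" unfolding \<mu>_def by (subst AE_density) auto
    with a have "AE x in \<mu>. False" by eventually_elim auto
    then show False by simp
  qed
  obtain T where T: "\<And>t. T \<le> \<bar>t\<bar> \<Longrightarrow> cmod (char \<mu> t) \<le> 1 / 2"
    using W.char_decay[OF int[folded \<mu>_def]] by blast
  have away: "\<exists>c<1. \<forall>t\<in>UNIV. r \<le> \<bar>t\<bar> \<longrightarrow> cmod (char \<mu> t) \<le> c" if r: "r > 0" for r
  proof -
    have "cmod (char \<mu> t) \<noteq> 1" if "r \<le> \<bar>t\<bar>" for t
      using that r by (intro ne1) auto
    then obtain c where c: "c < 1" "\<And>t. r \<le> \<bar>t\<bar> \<Longrightarrow> \<bar>t\<bar> \<le> T \<Longrightarrow> cmod (char \<mu> t) \<le> c"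
      using W.char_bounded_away[OF r, of T] by blast
    have "cmod (char \<mu> t) \<le> max c (1 / 2)" if "r \<le> \<bar>t\<bar>" for t
      using c(2)[of t] T[of t] that by (cases "\<bar>t\<bar> \<le> T") (auto simp: le_max_iff_disj)
    then show ?thesis using c(1) by (intro exI[of _ "max c (1 / 2)"]) auto
  qed
  have base: "AE v in lborel. 0 \<le> Re (fourier_inverse 1 UNIV (\<lambda>t. char \<mu> t ^ n) (w - v)) \<and>
      dens lborel f UNIV n w v = ennreal (Re (fourier_inverse 1 UNIV (\<lambda>t. char \<mu> t ^ n) (w - v)))" for w
  proof -
    define N where "N = W.step_measure w n"
    interpret N: real_distribution N unfolding N_def by (rule W.step_measure_distribution)
    have N: "N = density lborel (dens lborel f UNIV n w)"
    proof (rule measure_eqI)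
      fix A assume "A \<in> sets N"
      then have A [measurable]: "A \<in> sets borel" by simp
      have "emeasure N A = (\<integral>\<^sup>+u. indicator A u \<partial>N)" using A by simp
      also have "\<dots> = kill \<mu> UNIV n (indicator A) w"
        unfolding N_def by (rule W.nn_integral_step_measure) auto
      also have "\<dots> = (\<integral>\<^sup>+v. dens lborel f UNIV n w v * indicator A v \<partial>lborel)"
        unfolding \<mu>_def using n W.real_distribution_axioms by (intro kill_eq_dens) (auto simp: \<mu>_def)
      also have "\<dots> = emeasure (density lborel (dens lborel f UNIV n w)) A"
        by (rule emeasure_density[symmetric]) auto
      finally show "emeasure N A = emeasure (density lborel (dens lborel f UNIV n w)) A" .
    qed simp
    have ch: "char N t = iexp (t * w) * char \<mu> (- t) ^ n" for t
      unfolding N_def by (rule W.char_step_measure)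
    have "integrable lborel (\<lambda>t. cmod (char \<mu> (0 + (- 1) * t)) ^ n)"
      by (rule lborel_integrable_real_affine[OF int[folded \<mu>_def]]) simp
    then have iN: "integrable lborel (char N)"
      by (rule Bochner_Integration.integrable_bound) (auto simp: ch norm_mult norm_power)
    have fi: "fourier_inverse 1 UNIV (char N) v = fourier_inverse 1 UNIV (\<lambda>t. char \<mu> t ^ n) (w - v)" for v
    proof -
      have e: "iexp (- t * w) * iexp (- (- t * v)) = iexp (- (t * (w - v)))" for t
        unfolding exp_add[symmetric] by (rule arg_cong[where f = exp]) (simp add: algebra_simps)
      have "(\<integral>t. indicator UNIV t * char N t * iexp (- (t * v)) \<partial>lborel)
         = \<bar>- 1\<bar> *\<^sub>R (\<integral>t. indicator UNIV (0 + (- 1) * t) * char N (0 + (- 1) * t) * iexp (- ((0 + (- 1) * t) * v)) \<partial>lborel)"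
        by (rule lborel_integral_real_affine) simp
      also have "\<dots> = (\<integral>t. char \<mu> t ^ n * (iexp (- t * w) * iexp (- (- t * v))) \<partial>lborel)"
        by (simp add: ch mult_ac)
      also have "\<dots> = (\<integral>t. indicator UNIV t * char \<mu> t ^ n * iexp (- (t * (w - v))) \<partial>lborel)"
        unfolding e by simp
      finally show ?thesis unfolding fourier_inverse_def by simp
    qed
    have "AE v in lborel. dens lborel f UNIV n w v = ennreal (Re (fourier_inverse 1 UNIV (char N) v))"
      by (rule N.density_inversion(2)[OF _ N iN]) measurable
    then show ?thesis
      unfolding fi by eventually_elim (use N.density_inversion(1)[OF _ N iN] fi in auto)
  qed
  have wd: "walk_density lborel UNIV f"
    by (rule walk_density.intro[OF group_measure_axioms walk_density_axioms.intro]) (use f walk in auto)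
  have sw: "supported_walk_density lborel UNIV f (\<lambda>_. UNIV)"
    by (rule supported_walk_density.intro[OF wd supported_walk_density_axioms.intro]) auto
  show ?thesis
  proof (rule inversion_walk.intro[OF sw inversion_walk_axioms.intro])
    show "\<exists>r>0. {- r..r} \<subseteq> (UNIV :: real set)" by (rule exI[of _ 1]) simp
    show "1 \<le> n" by (rule n)
    show "integrable lborel (\<lambda>t. indicator UNIV t * cmod (char (density lborel (\<lambda>x. ennreal (f x))) t) ^ n)"
      using int by simp
    show "\<exists>c<1. \<forall>t\<in>UNIV. r \<le> \<bar>t\<bar> \<longrightarrow> cmod (char (density lborel (\<lambda>x. ennreal (f x))) t) \<le> c" if "0 < r" for r
      using away[OF that] unfolding \<mu>_def .
    show "AE v in lborel. w - v \<in> UNIV \<longrightarrow>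
       0 \<le> Re (fourier_inverse 1 UNIV (\<lambda>t. char (density lborel (\<lambda>x. ennreal (f x))) t ^ n) (w - v)) \<and>
       dens lborel f UNIV n w v = ennreal (Re (fourier_inverse 1 UNIV (\<lambda>t. char (density lborel (\<lambda>x. ennreal (f x))) t ^ n) (w - v)))" for w
      using base[of w] unfolding \<mu>_def by eventually_elim blast
  qed auto
qed

section \<open>The lattice case of the inversion hypotheses\<close>

text \<open>Pushed forward to the Borel sets, so that it lives on the same measurable space as
  Lebesgue measure.\<close>

definition count_on :: "real set \<Rightarrow> real measure" where
  "count_on G = distr (count_space G) borel (\<lambda>x. x)"

lemma sets_count_on [simp, measurable_cong]: "sets (count_on G) = sets borel"
  by (simp add: count_on_def)

lemma nn_integral_count_on:
  "F \<in> borel_measurable borel \<Longrightarrow> (\<integral>\<^sup>+x. F x \<partial>count_on G) = (\<integral>\<^sup>+x. F x \<partial>count_space G)"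
  unfolding count_on_def by (subst nn_integral_distr) auto

lemma emeasure_count_on: "A \<in> sets borel \<Longrightarrow> emeasure (count_on G) A = emeasure (count_space G) (A \<inter> G)"
  unfolding count_on_def by (subst emeasure_distr) auto

lemma group_measure_count_on:
  assumes "countable G" "0 \<in> G" and diff: "\<And>a b. a \<in> G \<Longrightarrow> b \<in> G \<Longrightarrow> a - b \<in> G"
  shows "group_measure (count_on G) G"
proof -
  have Gb [measurable]: "G \<in> sets borel" using assms(1) by (rule sets.countable[rotated]) auto
  interpret sigma_finite_measure "count_on G"
  proof
    show "\<exists>A. countable A \<and> A \<subseteq> sets (count_on G) \<and> \<Union>A = space (count_on G) \<and> (\<forall>a\<in>A. emeasure (count_on G) a \<noteq> \<infinity>)"
    proof (intro exI[of _ "insert (- G) ((\<lambda>x. {x}) ` G)"] conjI ballI)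
      show "countable (insert (- G) ((\<lambda>x. {x}) ` G))" using assms(1) by simp
      show "insert (- G) ((\<lambda>x. {x}) ` G) \<subseteq> sets (count_on G)" by auto
      show "\<Union> (insert (- G) ((\<lambda>x. {x}) ` G)) = space (count_on G)" by (auto simp: count_on_def)
      fix a assume "a \<in> insert (- G) ((\<lambda>x. {x}) ` G)"
      then consider "a = - G" | x where "a = {x}" "x \<in> G" by auto
      then show "emeasure (count_on G) a \<noteq> \<infinity>"
        by cases (auto simp: emeasure_count_on)
    qed
  qed
  show ?thesis
  proof (rule group_measure.intro[OF sigma_finite_measure_axioms group_measure_axioms.intro])
    show "AE x in count_on G. x \<in> G"
      by (rule AE_I[of _ _ "- G"]) (auto simp: emeasure_count_on)
    fix a assume a: "a \<in> G"
    have bij: "bij_betw (\<lambda>x. a - x) G G"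
      by (rule bij_betwI[where g = "\<lambda>x. a - x"]) (use diff[OF a] in auto)
    have "distr (count_on G) borel (\<lambda>x. a - x) = distr (count_space G) borel (\<lambda>x. a - x)"
      unfolding count_on_def by (subst distr_distr) (auto simp: comp_def)
    also have "\<dots> = distr (distr (count_space G) (count_space G) (\<lambda>x. a - x)) borel (\<lambda>x. x)"
      by (subst distr_distr) (use diff[OF a] in \<open>auto simp: comp_def\<close>)
    also have "\<dots> = count_on G" unfolding distr_bij_count_space[OF bij] count_on_def ..
    finally show "distr (count_on G) borel (\<lambda>x. a - x) = count_on G" .
  qed (use assms in auto)
qed

lemma lattice_setE: "x \<in> lattice_set \<gamma> d \<Longrightarrow> (\<And>m :: int. x = \<gamma> + of_int m * d \<Longrightarrow> P) \<Longrightarrow> P"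
  by (auto simp: lattice_set_def)

lemma lattice_setI: "x = \<gamma> + of_int m * d \<Longrightarrow> x \<in> lattice_set \<gamma> d"
  by (auto simp: lattice_set_def)

lemma countable_lattice_set: "countable (lattice_set \<gamma> d)"
proof -
  have "lattice_set \<gamma> d = range (\<lambda>m :: int. \<gamma> + of_int m * d)" by (auto simp: lattice_set_def)
  then show ?thesis by simp
qed

lemma lattice_set_add:
  assumes "x \<in> lattice_set (real m * \<gamma>) d"
  shows "x + y \<in> lattice_set (real (m + k) * \<gamma>) d \<longleftrightarrow> y \<in> lattice_set (real k * \<gamma>) d"
proof -
  obtain a :: int where a: "x = real m * \<gamma> + of_int a * d" using assms by (rule lattice_setE)
  show ?thesis
  proof
    assume "x + y \<in> lattice_set (real (m + k) * \<gamma>) d"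
    then obtain b :: int where "x + y = real (m + k) * \<gamma> + of_int b * d" by (rule lattice_setE)
    then have "y = real k * \<gamma> + of_int (b - a) * d" using a by (simp add: algebra_simps)
    then show "y \<in> lattice_set (real k * \<gamma>) d" by (rule lattice_setI)
  next
    assume "y \<in> lattice_set (real k * \<gamma>) d"
    then obtain b :: int where "y = real k * \<gamma> + of_int b * d" by (rule lattice_setE)
    then have "x + y = real (m + k) * \<gamma> + of_int (a + b) * d" using a by (simp add: algebra_simps)
    then show "x + y \<in> lattice_set (real (m + k) * \<gamma>) d" by (rule lattice_setI)
  qed
qed

text \<open>The subgroup generated by \<open>\<gamma>\<close> and \<open>d\<close>. It contains the
  cosets of all times at once; it need not be discrete, and only its countability is used.\<close>

definition lattice_group :: "real \<Rightarrow> real \<Rightarrow> real set" where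
  "lattice_group \<gamma> d = (\<lambda>(a :: int, b :: int). of_int a * \<gamma> + of_int b * d) ` UNIV"

lemma countable_lattice_group: "countable (lattice_group \<gamma> d)"
  by (simp add: lattice_group_def)

lemma lattice_groupI: "x = of_int a * \<gamma> + of_int b * d \<Longrightarrow> x \<in> lattice_group \<gamma> d"
  unfolding lattice_group_def by (rule image_eqI[of _ _ "(a, b)"]) auto

lemma lattice_groupE:
  assumes "x \<in> lattice_group \<gamma> d"
  obtains a b :: int where "x = of_int a * \<gamma> + of_int b * d"
  using assms unfolding lattice_group_def by auto

lemma lattice_set_subset_group: "lattice_set (real n * \<gamma>) d \<subseteq> lattice_group \<gamma> d"
proof
  fix x assume "x \<in> lattice_set (real n * \<gamma>) d"
  then obtain m :: int where "x = real n * \<gamma> + of_int m * d" by (rule lattice_setE)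
  then show "x \<in> lattice_group \<gamma> d" by (intro lattice_groupI[of _ "int n" _ m]) simp
qed

lemma group_measure_lattice: "group_measure (count_on (lattice_group \<gamma> d)) (lattice_group \<gamma> d)"
proof (rule group_measure_count_on[OF countable_lattice_group])
  show "0 \<in> lattice_group \<gamma> d" by (rule lattice_groupI[of _ 0 _ 0]) simp
  fix x y assume "x \<in> lattice_group \<gamma> d" "y \<in> lattice_group \<gamma> d"
  then obtain a b a' b' :: int where "x = of_int a * \<gamma> + of_int b * d" "y = of_int a' * \<gamma> + of_int b' * d"
    by (auto elim!: lattice_groupE)
  then show "x - y \<in> lattice_group \<gamma> d"
    by (intro lattice_groupI[of _ "a - a'" _ "b - b'"]) (simp add: algebra_simps)
qed

lemma (in real_distribution) discrete_density:
  assumes G: "countable G" "AE x in M. x \<in> G" and f: "\<And>x. f x = measure M {x}"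
    and [measurable]: "f \<in> borel_measurable borel"
  shows "density (count_on G) (\<lambda>x. ennreal (f x)) = M"
proof (rule measure_eqI)
  have Gb [measurable]: "G \<in> sets borel" using G(1) by (rule sets.countable[rotated]) auto
  fix A assume "A \<in> sets (density (count_on G) (\<lambda>x. ennreal (f x)))"
  then have A [measurable]: "A \<in> sets borel" by simp
  have "emeasure (density (count_on G) (\<lambda>x. ennreal (f x))) A = (\<integral>\<^sup>+x. ennreal (f x) * indicator A x \<partial>count_on G)"
    by (rule emeasure_density) auto
  also have "\<dots> = (\<integral>\<^sup>+x. ennreal (f x) * indicator A x \<partial>count_space G)"
    by (rule nn_integral_count_on) auto
  also have "\<dots> = (\<integral>\<^sup>+x. emeasure M {x} * indicator A x \<partial>count_space G)"
    by (simp add: f emeasure_eq_measure)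
  also have "\<dots> = (\<integral>\<^sup>+x. emeasure M {x} \<partial>count_space (A \<inter> G))"
    by (subst (1 2) nn_integral_count_space_indicator)
      (auto intro!: nn_integral_cong simp: indicator_def)
  also have "\<dots> = emeasure M (A \<inter> G)"
    using G(1) by (intro emeasure_countable_singleton[symmetric]) auto
  also have "\<dots> = emeasure M A"
    using G(2) by (intro emeasure_eq_AE) auto
  finally show "emeasure (density (count_on G) (\<lambda>x. ennreal (f x))) A = emeasure M A" .
qed simp

lemma integral_iexp_period:
  fixes k :: int
  assumes d: "d > 0"
  shows "(\<integral>t. indicator {- (pi / d)..pi / d} t *\<^sub>R iexp (t * (of_int k * d)) \<partial>lborel) = (if k = 0 then 2 * pi / d else 0)"
proof (cases "k = 0")
  case True
  have "(\<integral>t. indicator {- (pi / d)..pi / d} t *\<^sub>R (1 :: complex) \<partial>lborel) = (2 * pi / d) *\<^sub>R 1"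
    using d by (subst integral_scaleR_left) (auto intro!: integrable_real_indicator simp: field_simps)
  then show ?thesis using True by (simp add: scaleR_conv_of_real)
next
  case False
  let ?t = "- (of_int k * d)"
  have t: "?t \<noteq> 0" "- (pi / d) \<le> pi / d" using False d by auto
  have "(\<integral>t. indicator {- (pi / d)..pi / d} t *\<^sub>R iexp (t * (of_int k * d)) \<partial>lborel)
     = (\<integral>t. indicator {- (pi / d)..pi / d} t *\<^sub>R iexp (- (?t * t)) \<partial>lborel)"
    by (simp add: mult_ac)
  also have "\<dots> = (iexp (- (?t * - (pi / d))) - iexp (- (?t * (pi / d)))) / (\<i> * ?t)"
    by (rule integral_iexp[OF t(2,1)])
  also have "iexp (- (?t * - (pi / d))) = iexp (- (?t * (pi / d)))"
  proof -
    have "- (?t * - (pi / d)) = - (of_int k * pi)" "- (?t * (pi / d)) = of_int k * pi" using d by auto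
    moreover have "iexp (- (of_int k * pi)) = iexp (of_int k * pi)"
      unfolding cis_conv_exp[symmetric] by (simp add: complex_eq_iff sin_zero_iff_int2)
    ultimately show ?thesis by simp
  qed
  finally show ?thesis using False by simp
qed

text \<open>Points of the support differ from \<open>x\<close> by multiples of \<open>d\<close>, so
  orthogonality of exponentials over one period isolates the mass at \<open>x\<close>, already for
  the first power. A modulus 1 at \<open>0 < \<bar>t\<bar> \<le> pi / d\<close> would put the
  support into a lattice of span \<open>2 pi / \<bar>t\<bar> \<ge> 2 d\<close>, against the
  maximality of \<open>d\<close>.\<close>

theorem inversion_walk_lattice:
  assumes f [measurable]: "f \<in> borel_measurable borel" "\<And>x. 0 \<le> f x"
    and walk: "fourth_moment_walk (density (count_on (lattice_group \<gamma> d)) (\<lambda>x. ennreal (f x)))"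
    and d: "d > 0" and supp: "{x. f x > 0} \<subseteq> lattice_set \<gamma> d"
    and span: "\<And>\<gamma>' d'. d < d' \<Longrightarrow> \<not> {x. f x > 0} \<subseteq> lattice_set \<gamma>' d'"
  shows "inversion_walk (count_on (lattice_group \<gamma> d)) (lattice_group \<gamma> d) f (\<lambda>n. lattice_set (real n * \<gamma>) d) d {- (pi / d)..pi / d} 1"
proof -
  define G where "G = lattice_group \<gamma> d"
  define \<rho> where "\<rho> = count_on G"
  define D where "D = {- (pi / d)..pi / d}"
  interpret group_measure \<rho> G unfolding \<rho>_def G_def by (rule group_measure_lattice)
  interpret W: fourth_moment_walk "density \<rho> (\<lambda>x. ennreal (f x))" unfolding \<rho>_def G_def by (rule walk)
  let ?\<phi> = "char (density \<rho> (\<lambda>x. ennreal (f x)))"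
  have sing: "emeasure \<rho> {x} = 1" if "x \<in> G" for x
    using that by (simp add: \<rho>_def emeasure_count_on)
  have suppG: "f x \<noteq> 0 \<Longrightarrow> x \<in> lattice_set \<gamma> d" for x
    using supp f(2)[of x] by (auto simp: less_le)
  have LG: "lattice_set \<gamma> d \<subseteq> G" using lattice_set_subset_group[of 1 \<gamma> d] by (simp add: G_def)
  have wd: "walk_density \<rho> G f"
    by (rule walk_density.intro[OF group_measure_axioms walk_density_axioms.intro]) (use f W.fourth_moment_walk_axioms in auto)
  have sw: "supported_walk_density \<rho> G f (\<lambda>n. lattice_set (real n * \<gamma>) d)"
    by (rule supported_walk_density.intro[OF wd supported_walk_density_axioms.intro])
      (use suppG lattice_set_add in \<open>auto simp del: of_nat_add\<close>)
  have ne1: "cmod (?\<phi> t) \<noteq> 1" if t: "t \<noteq> 0" "\<bar>t\<bar> \<le> pi / d" for t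
  proof
    assume "cmod (?\<phi> t) = 1"
    then obtain a where "AE x in density \<rho> (\<lambda>x. ennreal (f x)). \<exists>k :: int. x = a + of_int k * (2 * pi / \<bar>t\<bar>)"
      using W.char_norm_1_lattice[OF t(1)] by blast
    then have ae: "AE x in \<rho>. 0 < ennreal (f x) \<longrightarrow> (\<exists>k :: int. x = a + of_int k * (2 * pi / \<bar>t\<bar>))"
      by (subst (asm) AE_density) auto
    have "{x. f x > 0} \<subseteq> lattice_set a (2 * pi / \<bar>t\<bar>)"
    proof (clarify)
      fix x assume x: "0 < f x"
      then have "x \<in> G" using supp LG by auto
      from ae obtain N where N: "{x \<in> space \<rho>. \<not> (0 < ennreal (f x) \<longrightarrow> (\<exists>k :: int. x = a + of_int k * (2 * pi / \<bar>t\<bar>)))} \<subseteq> N"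
        "emeasure \<rho> N = 0" "N \<in> sets \<rho>" by (rule AE_E)
      \<comment> \<open>Points of \<open>G\<close> have mass 1 under the reference measure, so a
        null set contains none of them and the statement holds at \<open>x\<close> itself.\<close>
      have "x \<notin> N"
      proof
        assume "x \<in> N"
        then have "emeasure \<rho> {x} \<le> emeasure \<rho> N" using N by (intro emeasure_mono) auto
        then show False using sing[OF \<open>x \<in> G\<close>] N by simp
      qed
      then have "\<exists>k :: int. x = a + of_int k * (2 * pi / \<bar>t\<bar>)" using N(1) x by auto
      then show "x \<in> lattice_set a (2 * pi / \<bar>t\<bar>)" by (auto intro: lattice_setI)
    qed
    moreover have "d < 2 * pi / \<bar>t\<bar>"
    proof -
      have "d * \<bar>t\<bar> \<le> pi" using t(2) d by (simp add: field_simps)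
      then have "d * \<bar>t\<bar> < 2 * pi" using pi_gt_zero by linarith
      then show ?thesis using t(1) by (simp add: field_simps)
    qed
    ultimately show False using span by blast
  qed
  have away: "\<exists>c<1. \<forall>t\<in>D. r \<le> \<bar>t\<bar> \<longrightarrow> cmod (?\<phi> t) \<le> c" if r: "0 < r" for r
  proof -
    have "cmod (?\<phi> t) \<noteq> 1" if "r \<le> \<bar>t\<bar>" "\<bar>t\<bar> \<le> pi / d" for t
      using that r by (intro ne1) auto
    then obtain c where c: "c < 1" "\<And>t. r \<le> \<bar>t\<bar> \<Longrightarrow> \<bar>t\<bar> \<le> pi / d \<Longrightarrow> cmod (?\<phi> t) \<le> c"
      using W.char_bounded_away[OF r, of "pi / d"] by blast
    show ?thesis
      by (intro exI[of _ c] conjI ballI impI c) (auto simp: D_def)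
  qed
  have intf: "integrable \<rho> f"
  proof -
    have "integrable (density \<rho> (\<lambda>x. ennreal (f x))) (\<lambda>_. 1 :: real)" by simp
    then show "integrable \<rho> f" using f(2) by (subst (asm) integrable_density) auto
  qed
  have inv: "fourier_inverse d D (\<lambda>t. ?\<phi> t ^ 1) x = complex_of_real (f x)" if x: "x \<in> lattice_set \<gamma> d" for x
  proof -
    interpret P: pair_sigma_finite lborel \<rho> ..
    let ?F = "\<lambda>t s. f s *\<^sub>R (indicator D t *\<^sub>R iexp (t * (s - x)))"
    have nF: "norm (?F t s) = indicator D t * f s" for t s
      using f(2) by simp
    have intD: "integrable lborel (indicator D :: real \<Rightarrow> real)"
      unfolding D_def using d by (intro integrable_real_indicator) auto
    have intF: "integrable (lborel \<Otimes>\<^sub>M \<rho>) (case_prod ?F)"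
    proof (rule P.Fubini_integrable)
      show "integrable lborel (\<lambda>t. \<integral>s. norm (case_prod ?F (t, s)) \<partial>\<rho>)"
        unfolding prod.case nF using intD by simp
      show "AE t in lborel. integrable \<rho> (\<lambda>s. case_prod ?F (t, s))"
      proof (rule AE_I2)
        fix t :: real
        have "integrable \<rho> (\<lambda>s. indicator D t * f s)" using intf by simp
        then show "integrable \<rho> (\<lambda>s. case_prod ?F (t, s))"
          by (rule Bochner_Integration.integrable_bound) (auto simp: f(2))
      qed
    qed (simp add: D_def)
    have phi: "indicator D t * ?\<phi> t ^ 1 * iexp (- (t * x)) = (\<integral>s. ?F t s \<partial>\<rho>)" for t
    proof -
      have "?\<phi> t = (\<integral>s. f s *\<^sub>R iexp (t * s) \<partial>\<rho>)"
        unfolding char_def using f(2) by (intro integral_density) auto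
      then have "indicator D t * ?\<phi> t ^ 1 * iexp (- (t * x)) = (indicator D t * iexp (- (t * x))) * (\<integral>s. f s *\<^sub>R iexp (t * s) \<partial>\<rho>)"
        by (simp add: mult_ac)
      also have "\<dots> = (\<integral>s. (indicator D t * iexp (- (t * x))) * (f s *\<^sub>R iexp (t * s)) \<partial>\<rho>)"
        by (rule integral_mult_right_zero[symmetric])
      also have "\<dots> = (\<integral>s. ?F t s \<partial>\<rho>)"
      proof (rule Bochner_Integration.integral_cong[OF refl])
        fix s
        have "iexp (t * (s - x)) = iexp (- (t * x)) * iexp (t * s)"
          unfolding exp_add[symmetric] by (rule arg_cong[where f = exp]) (simp add: algebra_simps)
        then show "(indicator D t * iexp (- (t * x))) * (f s *\<^sub>R iexp (t * s)) = ?F t s"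
          by (simp add: indicator_def scaleR_conv_of_real)
      qed
      finally show ?thesis .
    qed
    have inner: "(\<integral>t. ?F t s \<partial>lborel) = indicator {x} s *\<^sub>R complex_of_real (f x * (2 * pi / d))" for s
    proof (cases "f s = 0")
      case True
      then show ?thesis by (auto simp: indicator_def)
    next
      case False
      obtain a b :: int where ab: "s = \<gamma> + of_int a * d" "x = \<gamma> + of_int b * d"
        using suppG[OF False] x by (auto elim!: lattice_setE)
      have sx: "s - x = of_int (a - b) * d" by (simp add: ab algebra_simps)
      have "(\<integral>t. ?F t s \<partial>lborel) = f s *\<^sub>R (\<integral>t. indicator D t *\<^sub>R iexp (t * (of_int (a - b) * d)) \<partial>lborel)"
        unfolding sx by (rule integral_scaleR_right)
      also have "\<dots> = f s *\<^sub>R complex_of_real (if a - b = 0 then 2 * pi / d else 0)"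
        unfolding D_def integral_iexp_period[OF d] ..
      also have "\<dots> = indicator {x} s *\<^sub>R complex_of_real (f x * (2 * pi / d))"
        using ab d by (auto simp: indicator_def scaleR_conv_of_real)
      finally show ?thesis .
    qed
    have "(\<integral>t. indicator D t * ?\<phi> t ^ 1 * iexp (- (t * x)) \<partial>lborel) = (\<integral>t. (\<integral>s. ?F t s \<partial>\<rho>) \<partial>lborel)"
      unfolding phi ..
    also have "\<dots> = (\<integral>s. (\<integral>t. ?F t s \<partial>lborel) \<partial>\<rho>)"
      by (rule P.Fubini_integral[OF intF, symmetric])
    also have "\<dots> = measure \<rho> {x} *\<^sub>R complex_of_real (f x * (2 * pi / d))"
      unfolding inner using sing[of x] x LG by (subst integral_scaleR_left) (auto intro!: integrable_real_indicator)
    also have "measure \<rho> {x} = 1" using sing[of x] x LG by (auto simp: measure_def)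
    finally show ?thesis unfolding fourier_inverse_def using d by (simp add: field_simps)
  qed
  have "inversion_walk \<rho> G f (\<lambda>n. lattice_set (real n * \<gamma>) d) d D 1"
  proof (rule inversion_walk.intro[OF sw inversion_walk_axioms.intro])
    show "0 < d" by (rule d)
    show "D \<in> sets borel" by (simp add: D_def)
    show "\<exists>r>0. {- r..r} \<subseteq> D" using d by (intro exI[of _ "pi / d"]) (auto simp: D_def)
    show "integrable lborel (\<lambda>t. indicator D t * cmod (?\<phi> t) ^ 1)"
    proof (rule Bochner_Integration.integrable_bound)
      show "integrable lborel (indicator D :: real \<Rightarrow> real)"
        unfolding D_def using d by (intro integrable_real_indicator) auto
      show "AE t in lborel. norm (indicator D t * cmod (?\<phi> t) ^ 1) \<le> norm (indicator D t :: real)"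
        using W.cmod_char_le_1 by (auto simp: indicator_def)
    qed (simp add: D_def)
    show "\<exists>c<1. \<forall>t\<in>D. r \<le> \<bar>t\<bar> \<longrightarrow> cmod (?\<phi> t) \<le> c" if "0 < r" for r by (rule away[OF that])
    show "AE v in \<rho>. w - v \<in> lattice_set (real 1 * \<gamma>) d \<longrightarrow>
       0 \<le> Re (fourier_inverse d D (\<lambda>t. ?\<phi> t ^ 1) (w - v)) \<and>
       dens \<rho> f UNIV 1 w v = ennreal (Re (fourier_inverse d D (\<lambda>t. ?\<phi> t ^ 1) (w - v)))" for w
      using inv f(2) by (intro AE_I2) auto
  qed simp
  then show ?thesis unfolding \<rho>_def G_def D_def .
qed

section \<open>Densities, lattice probabilities and the conditional probability\<close>

text \<open>Changes from the distance \<open>u = y - s\<close> to the position \<open>s\<close>, the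
  variable in which convolutions and path integrals are written.\<close>

lemma (in group_measure) dens_Suc_shift:
  assumes [measurable]: "f \<in> borel_measurable borel" "B \<in> sets borel" and n: "n \<ge> 1" and y: "y \<in> G"
  shows "dens \<rho> f B (Suc n) y (y - x) = (\<integral>\<^sup>+s. dens \<rho> f B n y (y - s) * ennreal (f (x - s)) \<partial>\<rho>) * indicator B (y - x)"
proof -
  obtain k where k: "n = Suc k" using n by (cases n) auto
  have "(\<integral>\<^sup>+s. (\<lambda>u. dens \<rho> f B n y u * ennreal (f (u - (y - x)))) (y - s) \<partial>\<rho>)
     = (\<integral>\<^sup>+u. dens \<rho> f B n y u * ennreal (f (u - (y - x))) \<partial>\<rho>)"
    by (rule nn_integral_reflect[OF y]) measurable
  moreover have "y - s - (y - x) = x - s" for s by simp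
  ultimately show ?thesis unfolding k by simp
qed

lemma conv_pow_eq_dens:
  assumes [measurable]: "f \<in> borel_measurable borel" and n: "n \<ge> 1"
  shows "conv_pow f n x = dens lborel f UNIV n y (y - x)"
  using n
proof (induction n arbitrary: x rule: dec_induct)
  case base
  then show ?case by simp
next
  case (step n)
  interpret group_measure lborel UNIV by (rule group_measure_lborel)
  obtain k where "n = Suc k" using step by (cases n) auto
  then have "conv_pow f (Suc n) x = (\<integral>\<^sup>+s. conv_pow f n s * ennreal (f (x - s)) \<partial>lborel)" by simp
  then show ?case using step dens_Suc_shift[of f UNIV n y x] by simp
qed

text \<open>Fubini in the last free coordinate: once it has the value \<open>t\<close>, the other
  coordinates form a path of \<open>n\<close> steps ending in \<open>t\<close>, and the last factor
  and the constraint \<open>t < y\<close> split off.\<close>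

lemma restr_density_Suc:
  assumes [measurable]: "f \<in> borel_measurable borel" and n: "n \<ge> 1" and y: "y > 0"
  shows "restr_density f (Suc n) x y = (\<integral>\<^sup>+s. indicator {..<y} s * restr_density f n s y * ennreal (f (x - s)) \<partial>lborel)"
proof -
  interpret product_sigma_finite "\<lambda>_ :: nat. lborel :: real measure"
    by (rule product_sigma_finite.intro) (rule sigma_finite_lborel)
  have ins: "{1..<Suc n} = insert n {1..<n}" using n by auto
  have bp [measurable]: "(\<lambda>s. bridge_path k x s i) \<in> borel_measurable (Pi\<^sub>M {1..<k} (\<lambda>_. lborel))" if "i \<le> k" for k i x
  proof (cases "i = 0 \<or> i = k")
    case True
    then show ?thesis by (cases "i = 0") (simp_all add: bridge_path_def)
  next
    case False
    then have ik: "i \<in> {1..<k}" using that by (cases i) auto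
    have "(\<lambda>s :: nat \<Rightarrow> real. s i) \<in> measurable (Pi\<^sub>M {1..<k} (\<lambda>_. lborel)) lborel"
      by (rule measurable_component_singleton[OF ik])
    then show ?thesis using False by (simp add: bridge_path_def)
  qed
  have ind: "indicator {s. \<forall>i\<in>I. s i < y} s = (\<Prod>i\<in>I. indicator {..<y} (s i) :: ennreal)" if "finite I" for I :: "nat set" and s :: "nat \<Rightarrow> real"
    using that by (induction I rule: finite_induct) (auto simp: indicator_def)
  have ind_meas [measurable]: "(\<lambda>s. indicator {s. \<forall>i\<in>{1..<k}. s i < y} s :: ennreal) \<in> borel_measurable (Pi\<^sub>M {1..<k} (\<lambda>_. lborel))" for k :: nat
  proof -
    have c: "(\<lambda>s :: nat \<Rightarrow> real. s i) \<in> measurable (Pi\<^sub>M {1..<k} (\<lambda>_. lborel)) borel" if "i \<in> {1..<k}" for i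
      using measurable_component_singleton[OF that, of "\<lambda>_. lborel :: real measure"] by simp
    show ?thesis
      unfolding ind[OF finite_atLeastLessThan] by (intro borel_measurable_prod_ennreal measurable_compose[OF c]) auto
  qed
  have prod_meas: "(\<lambda>s. \<Prod>i=1..k. ennreal (f (bridge_path k x s i - bridge_path k x s (i - 1)))) \<in> borel_measurable (Pi\<^sub>M {1..<k} (\<lambda>_. lborel))" for k x
    by (intro borel_measurable_prod_ennreal measurable_compose[OF _ measurable_ennreal] measurable_compose[OF _ assms(1)]
        borel_measurable_diff bp) auto
  let ?H = "\<lambda>k x s. indicator {s. \<forall>i\<in>{1..<k}. s i < y} s * (\<Prod>i=1..k. ennreal (f (bridge_path k x s i - bridge_path k x s (i - 1))))"
  have H: "?H k x \<in> borel_measurable (Pi\<^sub>M {1..<k} (\<lambda>_. lborel))" for k x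
    by (intro borel_measurable_times_ennreal ind_meas prod_meas)
  have upd: "?H (Suc n) x (s(n := t)) = (indicator {..<y} t * ennreal (f (x - t))) * ?H n t s" for s t
  proof -
    have b: "bridge_path (Suc n) x (s(n := t)) i = bridge_path n t s i" if "i \<le> n" for i
      using that by (auto simp: bridge_path_def)
    have "(\<Prod>i=1..Suc n. ennreal (f (bridge_path (Suc n) x (s(n := t)) i - bridge_path (Suc n) x (s(n := t)) (i - 1))))
       = (\<Prod>i=1..n. ennreal (f (bridge_path (Suc n) x (s(n := t)) i - bridge_path (Suc n) x (s(n := t)) (i - 1)))) * ennreal (f (x - t))"
      using n by (simp add: bridge_path_def)
    also have "(\<Prod>i=1..n. ennreal (f (bridge_path (Suc n) x (s(n := t)) i - bridge_path (Suc n) x (s(n := t)) (i - 1))))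
       = (\<Prod>i=1..n. ennreal (f (bridge_path n t s i - bridge_path n t s (i - 1))))"
      by (intro prod.cong refl) (auto simp: b)
    finally have p: "(\<Prod>i=1..Suc n. ennreal (f (bridge_path (Suc n) x (s(n := t)) i - bridge_path (Suc n) x (s(n := t)) (i - 1))))
       = (\<Prod>i=1..n. ennreal (f (bridge_path n t s i - bridge_path n t s (i - 1)))) * ennreal (f (x - t))" .
    have i: "indicator {s. \<forall>i\<in>{1..<Suc n}. s i < y} (s(n := t)) = (indicator {..<y} t * indicator {s. \<forall>i\<in>{1..<n}. s i < y} s :: ennreal)"
      unfolding ins by (auto simp: indicator_def)
    show ?thesis unfolding p i by (simp only: mult_ac)
  qed
  have "restr_density f (Suc n) x y = (\<integral>\<^sup>+s. ?H (Suc n) x s \<partial>Pi\<^sub>M {1..<Suc n} (\<lambda>_. lborel))"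
    using y by (simp add: restr_density_def)
  also have "\<dots> = (\<integral>\<^sup>+t. (\<integral>\<^sup>+s. ?H (Suc n) x (s(n := t)) \<partial>Pi\<^sub>M {1..<n} (\<lambda>_. lborel)) \<partial>lborel)"
    using H[of "Suc n" x] unfolding ins by (intro product_nn_integral_insert_rev) auto
  also have "\<dots> = (\<integral>\<^sup>+t. (indicator {..<y} t * ennreal (f (x - t))) * restr_density f n t y \<partial>lborel)"
  proof -
    have rd: "restr_density f n t y = (\<integral>\<^sup>+s. ?H n t s \<partial>Pi\<^sub>M {1..<n} (\<lambda>_. lborel))" for t
      using y by (simp add: restr_density_def)
    show ?thesis unfolding upd rd by (intro nn_integral_cong nn_integral_cmult H)
  qed
  finally show ?thesis by (simp add: mult_ac)
qed

text \<open>The path integral constrains the intermediate points only, while \<open>dens\<close>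
  also requires the end point to be above 0 in distance from the barrier; the hypothesis
  \<open>x < y\<close> reconciles the two.\<close>

lemma restr_density_eq_dens:
  assumes f [measurable]: "f \<in> borel_measurable borel" and n: "n \<ge> 1" and y: "y > 0" and xy: "x < y"
  shows "restr_density f n x y = dens lborel f {0<..} n y (y - x)"
  using n xy
proof (induction n arbitrary: x rule: dec_induct)
  \<comment> \<open>For \<open>n = 1\<close> there are no intermediate coordinates: the product over
    the empty index set is a point mass.\<close>
  case base
  have "Pi\<^sub>M {} (\<lambda>_ :: nat. lborel :: real measure) = count_space {\<lambda>_. undefined}" by (rule PiM_empty)
  then show ?case using base y
    by (simp add: restr_density_def bridge_path_def nn_integral_count_space_finite)
next
  case (step n)
  interpret group_measure lborel UNIV by (rule group_measure_lborel)
  have "restr_density f (Suc n) x y = (\<integral>\<^sup>+s. indicator {..<y} s * restr_density f n s y * ennreal (f (x - s)) \<partial>lborel)"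
    using step y by (intro restr_density_Suc) auto
  also have "\<dots> = (\<integral>\<^sup>+s. dens lborel f {0<..} n y (y - s) * ennreal (f (x - s)) \<partial>lborel)"
  proof (rule nn_integral_cong)
    fix s
    show "indicator {..<y} s * restr_density f n s y * ennreal (f (x - s)) = dens lborel f {0<..} n y (y - s) * ennreal (f (x - s))"
      using step.IH[of s] dens_outside[of y "{0<..}" "y - s" lborel f n] by (cases "s < y") auto
  qed
  also have "\<dots> = dens lborel f {0<..} (Suc n) y (y - x)"
    using dens_Suc_shift[of f "{0<..}" n y x] step by simp
  finally show ?case .
qed

lemma enn2real_divide_finite:
  assumes "a \<le> b" "0 < b" "b < \<top>"
  shows "enn2real (a / b) = enn2real a / enn2real b"
proof -
  have "a < \<top>" using assms by simp
  then obtain Q where Q: "a = ennreal Q" "Q \<ge> 0" by (cases a) auto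
  obtain P where P: "b = ennreal P" "P \<ge> 0" using assms by (cases b) auto
  have "P > 0" using P assms by auto
  then show ?thesis using P Q by (simp add: divide_ennreal)
qed

section \<open>Path probabilities in the lattice case\<close>

context prob_space
begin

lemma walk_Suc: "walk X (Suc n) \<omega> = walk X n \<omega> + X (Suc n) \<omega>"
  by (simp add: walk_def)

text \<open>Decomposition by the position before the last step, which is independent of the last
  increment. The event restricts the times \<open>k < n\<close> only, to match the maximum up to
  time \<open>n - 1\<close>; the end point is treated by the hypothesis
  \<open>y - x \<in> B\<close>.\<close>

lemma path_probability:
  fixes X :: "nat \<Rightarrow> 'a \<Rightarrow> real"
  assumes ind: "indep_vars (\<lambda>_. borel) X {1..}"
    and dist: "\<And>i. i \<ge> 1 \<Longrightarrow> distr M borel (X i) = distr M borel (X 1)"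
    and f: "\<And>x. f x = prob {\<omega> \<in> space M. X 1 \<omega> = x}" and fm [measurable]: "f \<in> borel_measurable borel"
    and gm: "group_measure (count_on G) G" and G: "countable G" "AE \<omega> in M. X 1 \<omega> \<in> G"
    and B [measurable]: "B \<in> sets borel" and y: "y \<in> G" "y \<in> B"
    and n: "n \<ge> 1" and x: "x \<in> G" "y - x \<in> B"
  shows "emeasure M {\<omega> \<in> space M. (\<forall>k<n. y - walk X k \<omega> \<in> B) \<and> walk X n \<omega> = x} = dens (count_on G) f B n y (y - x)"
proof -
  interpret group_measure "count_on G" G by (rule gm)
  have Xm [measurable]: "X i \<in> borel_measurable M" if "i \<ge> 1" for i
    using ind that unfolding indep_vars_def by auto
  have Gb [measurable]: "G \<in> sets borel" using G(1) by (rule sets.countable[rotated]) auto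
  have wm [measurable]: "walk X k \<in> borel_measurable M" for k
    unfolding walk_def[abs_def] by (intro borel_measurable_sum Xm) auto
  have Xf: "emeasure M {\<omega> \<in> space M. X i \<omega> = x} = ennreal (f x)" if "i \<ge> 1" for i x
  proof -
    have "emeasure M {\<omega> \<in> space M. X i \<omega> = x} = emeasure (distr M borel (X i)) {x}"
      using that by (subst emeasure_distr) (auto intro!: arg_cong2[where f = emeasure])
    also have "\<dots> = emeasure (distr M borel (X 1)) {x}" by (simp only: dist[OF that])
    also have "\<dots> = emeasure M {\<omega> \<in> space M. X 1 \<omega> = x}"
      by (subst emeasure_distr) (auto intro!: arg_cong2[where f = emeasure])
    finally show ?thesis by (simp add: f emeasure_eq_measure)
  qed
  have XG: "AE \<omega> in M. X i \<omega> \<in> G" if "i \<ge> 1" for i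
  proof -
    have "AE x in distr M borel (X 1). x \<in> G" using G(2) by (subst AE_distr_iff) auto
    then have "AE x in distr M borel (X i). x \<in> G" by (simp only: dist[OF that])
    then show ?thesis using that by (subst (asm) AE_distr_iff) auto
  qed
  define E where "E = (\<lambda>n x. {\<omega> \<in> space M. (\<forall>k<n. y - walk X k \<omega> \<in> B) \<and> walk X n \<omega> = x})"
  have Em [measurable]: "E n x \<in> sets M" for n x unfolding E_def by measurable
  have indep: "emeasure M (E n s \<inter> {\<omega> \<in> space M. X (Suc n) \<omega> = t}) = emeasure M (E n s) * ennreal (f t)" for n s t
  proof -
    let ?A = "{1..n}" and ?C = "{Suc n}"
    have iv: "indep_var (PiM ?A (\<lambda>_. borel)) (\<lambda>\<omega>. restrict (\<lambda>i. X i \<omega>) ?A) (PiM ?C (\<lambda>_. borel)) (\<lambda>\<omega>. restrict (\<lambda>i. X i \<omega>) ?C)"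
      using ind by (rule indep_var_restrict) auto
    let ?w = "\<lambda>k \<xi>. \<Sum>i=1..k. (\<xi> i :: real)"
    have wk [measurable]: "?w k \<in> borel_measurable (PiM ?A (\<lambda>_. borel))" if "k \<le> n" for k
      by (intro borel_measurable_sum measurable_component_singleton) (use that in auto)
    define U where "U = {\<xi> \<in> space (PiM ?A (\<lambda>_. borel :: real measure)). (\<forall>k\<in>{..<n}. y - ?w k \<xi> \<in> B) \<and> ?w n \<xi> = s}"
    have U: "U \<in> sets (PiM ?A (\<lambda>_. borel))"
    proof -
      have "{\<xi> \<in> space (PiM ?A (\<lambda>_. borel)). \<forall>k\<in>{..<n}. y - ?w k \<xi> \<in> B} \<in> sets (PiM ?A (\<lambda>_. borel))"
      proof (rule sets.sets_Collect_finite_All)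
        fix k assume "k \<in> {..<n}"
        then have "(\<lambda>\<xi>. y - ?w k \<xi>) \<in> borel_measurable (PiM ?A (\<lambda>_. borel))"
          by (intro borel_measurable_diff borel_measurable_const wk) auto
        from measurable_sets[OF this B]
        show "{\<xi> \<in> space (PiM ?A (\<lambda>_. borel)). y - ?w k \<xi> \<in> B} \<in> sets (PiM ?A (\<lambda>_. borel))"
          by (simp add: vimage_def Int_def conj_commute)
      qed simp
      moreover have "?w n -` {s} \<inter> space (PiM ?A (\<lambda>_. borel)) \<in> sets (PiM ?A (\<lambda>_. borel))"
        by (rule measurable_sets[OF wk]) auto
      moreover have "U = {\<xi> \<in> space (PiM ?A (\<lambda>_. borel)). \<forall>k\<in>{..<n}. y - ?w k \<xi> \<in> B} \<inter> (?w n -` {s} \<inter> space (PiM ?A (\<lambda>_. borel)))"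
        unfolding U_def by auto
      ultimately show ?thesis by (simp only: sets.Int)
    qed
    define V where "V = {\<xi> \<in> space (PiM ?C (\<lambda>_. borel :: real measure)). \<xi> (Suc n) = t}"
    have V: "V \<in> sets (PiM ?C (\<lambda>_. borel))"
    proof -
      have "(\<lambda>\<xi>. \<xi> (Suc n)) -` {t} \<inter> space (PiM ?C (\<lambda>_. borel :: real measure)) \<in> sets (PiM ?C (\<lambda>_. borel))"
        by (rule measurable_sets[OF measurable_component_singleton]) auto
      moreover have "V = (\<lambda>\<xi>. \<xi> (Suc n)) -` {t} \<inter> space (PiM ?C (\<lambda>_. borel))"
        unfolding V_def by auto
      ultimately show ?thesis by simp
    qed
    have EU: "(\<lambda>\<omega>. restrict (\<lambda>i. X i \<omega>) ?A) -` U \<inter> space M = E n s"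
    proof -
      have "?w k (restrict (\<lambda>i. X i \<omega>) ?A) = walk X k \<omega>" if "k \<le> n" for k \<omega>
        unfolding walk_def using that by (intro sum.cong) auto
      then show ?thesis unfolding U_def E_def by (auto simp: space_PiM)
    qed
    have XV: "(\<lambda>\<omega>. restrict (\<lambda>i. X i \<omega>) ?C) -` V \<inter> space M = {\<omega> \<in> space M. X (Suc n) \<omega> = t}"
      unfolding V_def by (auto simp: space_PiM)
    have "(\<lambda>\<omega>. (restrict (\<lambda>i. X i \<omega>) ?A, restrict (\<lambda>i. X i \<omega>) ?C)) -` (U \<times> V) \<inter> space M
       = ((\<lambda>\<omega>. restrict (\<lambda>i. X i \<omega>) ?A) -` U \<inter> space M) \<inter> ((\<lambda>\<omega>. restrict (\<lambda>i. X i \<omega>) ?C) -` V \<inter> space M)"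
      by auto
    then have "prob (E n s \<inter> {\<omega> \<in> space M. X (Suc n) \<omega> = t}) = prob (E n s) * prob {\<omega> \<in> space M. X (Suc n) \<omega> = t}"
      using indep_varD[OF iv U V] unfolding EU XV by simp
    then show ?thesis using Xf[of "Suc n" t] by (simp add: emeasure_eq_measure ennreal_mult)
  qed
  have "emeasure M (E n x) = dens (count_on G) f B n y (y - x)"
    using n x
  proof (induction n arbitrary: x rule: dec_induct)
    case base
    have "E 1 x = {\<omega> \<in> space M. X 1 \<omega> = x}" using y by (auto simp: E_def walk_def)
    then show ?case using Xf[of 1 x] y base by simp
  next
    case (step n)
    define D where "D = (\<lambda>s. E n s \<inter> {\<omega> \<in> space M. X (Suc n) \<omega> = x - s})"
    define S where "S = {s \<in> G. y - s \<in> B}"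
    have S: "countable S" using G(1) by (rule countable_subset[rotated]) (auto simp: S_def)
    \<comment> \<open>The two events agree only up to a null set: the previous position
      \<open>x - X (Suc n) \<omega>\<close> lies in \<open>G\<close> only if the last increment
      does.\<close>
    have "emeasure M (E (Suc n) x) = emeasure M (\<Union>s\<in>S. D s)"
    proof (rule emeasure_eq_AE)
      show "AE \<omega> in M. \<omega> \<in> E (Suc n) x \<longleftrightarrow> \<omega> \<in> (\<Union>s\<in>S. D s)"
        using XG[of "Suc n", simplified]
      proof eventually_elim
        case (elim \<omega>)
        show ?case
        proof
          assume w: "\<omega> \<in> E (Suc n) x"
          then have x': "walk X n \<omega> = x - X (Suc n) \<omega>" by (auto simp: E_def walk_Suc)
          then have "walk X n \<omega> \<in> G" using diff_in_G[OF step.prems(1) elim] by simp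
          moreover have "y - walk X n \<omega> \<in> B" using w by (auto simp: E_def)
          ultimately have "walk X n \<omega> \<in> S" by (simp add: S_def)
          moreover have "\<omega> \<in> D (walk X n \<omega>)" using w x' by (auto simp: E_def D_def)
          ultimately show "\<omega> \<in> (\<Union>s\<in>S. D s)" by blast
        next
          assume "\<omega> \<in> (\<Union>s\<in>S. D s)"
          then show "\<omega> \<in> E (Suc n) x" by (auto simp: E_def D_def S_def walk_Suc less_Suc_eq)
        qed
      qed
      show "(\<Union>s\<in>S. D s) \<in> sets M" using S by (intro sets.countable_UN') (auto simp: D_def)
    qed measurable
    also have "\<dots> = (\<integral>\<^sup>+s. emeasure M (D s) \<partial>count_space S)"
      by (rule emeasure_UN_countable[OF _ S]) (auto simp: D_def disjoint_family_on_def E_def)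
    also have "\<dots> = (\<integral>\<^sup>+s. emeasure M (E n s) * ennreal (f (x - s)) \<partial>count_space S)"
      unfolding D_def indep ..
    also have "\<dots> = (\<integral>\<^sup>+s. dens (count_on G) f B n y (y - s) * ennreal (f (x - s)) \<partial>count_space S)"
      by (intro nn_integral_cong) (simp add: S_def step.IH)
    also have "\<dots> = (\<integral>\<^sup>+s. dens (count_on G) f B n y (y - s) * ennreal (f (x - s)) \<partial>count_space G)"
      by (intro nn_integral_count_space_eq) (auto simp: S_def dens_outside)
    also have "\<dots> = (\<integral>\<^sup>+s. dens (count_on G) f B n y (y - s) * ennreal (f (x - s)) \<partial>count_on G)"
      by (rule nn_integral_count_on[symmetric]) measurable
    also have "\<dots> = dens (count_on G) f B (Suc n) y (y - x)"
      using dens_Suc_shift[OF fm B step(1) y(1), of x] step.prems by simp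
    finally show ?case .
  qed
  then show ?thesis unfolding E_def .
qed

lemma walk_max_less_iff:
  assumes "y > 0" "n \<ge> 1"
  shows "walk_max X (n - 1) \<omega> < y \<longleftrightarrow> (\<forall>k<n. y - walk X k \<omega> \<in> {0<..})"
proof -
  have "walk_max X (n - 1) \<omega> < y \<longleftrightarrow> (\<forall>k\<in>{0..n - 1}. walk X k \<omega> < y)"
    unfolding walk_max_def by (subst Max_less_iff) auto
  moreover have "{0..n - 1} = {..<n}" using assms(2) by auto
  ultimately show ?thesis by auto
qed

end

section \<open>The conditional probability in the two cases\<close>

lemma (in prob_space) fourth_moment_walk_distr:
  assumes [measurable]: "X \<in> borel_measurable M"
    and "expectation X = 0" "expectation (\<lambda>\<omega>. (X \<omega>)\<^sup>2) = 1" "integrable M (\<lambda>\<omega>. \<bar>X \<omega>\<bar> ^ 4)"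
  shows "fourth_moment_walk (distr M borel X)"
proof -
  interpret D: real_distribution "distr M borel X" by (rule real_distribution_distr) simp
  show ?thesis
  proof
    show "integrable (distr M borel X) (\<lambda>x. x ^ 4)"
      using assms(4) by (subst integrable_distr_eq) auto
    show "(\<integral>x. x \<partial>distr M borel X) = 0" using assms(2) by (subst integral_distr) auto
    show "(\<integral>x. x\<^sup>2 \<partial>distr M borel X) = 1" using assms(3) by (subst integral_distr) auto
  qed
qed

text \<open>Links the two halves of the lattice hypothesis: some lattice carries the law, and the
  atoms lie in the lattice given by \<open>\<gamma>\<close> and \<open>d\<close>. As the atoms carry
  everything, the given lattice carries the law.\<close>

lemma (in real_distribution) atoms_carry_discrete:
  assumes C: "countable C" "AE x in M. x \<in> C"
  shows "AE x in M. 0 < measure M {x}"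
proof -
  let ?N = "{x \<in> C. measure M {x} = 0}"
  have "countable ?N" using C(1) by (rule countable_subset[rotated]) auto
  then have "(\<Union>x\<in>?N. {x}) \<in> null_sets M"
    by (intro null_sets_UN') (auto simp: null_sets_def emeasure_eq_measure)
  then have "AE x in M. x \<notin> (\<Union>x\<in>?N. {x})" by (rule AE_not_in)
  with C(2) show ?thesis
    by eventually_elim (auto simp: less_le)
qed

lemma (in prob_space) conditional_limit_continuous:
  assumes X [measurable]: "X 1 \<in> borel_measurable M" and walk: "fourth_moment_walk (distr M borel (X 1))"
    and C: "hyp_C M X f" and R: "cond_prob_C f R"
    and y: "filterlim y at_top sequentially" "(\<lambda>n. y n / sqrt (real n)) \<longlonglongrightarrow> 0"
    and z: "filterlim z at_top sequentially" "(\<lambda>n. z n / sqrt (real n)) \<longlonglongrightarrow> 0"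
  shows "(\<lambda>n. R n (y n - z n) (y n) / (2 * y n * z n / real n)) \<longlonglongrightarrow> 1"
proof -
  have f0: "\<And>x. 0 \<le> f x" and dist: "distributed M lborel (X 1) (\<lambda>x. ennreal (f x))"
    using C unfolding hyp_C_def Let_def by auto
  have "(\<lambda>x. enn2real (ennreal (f x))) \<in> borel_measurable borel"
    using distributed_borel_measurable[OF dist] by measurable
  then have f [measurable]: "f \<in> borel_measurable borel" using f0 by simp
  have dens: "density lborel (\<lambda>x. ennreal (f x)) = distr M borel (X 1)"
    using distributed_distr_eq_density[OF dist] by (metis distr_cong sets_lborel)
  obtain n0 where n0: "n0 \<ge> 1" "integrable lborel (\<lambda>t. cmod (char (distr M borel (X 1)) t) ^ n0)"
    using C unfolding hyp_C_def Let_def by auto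
  interpret I: inversion_walk lborel UNIV f "\<lambda>_. UNIV" 1 UNIV n0
    using walk n0 f0 unfolding dens[symmetric] by (intro inversion_walk_lborel f) auto
  interpret W: llt_walk lborel UNIV f "\<lambda>_. UNIV" 1 by (rule I.llt_walk)
  have G: "\<forall>\<^sub>F n in sequentially. y n \<in> UNIV \<and> z n \<in> UNIV \<and> y n - z n \<in> UNIV" by simp
  note lim = W.density_ratio_limit[OF G y z]
  have "\<forall>\<^sub>F n in sequentially. enn2real (I.q n (y n) (z n)) / enn2real (I.p n (y n) (z n)) / (2 * y n * z n / real n)
      = R n (y n - z n) (y n) / (2 * y n * z n / real n)"
    using lim(2) eventually_ge_at_top[of 1] filterlim_at_top_dense[THEN iffD1, OF y(1), rule_format, of 0]
      filterlim_at_top_dense[THEN iffD1, OF z(1), rule_format, of 0]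
  proof eventually_elim
    case (elim n)
    have p: "conv_pow f n (y n - z n) = I.p n (y n) (z n)"
      using conv_pow_eq_dens[OF f elim(2), of "y n - z n" "y n"] by simp
    have q: "restr_density f n (y n - z n) (y n) = I.q n (y n) (z n)"
      using restr_density_eq_dens[OF f elim(2,3), of "y n - z n"] elim(4) by simp
    \<comment> \<open>Eventually the convolution is positive and finite at this point, so the clause
      of \<open>cond_prob_C\<close> that determines \<open>R\<close> applies.\<close>
    have "R n (y n - z n) (y n) = enn2real (I.q n (y n) (z n) / I.p n (y n) (z n))"
      using R elim unfolding cond_prob_C_def p[symmetric] q[symmetric] by auto
    also have "\<dots> = enn2real (I.q n (y n) (z n)) / enn2real (I.p n (y n) (z n))"
      using elim by (intro enn2real_divide_finite I.q_le_p) auto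
    finally show ?case by simp
  qed
  with lim(1) show ?thesis by (rule Lim_transform_eventually)
qed

lemma (in prob_space) conditional_limit_lattice:
  assumes ind: "indep_vars (\<lambda>_. borel) X {1..}"
    and dist: "\<And>i. i \<ge> 1 \<Longrightarrow> distr M borel (X i) = distr M borel (X 1)"
    and walk: "fourth_moment_walk (distr M borel (X 1))"
    and L: "hyp_L M X f \<gamma> d" and R: "cond_prob_L M X R"
    and yL: "\<And>n. n \<ge> 1 \<Longrightarrow> y n \<in> lattice_set (real n * \<gamma>) d"
    and yzL: "\<And>n. n \<ge> 1 \<Longrightarrow> y n - z n \<in> lattice_set (real n * \<gamma>) d"
    and y: "filterlim y at_top sequentially" "(\<lambda>n. y n / sqrt (real n)) \<longlonglongrightarrow> 0"
    and z: "filterlim z at_top sequentially" "(\<lambda>n. z n / sqrt (real n)) \<longlonglongrightarrow> 0"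
  shows "(\<lambda>n. R n (y n - z n) (y n) / (2 * y n * z n / real n)) \<longlonglongrightarrow> 1"
proof -
  have X [measurable]: "X 1 \<in> borel_measurable M" using ind unfolding indep_vars_def by auto
  define \<mu> where "\<mu> = distr M borel (X 1)"
  interpret D: fourth_moment_walk \<mu> unfolding \<mu>_def by (rule walk)
  define G where "G = lattice_group \<gamma> d"
  have d: "d > 0" and f: "\<And>x. f x = prob {\<omega> \<in> space M. X 1 \<omega> = x}" and supp: "{x. f x > 0} \<subseteq> lattice_set \<gamma> d"
    and span: "\<And>\<gamma>' d'. d < d' \<Longrightarrow> \<not> {x. f x > 0} \<subseteq> lattice_set \<gamma>' d'"
    and lat: "lattice_distribution \<mu>"
    using L unfolding hyp_L_def \<mu>_def by auto
  have f\<mu>: "f x = measure \<mu> {x}" for x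
  proof -
    have "measure \<mu> {x} = prob (X 1 -` {x} \<inter> space M)"
      unfolding \<mu>_def by (rule measure_distr[OF X]) simp
    also have "X 1 -` {x} \<inter> space M = {\<omega> \<in> space M. X 1 \<omega> = x}" by auto
    finally show ?thesis by (simp only: f)
  qed
  have LG: "lattice_set (real n * \<gamma>) d \<subseteq> G" for n unfolding G_def by (rule lattice_set_subset_group)
  have f0: "0 \<le> f x" for x by (simp add: f)
  have fm [measurable]: "f \<in> borel_measurable borel"
  proof (rule measurable_discrete_difference[where f = "\<lambda>_. 0"])
    show "countable (lattice_set \<gamma> d)" by (rule countable_lattice_set)
    show "0 = f x" if "x \<notin> lattice_set \<gamma> d" for x using supp f0[of x] that by (force simp: less_le)
  qed auto
  have cG: "countable G" unfolding G_def by (rule countable_lattice_group)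
  have aeG: "AE x in \<mu>. x \<in> G"
  proof -
    obtain \<gamma>' d' where "AE x in \<mu>. x \<in> lattice_set \<gamma>' d'" using lat unfolding lattice_distribution_def by blast
    from D.atoms_carry_discrete[OF countable_lattice_set this] show ?thesis
      by eventually_elim (use supp LG[of 1] f\<mu> in auto)
  qed
  have dens: "density (count_on G) (\<lambda>x. ennreal (f x)) = \<mu>"
    by (rule D.discrete_density[OF cG aeG f\<mu> fm])
  interpret I: inversion_walk "count_on G" G f "\<lambda>n. lattice_set (real n * \<gamma>) d" d "{- (pi / d)..pi / d}" 1
    unfolding G_def using fm f0 d supp span
    by (intro inversion_walk_lattice) (use D.fourth_moment_walk_axioms dens in \<open>simp_all add: G_def\<close>)
  interpret W: llt_walk "count_on G" G f "\<lambda>n. lattice_set (real n * \<gamma>) d" d by (rule I.llt_walk)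
  have yzG: "y n \<in> G" "y n - z n \<in> G" "z n \<in> G" if "n \<ge> 1" for n
  proof -
    show "y n \<in> G" "y n - z n \<in> G" using yL[OF that] yzL[OF that] LG by auto
    then show "z n \<in> G" using I.diff_in_G[of "y n" "y n - z n"] by simp
  qed
  have G: "\<forall>\<^sub>F n in sequentially. y n \<in> G \<and> z n \<in> G \<and> y n - z n \<in> lattice_set (real n * \<gamma>) d"
    using eventually_ge_at_top[of 1] by eventually_elim (use yzG yzL in auto)
  note lim = W.density_ratio_limit[OF G y z]
  have XG: "AE \<omega> in M. X 1 \<omega> \<in> G"
  proof -
    have [measurable]: "G \<in> sets borel" using cG by (rule sets.countable[rotated]) auto
    show ?thesis using aeG unfolding \<mu>_def by (subst (asm) AE_distr_iff[OF X]) auto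
  qed
  note path = path_probability[OF ind dist f fm I.group_measure_axioms cG XG]
  have "\<forall>\<^sub>F n in sequentially. enn2real (I.q n (y n) (z n)) / enn2real (I.p n (y n) (z n)) / (2 * y n * z n / real n)
      = R n (y n - z n) (y n) / (2 * y n * z n / real n)"
    using lim(2) eventually_ge_at_top[of 1] filterlim_at_top_dense[THEN iffD1, OF y(1), rule_format, of 0]
      filterlim_at_top_dense[THEN iffD1, OF z(1), rule_format, of 0]
  proof eventually_elim
    case (elim n)
    have p: "emeasure M {\<omega> \<in> space M. walk X n \<omega> = y n - z n} = I.p n (y n) (z n)"
      using path[of UNIV "y n" n "y n - z n"] yzG[OF elim(2)] elim(2) by simp
    have q: "emeasure M {\<omega> \<in> space M. walk_max X (n - 1) \<omega> < y n \<and> walk X n \<omega> = y n - z n} = I.q n (y n) (z n)"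
      using path[of "{0<..}" "y n" n "y n - z n"] yzG[OF elim(2)] elim
      unfolding walk_max_less_iff[OF elim(3,2)] by simp
    have p': "prob {\<omega> \<in> space M. walk X n \<omega> = y n - z n} = enn2real (I.p n (y n) (z n))"
      unfolding p[symmetric] by (simp add: measure_def)
    have "prob {\<omega> \<in> space M. walk X n \<omega> = y n - z n} > 0"
      unfolding p' using elim(1) by (simp add: enn2real_positive_iff)
    then have "R n (y n - z n) (y n) = \<P>(\<omega> in M. walk_max X (n - 1) \<omega> < y n \<bar> walk X n \<omega> = y n - z n)"
      using R elim(2) unfolding cond_prob_L_def by auto
    also have "\<dots> = enn2real (I.q n (y n) (z n)) / enn2real (I.p n (y n) (z n))"
      unfolding cond_prob_def p' q[symmetric] by (simp add: measure_def)
    finally show ?case by simp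
  qed
  with lim(1) show ?thesis by (rule Lim_transform_eventually)
qed

theorem corollary2:
  fixes M :: "'a measure" and X :: "nat \<Rightarrow> 'a \<Rightarrow> real"
    and f :: "real \<Rightarrow> real" and \<gamma> d :: real
    and L :: "nat \<Rightarrow> real set" and R :: "nat \<Rightarrow> real \<Rightarrow> real \<Rightarrow> real"
    and y z :: "nat \<Rightarrow> real"
  assumes "prob_space M"
    and "prob_space.indep_vars M (\<lambda>_. borel) X {1..}"
    and "\<forall>i\<ge>1. distr M borel (X i) = distr M borel (X 1)"
    and "prob_space.expectation M (X 1) = 0"
    and "prob_space.expectation M (\<lambda>\<omega>. (X 1 \<omega>)\<^sup>2) = 1"
    and "integrable M (\<lambda>\<omega>. \<bar>X 1 \<omega>\<bar> ^ 4)"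
    and "(hyp_C M X f \<and> (\<forall>n\<ge>1. L n = UNIV) \<and> cond_prob_C f R) \<or>
         (hyp_L M X f \<gamma> d \<and> (\<forall>n\<ge>1. L n = lattice_set (real n * \<gamma>) d) \<and> cond_prob_L M X R)"
    and "\<forall>n\<ge>1. y n \<in> L n"
    and "\<forall>n\<ge>1. y n - z n \<in> L n"
    and "filterlim y at_top sequentially"
    and "y \<in> o(\<lambda>n. sqrt (real n))"
    and "filterlim z at_top sequentially"
    and "z \<in> o(\<lambda>n. sqrt (real n))"
  shows "(\<lambda>n. R n (y n - z n) (y n) / (2 * y n * z n / real n)) \<longlonglongrightarrow> 1"
proof -
  interpret prob_space M by fact
  have X [measurable]: "X 1 \<in> borel_measurable M" using assms(2) unfolding indep_vars_def by auto
  have walk: "fourth_moment_walk (distr M borel (X 1))"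
    by (rule fourth_moment_walk_distr[OF X assms(4-6)])
  have y: "(\<lambda>n. y n / sqrt (real n)) \<longlonglongrightarrow> 0" and z: "(\<lambda>n. z n / sqrt (real n)) \<longlonglongrightarrow> 0"
    using assms(11,13) by (auto dest: smalloD_tendsto)
  from assms(7) show ?thesis
  proof
    assume "hyp_C M X f \<and> (\<forall>n\<ge>1. L n = UNIV) \<and> cond_prob_C f R"
    then have "hyp_C M X f" "cond_prob_C f R" by auto
    then show ?thesis
      by (rule conditional_limit_continuous[where X = X and R = R and y = y and z = z, OF X walk _ _ assms(10) y assms(12) z])
  next
    assume L: "hyp_L M X f \<gamma> d \<and> (\<forall>n\<ge>1. L n = lattice_set (real n * \<gamma>) d) \<and> cond_prob_L M X R"
    show ?thesis
    proof (rule conditional_limit_lattice[where X = X and R = R and y = y and z = z, OF assms(2) _ walk _ _ _ _ assms(10) y assms(12) z])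
      show "distr M borel (X i) = distr M borel (X 1)" if "i \<ge> 1" for i
        using assms(3) that by blast
      show "y n \<in> lattice_set (real n * \<gamma>) d" "y n - z n \<in> lattice_set (real n * \<gamma>) d" if "n \<ge> 1" for n
        using L assms(8,9) that by auto
    qed (use L in auto)
  qed
qed

end
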